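(* Let $(h_j)_j\subset\mathcal{H}$ be a sequence. Then there exist a subsequence (not relabelled) and $h\in\mathcal{H}$ such that $h_j\rightharpoonup h$ weakly-$\ast$ in $L^\infty(\mathbb{R}^N\times\mathbb{R}^N)$ and $(\mathcal{L}_{h_j})_j$ $H$-converges to $\mathcal{L}_h$ as $j\to\infty$.
   Context: Let $\Omega\subset\mathbb{R}^N$ be a bounded open smooth domain, let $1<p<\infty$ and $p'=p/(p-1)$. Let $k$ be a radial and positive function in $L^1(\mathbb{R}^N)$ (written $k(|z|)$, $z\in\mathbb{R}^N$) such that $\int_{\mathbb{R}^N\setminus B(0,\epsilon)}\frac{k(|z|)}{|z|^p}\,dz<\infty$ for every $\epsilon>0$, where $B(0,\epsilon)$ is the open ball of radius $\epsilon$ centred at $0$, and $k(|z|)\ge \frac{c_0}{|z|^{N+(s-1)p}}$ for all $z\in\mathbb{R}^N\setminus\{0\}$, where $c_0>0$ and $s\in(0,1)$ are given constants. Put $B(w,w)=\int_{\mathbb{R}^N}\int_{\mathbb{R}^N}k(|x'-x|)\frac{|w(x')-w(x)|^p}{|x'-x|^p}\,dx'dx$, $X=\{w\in L^p(\mathbb{R}^N): B(w,w)<\infty\}$ and $X_0=\{w\in X: w=0\text{ a.e. in }\mathbb{R}^N\setminus\Omega\}$, normed by $\|w\|_{X_0}=B(w,w)^{1/p}$ (equivalent on $X_0$ to $\|w\|_{L^p(\mathbb{R}^N)}+B(w,w)^{1/p}$). $X_0'$ is its dual and $\langle\cdot,\cdot\rangle$ the duality pairing between $X_0'$ and $X_0$.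 All functions are real-valued. Fix constants $0<h_{\min}<h_{\max}$; $\mathcal{H}$ is the set of $h\in L^\infty(\mathbb{R}^N\times\mathbb{R}^N)$ with $h(x',x)=h(x,x')\in[h_{\min},h_{\max}]$ for a.e. $(x',x)$. For $h\in\mathcal{H}$ and $u,v\in X_0$, $$B_h(u,v)=\int_{\mathbb{R}^N}\int_{\mathbb{R}^N}h(x',x)\,k(|x'-x|)\,\frac{|u(x')-u(x)|^{p-2}(u(x')-u(x))(v(x')-v(x))}{|x'-x|^p}\,dx'dx ,$$ and the operator $\mathcal{L}_h:X_0\to X_0'$ is defined by $\langle\mathcal{L}_hu,v\rangle=B_h(u,v)$. For every $f\in X_0'$ there is a unique $u\in X_0$ with $\mathcal{L}_hu=f$, i.e. $B_h(u,v)=\langle f,v\rangle$ for all $v\in X_0$; it is denoted $\mathcal{L}_h^{-1}f$. The nonlocal flux associated with $h$ (and $f$) is $$\Psi_h(x',x)=h(x',x)\,k(|x'-x|)^{1/p'}\,\frac{|u(x')-u(x)|^{p-2}(u(x')-u(x))}{|x'-x|^{p-1}},\qquad u=\mathcal{L}_h^{-1}f .$$ $H$-convergence: $(\mathcal{L}_{h_j})_j$ $H$-converges to $\mathcal{L}_h$ if for every $f\in X_0'$, as $j\to\infty$: (1) $\mathcal{L}_{h_j}^{-1}f\rightharpoonup\mathcal{L}_h^{-1}f$ weakly in $X_0$; and (2) $\Psi_{h_j}\rightharpoonup\Psi_h$ weakly in $L^{p'}(\mathbb{R}^N\times\mathbb{R}^N)$.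
   Formalization: The kernel k is assumed only locally integrable instead of in L^1(R^N), because k in L^1(R^N) contradicts the lower bound k(|z|) ≥ c_0/|z|^{N+(s-1)p} for all z ≠ 0 with s<1, which is not integrable at infinity. *)

theory Defs
  imports "HOL-Analysis.Analysis"
begin

text \<open>
  The space R^N is an arbitrary Euclidean space \<open>'a\<close> of dimension \<open>N = DIM('a)\<close>.  Function spaces
  consist of Borel measurable representatives, and functions that agree almost everywhere are not
  identified; the norms below are therefore only seminorms on representatives, and bounded linear
  functionals automatically respect equality almost everywhere.
\<close>

section \<open>Smooth domains\<close>

fun C_k :: "nat \<Rightarrow> ('a::euclidean_space \<Rightarrow> real) \<Rightarrow> bool" where
  "C_k 0 g = continuous_on UNIV g"
| "C_k (Suc m) g = ((\<forall>x. g differentiable (at x)) \<and>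
     (\<forall>b\<in>Basis. C_k m (\<lambda>x. frechet_derivative g (at x) b)))"

definition C_infinity :: "('a::euclidean_space \<Rightarrow> real) \<Rightarrow> bool" where
  "C_infinity g \<longleftrightarrow> (\<forall>m. C_k m g)"

text \<open>
  Near each boundary point the domain is the region above a smooth graph over the hyperplane
  orthogonal to a unit vector \<open>e\<close>, which plays the role of the last coordinate direction.  Only
  the values of \<open>\<gamma>\<close> on that hyperplane matter.
\<close>
definition smooth_boundary :: "'a::euclidean_space set \<Rightarrow> bool" where
  "smooth_boundary \<Omega> \<longleftrightarrow>
     (\<forall>x0\<in>frontier \<Omega>. \<exists>r>0. \<exists>e \<gamma>. norm e = 1 \<and> C_infinity \<gamma> \<and>
        \<Omega> \<inter> ball x0 r = {x \<in> ball x0 r. \<gamma> (x - (x \<bullet> e) *\<^sub>R e) < x \<bullet> e})"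

definition bounded_smooth_domain :: "'a::euclidean_space set \<Rightarrow> bool" where
  "bounded_smooth_domain \<Omega> \<longleftrightarrow>
     open \<Omega> \<and> connected \<Omega> \<and> \<Omega> \<noteq> {} \<and> bounded \<Omega> \<and> smooth_boundary \<Omega>"

section \<open>Lebesgue spaces, duals and weak convergence\<close>

definition Lp_space :: "real \<Rightarrow> ('b::euclidean_space \<Rightarrow> real) set" where
  "Lp_space q = {g \<in> borel_measurable lborel. integrable lborel (\<lambda>z. \<bar>g z\<bar> powr q)}"

definition Lp_norm :: "real \<Rightarrow> ('b::euclidean_space \<Rightarrow> real) \<Rightarrow> real" where
  "Lp_norm q g = (\<integral>z. \<bar>g z\<bar> powr q \<partial>lborel) powr (1 / q)"

definition Linfty_space :: "('b::euclidean_space \<Rightarrow> real) set" where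
  "Linfty_space = {g \<in> borel_measurable lborel. \<exists>C. AE z in lborel. \<bar>g z\<bar> \<le> C}"

definition dual_space ::
  "('b \<Rightarrow> real) set \<Rightarrow> (('b \<Rightarrow> real) \<Rightarrow> real) \<Rightarrow> (('b \<Rightarrow> real) \<Rightarrow> real) set" where
  "dual_space V nrm = {\<phi>.
     (\<forall>u\<in>V. \<forall>v\<in>V. \<phi> (\<lambda>x. u x + v x) = \<phi> u + \<phi> v) \<and>
     (\<forall>c. \<forall>u\<in>V. \<phi> (\<lambda>x. c * u x) = c * \<phi> u) \<and>
     (\<exists>C. \<forall>u\<in>V. \<bar>\<phi> u\<bar> \<le> C * nrm u)}"

definition weakly_converges ::
  "('b \<Rightarrow> real) set \<Rightarrow> (('b \<Rightarrow> real) \<Rightarrow> real) \<Rightarrow> (nat \<Rightarrow> 'b \<Rightarrow> real) \<Rightarrow> ('b \<Rightarrow> real) \<Rightarrow> bool" where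
  "weakly_converges V nrm w w0 \<longleftrightarrow>
     (\<forall>j. w j \<in> V) \<and> w0 \<in> V \<and> (\<forall>\<phi>\<in>dual_space V nrm. (\<lambda>j. \<phi> (w j)) \<longlonglongrightarrow> \<phi> w0)"

definition weakly_star_converges_Linfty ::
  "(nat \<Rightarrow> 'b::euclidean_space \<Rightarrow> real) \<Rightarrow> ('b \<Rightarrow> real) \<Rightarrow> bool" where
  "weakly_star_converges_Linfty w w0 \<longleftrightarrow>
     (\<forall>j. w j \<in> Linfty_space) \<and> w0 \<in> Linfty_space \<and>
     (\<forall>g. integrable lborel g \<longrightarrow>
        (\<lambda>j. \<integral>z. w j z * g z \<partial>lborel) \<longlonglongrightarrow> (\<integral>z. w0 z * g z \<partial>lborel))"

section \<open>Nonlocal energy spaces\<close>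

text \<open>
  The kernel is given by its radial profile \<open>k :: real \<Rightarrow> real\<close>; the kernel itself is
  \<open>\<lambda>z. k (norm z)\<close>.  Points of \<open>'a \<times> 'a\<close> are written in the order \<open>(x', x)\<close>.  On the diagonal, a
  null set, the integrands take the value 0.
\<close>

definition energy :: "real \<Rightarrow> (real \<Rightarrow> real) \<Rightarrow> ('a::euclidean_space \<Rightarrow> real) \<Rightarrow> ennreal" where
  "energy p k w = (\<integral>\<^sup>+(x', x). ennreal (k (norm (x' - x)) *
       (\<bar>w x' - w x\<bar> powr p / norm (x' - x) powr p)) \<partial>(lborel :: ('a \<times> 'a) measure))"

definition X_space :: "real \<Rightarrow> (real \<Rightarrow> real) \<Rightarrow> ('a::euclidean_space \<Rightarrow> real) set" where
  "X_space p k = {w \<in> Lp_space p. energy p k w < \<infinity>}"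

definition X0_space ::
  "real \<Rightarrow> (real \<Rightarrow> real) \<Rightarrow> 'a::euclidean_space set \<Rightarrow> ('a \<Rightarrow> real) set" where
  "X0_space p k \<Omega> = {w \<in> X_space p k. AE x in lborel. x \<notin> \<Omega> \<longrightarrow> w x = 0}"

definition X0_norm :: "real \<Rightarrow> (real \<Rightarrow> real) \<Rightarrow> ('a::euclidean_space \<Rightarrow> real) \<Rightarrow> real" where
  "X0_norm p k w = enn2real (energy p k w) powr (1 / p)"

definition X0_dual ::
  "real \<Rightarrow> (real \<Rightarrow> real) \<Rightarrow> 'a::euclidean_space set \<Rightarrow> (('a \<Rightarrow> real) \<Rightarrow> real) set" where
  "X0_dual p k \<Omega> = dual_space (X0_space p k \<Omega>) (X0_norm p k)"

section \<open>The operators, fluxes and H-convergence\<close>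

definition H_class :: "real \<Rightarrow> real \<Rightarrow> ('a::euclidean_space \<times> 'a \<Rightarrow> real) set" where
  "H_class hmin hmax = {h \<in> Linfty_space.
     AE (x', x) in lborel. h (x', x) = h (x, x') \<and> hmin \<le> h (x', x) \<and> h (x', x) \<le> hmax}"

definition B_form ::
  "real \<Rightarrow> (real \<Rightarrow> real) \<Rightarrow> ('a::euclidean_space \<times> 'a \<Rightarrow> real) \<Rightarrow>
   ('a \<Rightarrow> real) \<Rightarrow> ('a \<Rightarrow> real) \<Rightarrow> real" where
  "B_form p k h u v = (\<integral>(x', x). h (x', x) * k (norm (x' - x)) *
     ((\<bar>u x' - u x\<bar> powr (p - 2) * (u x' - u x) * (v x' - v x)) / norm (x' - x) powr p) \<partial>lborel)"

definition L_op ::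
  "real \<Rightarrow> (real \<Rightarrow> real) \<Rightarrow> ('a::euclidean_space \<times> 'a \<Rightarrow> real) \<Rightarrow>
   ('a \<Rightarrow> real) \<Rightarrow> (('a \<Rightarrow> real) \<Rightarrow> real)" where
  "L_op p k h u = (\<lambda>v. B_form p k h u v)"

text \<open>
  The solution is unique only up to equality almost everywhere, so a representative is chosen.
\<close>
definition L_inv ::
  "real \<Rightarrow> (real \<Rightarrow> real) \<Rightarrow> 'a::euclidean_space set \<Rightarrow> ('a \<times> 'a \<Rightarrow> real) \<Rightarrow>
   (('a \<Rightarrow> real) \<Rightarrow> real) \<Rightarrow> ('a \<Rightarrow> real)" where
  "L_inv p k \<Omega> h f =
     (SOME u. u \<in> X0_space p k \<Omega> \<and> (\<forall>v\<in>X0_space p k \<Omega>. L_op p k h u v = f v))"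

definition conj_exp :: "real \<Rightarrow> real" where
  "conj_exp p = p / (p - 1)"

definition flux ::
  "real \<Rightarrow> (real \<Rightarrow> real) \<Rightarrow> 'a::euclidean_space set \<Rightarrow> ('a \<times> 'a \<Rightarrow> real) \<Rightarrow>
   (('a \<Rightarrow> real) \<Rightarrow> real) \<Rightarrow> ('a \<times> 'a \<Rightarrow> real)" where
  "flux p k \<Omega> h f = (\<lambda>(x', x). let u = L_inv p k \<Omega> h f in
     h (x', x) * k (norm (x' - x)) powr (1 / conj_exp p) *
     ((\<bar>u x' - u x\<bar> powr (p - 2) * (u x' - u x)) / norm (x' - x) powr (p - 1)))"

definition H_converges ::
  "real \<Rightarrow> (real \<Rightarrow> real) \<Rightarrow> 'a::euclidean_space set \<Rightarrow>
   (nat \<Rightarrow> 'a \<times> 'a \<Rightarrow> real) \<Rightarrow> ('a \<times> 'a \<Rightarrow> real) \<Rightarrow> bool" where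
  "H_converges p k \<Omega> hs h \<longleftrightarrow>
     (\<forall>f\<in>X0_dual p k \<Omega>.
        weakly_converges (X0_space p k \<Omega>) (X0_norm p k)
          (\<lambda>j. L_inv p k \<Omega> (hs j) f) (L_inv p k \<Omega> h f) \<and>
        weakly_converges (Lp_space (conj_exp p)) (Lp_norm (conj_exp p))
          (\<lambda>j. flux p k \<Omega> (hs j) f) (flux p k \<Omega> h f))"

section \<open>Admissible kernels\<close>

text \<open>
  The kernel is only required to be locally integrable.  Integrability over all of \<open>'a\<close> would be
  incompatible with the lower bound: since \<open>s < 1\<close>, the exponent \<open>N + (s - 1) p\<close> is smaller
  than \<open>N\<close>, so the lower bound is not integrable at infinity.  The model case
  \<open>k r = 1 / r powr (N + (s - 1) p)\<close>, that of the fractional p-Laplacian, is admissible.  No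
  condition is put on \<open>k 0\<close>, since kernels are typically singular at the origin.
\<close>
definition admissible_kernel ::
  "'a::euclidean_space itself \<Rightarrow> real \<Rightarrow> real \<Rightarrow> real \<Rightarrow> (real \<Rightarrow> real) \<Rightarrow> bool" where
  "admissible_kernel T p s c0 k \<longleftrightarrow>
     (\<forall>r>0. 0 < k r) \<and>
     (\<forall>K::'a set. compact K \<longrightarrow> set_integrable lborel K (\<lambda>z. k (norm z))) \<and>
     (\<forall>\<epsilon>>0. set_integrable lborel (- ball (0::'a) \<epsilon>) (\<lambda>z. k (norm z) / norm z powr p)) \<and>
     (\<forall>z::'a. z \<noteq> 0 \<longrightarrow> k (norm z) \<ge> c0 / norm z powr (real DIM('a) + (s - 1) * p))"

end

theory Submission
  imports Defs "HOL-Library.Diagonal_Subsequence"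
begin

text \<open>
  Weak-star compactness of bounded sets in \<open>L^\<infinity>\<close> gives a subsequence of the coefficients with a weak-star
  limit \<open>h\<close>, and the bounds and the symmetry of the coefficients pass to \<open>h\<close>. The same \<open>h\<close> is the H-limit,
  in contrast to homogenisation of differential operators: the equation contains no derivatives, only
  increments, and these converge almost everywhere because the energy space embeds compactly into \<open>L^p\<close>.

  Let \<open>u j\<close> solve the equation with coefficient \<open>h j\<close> and a fixed right-hand side. The energies of the
  \<open>u j\<close> are bounded (\<open>solution_bound\<close>), so by compactness (\<open>X0_compact\<close>) a subsequence converges almost
  everywhere, and with it the difference quotients \<open>D (u j) (x', x) = k^(1/p) (u j x' - u j x) / |x' - x|\<close>. The
  nonlinear expression \<open>|D (u j)|^(p-2) D (u j)\<close> is bounded in \<open>L^p'\<close> and converges almost everywhere, hence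
  its product with any fixed function of \<open>L^p\<close> converges strongly in \<open>L^1\<close>
  (\<open>integral_abs_diff_mult_tendsto_0\<close>), and this strong convergence may be paired with the weak-star
  convergence of \<open>h j\<close>. So the limit solves the equation with coefficient \<open>h\<close>. As that equation has only one
  solution, the whole sequence converges, and the fluxes converge weakly
  (\<open>weak_star_imp_H_converges\<close>).

  Existence of solutions, the duality of \<open>L^p\<close> and \<open>L^p'\<close>, the dual of the energy space and the weak
  compactness of \<open>L^2\<close>, from which weak-star compactness is derived, all come from one theorem
  (\<open>representation\<close>): a bounded functional on a complete space normed by \<open>(\<integral> |D u|^q)^(1/q)\<close> is represented by
  the minimiser of a strictly convex integral. Minimising sequences converge in norm by a
  quantitative form of strict convexity (\<open>clarkson_eps\<close>).

  Compactness rests on the lower bound for the kernel. It controls the deviation of a function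
  from its means over small cubes (\<open>mean_deviation_le\<close>, \<open>compactness_estimate\<close>), and the finitely many
  means over the cubes that cover \<open>\<Omega>\<close> converge along a subsequence.
\<close>

section \<open>Scalar inequalities for signed powers\<close>

text \<open>
  The map \<open>t \<mapsto> |t|^(q-2) t\<close>, the derivative of \<open>|t|^q / q\<close>. It is the nonlinearity of the operator, and
  it carries \<open>L^q\<close> to the dual space \<open>L^q'\<close> with \<open>q' = conj_exp q\<close>.
\<close>
definition spow :: "real \<Rightarrow> real \<Rightarrow> real" where
  "spow q t = \<bar>t\<bar> powr (q - 2) * t"

lemma spow_measurable [measurable]: "spow q \<in> borel_measurable borel"
  unfolding spow_def by measurable

lemma abs_spow: "\<bar>spow q t\<bar> = \<bar>t\<bar> powr (q - 1)"
proof (cases "t = 0")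
  case False
  then have "\<bar>t\<bar> powr (q - 1) = \<bar>t\<bar> powr (q - 2) * \<bar>t\<bar> powr 1"
    by (subst powr_add[symmetric]) simp
  then show ?thesis using False by (simp add: spow_def abs_mult)
qed (simp add: spow_def)

lemma spow_mult_self: "spow q t * t = \<bar>t\<bar> powr q"
proof (cases "t = 0")
  case False
  then have "\<bar>t\<bar> powr q = \<bar>t\<bar> powr (q - 2) * \<bar>t\<bar> powr 2"
    by (subst powr_add[symmetric]) simp
  then show ?thesis using False
    by (simp add: spow_def powr_numeral power2_eq_square)
qed (simp add: spow_def)

lemma abs_spow_powr_conj:
  assumes "q > 1" shows "\<bar>spow q t\<bar> powr (conj_exp q) = \<bar>t\<bar> powr q"
  using assms by (simp add: abs_spow powr_powr conj_exp_def)

lemma isCont_spow: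
  assumes "q > 1" shows "isCont (spow q) t"
proof (cases "t = 0")
  case True
  have "((\<lambda>x. \<bar>x\<bar> powr (q - 1)) \<longlongrightarrow> \<bar>0\<bar> powr (q - 1)) (at 0)"
    using assms by (intro tendsto_powr' tendsto_intros) auto
  then have "((\<lambda>x. \<bar>spow q x\<bar>) \<longlongrightarrow> 0) (at 0)" by (simp add: abs_spow)
  then have "(spow q \<longlongrightarrow> 0) (at 0)" by (rule tendsto_rabs_zero_cancel)
  then show ?thesis using True by (simp add: isCont_def spow_def)
next
  case False
  then show ?thesis unfolding spow_def by (intro continuous_intros) auto
qed

lemma tendsto_spow [tendsto_intros]:
  assumes "q > 1" "(f \<longlongrightarrow> a) F" shows "((\<lambda>x. spow q (f x)) \<longlongrightarrow> spow q a) F"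
  using isCont_tendsto_compose[OF isCont_spow[OF assms(1)] assms(2)] .

text \<open>
  For fixed \<open>y\<close> the function \<open>z^q - q z y^(q-1)\<close> has derivative \<open>q (z^(q-1) - y^(q-1))\<close>, so it has a
  strict minimum at \<open>z = y\<close>.
\<close>
lemma young_strict_nonneg:
  fixes x y q :: real
  assumes q: "q > 1" and "x \<ge> 0" "y \<ge> 0" "x \<noteq> y"
  shows "q * x * y powr (q - 1) < x powr q + (q - 1) * y powr q"
proof -
  consider "x = 0" | "y = 0" | "x > 0" "y > 0" using assms by linarith
  then show ?thesis
  proof cases
    case 3
    define F where "F z = z powr q - q * z * y powr (q - 1)" for z
    have D: "(F has_real_derivative q * z powr (q - 1) - q * y powr (q - 1)) (at z)" if "z > 0" for z
      unfolding F_def using that by (auto intro!: derivative_eq_intros)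
    have yq: "y * y powr (q - 1) = y powr q"
      using 3 by (simp add: powr_diff)
    have "F y < F x"
    proof (cases "x < y")
      case True
      obtain z where z: "x < z" "z < y" "F y - F x = (y - x) * (q * z powr (q - 1) - q * y powr (q - 1))"
        using MVT2[OF True, of F "\<lambda>z. q * z powr (q - 1) - q * y powr (q - 1)"] D 3 by force
      have "z powr (q - 1) < y powr (q - 1)" using z 3 q by (intro powr_less_mono2) auto
      then have "(y - x) * (q * z powr (q - 1) - q * y powr (q - 1)) < 0"
        using True q by (intro mult_pos_neg) (auto simp: mult_less_cancel_left)
      then show ?thesis using z by simp
    next
      case False
      then have "y < x" using assms by simp
      obtain z where z: "y < z" "z < x" "F x - F y = (x - y) * (q * z powr (q - 1) - q * y powr (q - 1))"
        using MVT2[OF \<open>y < x\<close>, of F "\<lambda>z. q * z powr (q - 1) - q * y powr (q - 1)"] D 3 by force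
      have "y powr (q - 1) < z powr (q - 1)" using z 3 q by (intro powr_less_mono2) auto
      then have "(x - y) * (q * z powr (q - 1) - q * y powr (q - 1)) > 0"
        using \<open>y < x\<close> q by (intro mult_pos_pos) (auto simp: mult_less_cancel_left)
      then show ?thesis using z by simp
    qed
    then show ?thesis using yq by (simp add: F_def algebra_simps)
  qed (use assms in auto)
qed

lemma young_nonneg:
  fixes x y q :: real
  assumes q: "q > 1" and "x \<ge> 0" "y \<ge> 0"
  shows "q * x * y powr (q - 1) \<le> x powr q + (q - 1) * y powr q"
proof (cases "x = y")
  case True
  have "x * x powr (q - 1) = x powr q"
    using assms by (cases "x = 0") (auto simp: powr_diff)
  then show ?thesis using True by (simp add: algebra_simps)
qed (use young_strict_nonneg[OF assms] in simp)

text \<open>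
  Strict convexity of \<open>|t|^q\<close> in the form that a tangent lies strictly below the graph. Reducing to
  absolute values gives Young's inequality, except when \<open>t = -a\<close>, where Young's inequality is an
  equality and the strictness comes from the sign of \<open>spow q a * t\<close>. Every later use of convexity
  (uniqueness, Jensen's inequality, lower semicontinuity, the Euler-Lagrange equation) is an instance.
\<close>
lemma tangent_strict:
  assumes q: "q > 1" and "t \<noteq> a"
  shows "\<bar>a\<bar> powr q + q * spow q a * (t - a) < \<bar>t\<bar> powr q"
proof -
  have *: "\<bar>a\<bar> powr q + q * spow q a * (t - a) = q * (spow q a * t) - (q - 1) * \<bar>a\<bar> powr q"
    by (simp add: algebra_simps flip: spow_mult_self)
  show ?thesis
  proof (cases "\<bar>t\<bar> = \<bar>a\<bar>")
    case False
    have "spow q a * t \<le> \<bar>spow q a\<bar> * \<bar>t\<bar>" by (metis abs_ge_self abs_mult)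
    then have "q * (spow q a * t) \<le> q * \<bar>t\<bar> * \<bar>a\<bar> powr (q - 1)"
      using q by (simp add: abs_spow mult.commute mult.left_commute)
    also have "\<dots> < \<bar>t\<bar> powr q + (q - 1) * \<bar>a\<bar> powr q"
      using young_strict_nonneg[OF q _ _ False] by simp
    finally show ?thesis using * by simp
  next
    case True
    then have t: "t = - a" "a \<noteq> 0" using assms by auto
    then have "spow q a * t = - (\<bar>a\<bar> powr q)" by (simp flip: spow_mult_self)
    moreover have "\<bar>a\<bar> powr q > 0" using t by simp
    moreover have "q * (\<bar>a\<bar> powr q) > 0" using t q by simp
    moreover have "\<bar>t\<bar> powr q = \<bar>a\<bar> powr q" using True by simp
    ultimately show ?thesis using * by (simp add: left_diff_distrib)
  qed
qed

lemma tangent_le: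
  assumes q: "q > 1"
  shows "\<bar>a\<bar> powr q + q * spow q a * (t - a) \<le> \<bar>t\<bar> powr q"
  using tangent_strict[OF q, of t a] by (cases "t = a") auto

lemma spow_strict_mono:
  assumes q: "q > 1" and ab: "a \<noteq> b" shows "(spow q a - spow q b) * (a - b) > 0"
proof -
  have "q * ((spow q a - spow q b) * (a - b)) > 0"
    using tangent_strict[OF q ab] tangent_strict[OF q ab[symmetric]]
    by (simp add: algebra_simps)
  then show ?thesis using q by (simp add: zero_less_mult_iff)
qed

lemma midpoint_strict:
  fixes a b q :: real
  assumes q: "q > 1" and "a \<noteq> b"
  shows "\<bar>(a + b) / 2\<bar> powr q < (\<bar>a\<bar> powr q + \<bar>b\<bar> powr q) / 2"
  using tangent_strict[OF q, of a "(a + b) / 2"] tangent_strict[OF q, of b "(a + b) / 2"] assms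
  by (simp add: field_simps)

lemma midpoint_le:
  fixes a b q :: real
  assumes q: "q > 1"
  shows "\<bar>(a + b) / 2\<bar> powr q \<le> (\<bar>a\<bar> powr q + \<bar>b\<bar> powr q) / 2"
  using midpoint_strict[OF q, of a b] by (cases "a = b") auto

lemma abs_add_powr_le:
  fixes a b q :: real
  assumes q: "q > 1"
  shows "\<bar>a + b\<bar> powr q \<le> 2 powr q * (\<bar>a\<bar> powr q + \<bar>b\<bar> powr q)"
proof -
  have "\<bar>a + b\<bar> powr q = 2 powr q * \<bar>(a + b) / 2\<bar> powr q"
    by (simp add: powr_divide)
  also have "\<dots> \<le> 2 powr q * (\<bar>a\<bar> powr q + \<bar>b\<bar> powr q)"
  proof (rule mult_left_mono)
    have "(\<bar>a\<bar> powr q + \<bar>b\<bar> powr q) / 2 \<le> \<bar>a\<bar> powr q + \<bar>b\<bar> powr q" by simp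
    with midpoint_le[OF q, of a b]
    show "\<bar>(a + b) / 2\<bar> powr q \<le> \<bar>a\<bar> powr q + \<bar>b\<bar> powr q"
      by (rule order_trans)
  qed simp
  finally show ?thesis .
qed

lemma abs_diff_powr_le:
  fixes a b q :: real
  assumes q: "q > 1"
  shows "\<bar>a - b\<bar> powr q \<le> 2 powr q * (\<bar>a\<bar> powr q + \<bar>b\<bar> powr q)"
  using abs_add_powr_le[OF q, of a "- b"] by simp

lemma abs_mult_powr_conj_le:
  assumes q: "q > 1"
  shows "\<bar>x * y\<bar> \<le> \<bar>x\<bar> powr q + \<bar>y\<bar> powr (conj_exp q)"
proof -
  define z where "z = \<bar>y\<bar> powr (1 / (q - 1))"
  have y: "z powr (q - 1) = \<bar>y\<bar>" "z powr q = \<bar>y\<bar> powr (conj_exp q)" "z \<ge> 0"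
    using q by (auto simp: z_def powr_powr conj_exp_def)
  have "q * \<bar>x * y\<bar> \<le> \<bar>x\<bar> powr q + (q - 1) * \<bar>y\<bar> powr (conj_exp q)"
    using young_nonneg[OF q, of "\<bar>x\<bar>" z] y by (simp add: abs_mult mult.assoc)
  also have "\<dots> \<le> q * (\<bar>x\<bar> powr q + \<bar>y\<bar> powr (conj_exp q))"
  proof -
    have "1 * \<bar>x\<bar> powr q \<le> q * \<bar>x\<bar> powr q" using q by (intro mult_right_mono) auto
    moreover have "(q - 1) * \<bar>y\<bar> powr (conj_exp q) \<le> q * \<bar>y\<bar> powr (conj_exp q)"
      by (rule mult_right_mono) auto
    ultimately show ?thesis unfolding distrib_left by linarith
  qed
  finally show ?thesis using q by simp
qed

text \<open>
  The weight \<open>d\<close> is moved between the two factors by writing \<open>x * y = (l * x) * (y / l)\<close>.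
\<close>
lemma young_eps:
  assumes q: "q > 1" and d: "d > 0"
  obtains C where "C > 0" "\<And>x y. \<bar>x * y\<bar> \<le> d * \<bar>x\<bar> powr q + C * \<bar>y\<bar> powr (conj_exp q)"
proof -
  define l where "l = d powr (1 / q)"
  have l: "l > 0" "l powr q = d" using q d by (auto simp: l_def powr_powr)
  show ?thesis
  proof (rule that[of "(1 / l) powr (conj_exp q)"])
    show "(1 / l) powr conj_exp q > 0" using l by simp
    fix x y :: real
    have "\<bar>x * y\<bar> = \<bar>(l * x) * (1 / l * y)\<bar>" using l by simp
    also have "\<dots> \<le> \<bar>l * x\<bar> powr q + \<bar>1 / l * y\<bar> powr (conj_exp q)"
      by (rule abs_mult_powr_conj_le[OF q])
    also have "\<bar>l * x\<bar> powr q = d * \<bar>x\<bar> powr q"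
      using l by (simp add: abs_mult powr_mult)
    also have "\<bar>1 / l * y\<bar> powr (conj_exp q) = (1 / l) powr (conj_exp q) * \<bar>y\<bar> powr (conj_exp q)"
      using l by (simp only: abs_mult powr_mult) (simp add: powr_mult)
    finally show "\<bar>x * y\<bar> \<le> d * \<bar>x\<bar> powr q + (1 / l) powr (conj_exp q) * \<bar>y\<bar> powr (conj_exp q)" .
  qed
qed

text \<open>
  A substitute for Clarkson's inequalities which does not distinguish \<open>q \<le> 2\<close> from \<open>q \<ge> 2\<close>: the distance
  of two numbers is controlled by the midpoint convexity defect of \<open>|t|^q\<close>, up to an arbitrarily small
  multiple of their size. Both sides are homogeneous of degree \<open>q\<close>, so it suffices to consider
  \<open>|a|^q + |b|^q = 1\<close>. There the pairs with \<open>|a - b|^q \<ge> e\<close> form a compact set on which the defect is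
  positive, hence bounded below.
\<close>
lemma clarkson_eps:
  fixes q e :: real
  assumes q: "q > 1" and e: "e > 0"
  obtains C where "C > 0" "\<And>a b. \<bar>a - b\<bar> powr q \<le> e * (\<bar>a\<bar> powr q + \<bar>b\<bar> powr q)
      + C * ((\<bar>a\<bar> powr q + \<bar>b\<bar> powr q) / 2 - \<bar>(a + b) / 2\<bar> powr q)"
proof -
  define S where "S x = \<bar>fst x\<bar> powr q + \<bar>snd x\<bar> powr q" for x :: "real \<times> real"
  define d where "d x = S x / 2 - \<bar>(fst x + snd x) / 2\<bar> powr q" for x :: "real \<times> real"
  define m where "m x = \<bar>fst x - snd x\<bar> powr q" for x :: "real \<times> real"
  have contS: "continuous_on UNIV S" and contd: "continuous_on UNIV d" and contm: "continuous_on UNIV m"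
    unfolding S_def d_def m_def using q by (auto intro!: continuous_intros continuous_on_powr')
  define K where "K = {x. S x = 1} \<inter> {x. e \<le> m x}"
  have "closed K" unfolding K_def
    by (intro closed_Int closed_Collect_eq closed_Collect_le contS contm continuous_intros)
  have le1: "\<bar>u\<bar> \<le> 1" if "\<bar>u\<bar> powr q \<le> 1" for u
    using that q by (smt (verit) gr_one_powr)
  have "bounded K"
  proof (rule bounded_subset[OF bounded_cbox[of "(-1,-1)" "(1,1)"]], rule subsetI)
    fix x assume "x \<in> K"
    then have "\<bar>fst x\<bar> powr q \<le> 1" "\<bar>snd x\<bar> powr q \<le> 1"
      by (auto simp: K_def S_def) (smt (verit) powr_ge_zero)+
    then have "\<bar>fst x\<bar> \<le> 1" "\<bar>snd x\<bar> \<le> 1" using le1 by auto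
    then show "x \<in> cbox (-1,-1) (1,1)" by (cases x) (auto simp: cbox_Pair_eq)
  qed
  then have "compact K" using \<open>closed K\<close> by (simp add: compact_eq_bounded_closed)
  have dpos: "d x > 0" if "x \<in> K" for x
  proof -
    have "fst x \<noteq> snd x" using that e by (auto simp: K_def m_def)
    then show ?thesis using midpoint_strict[OF q] by (auto simp: d_def S_def)
  qed
  obtain \<mu> where mu: "\<mu> > 0" "\<And>x. x \<in> K \<Longrightarrow> \<mu> \<le> d x"
  proof (cases "K = {}")
    case False
    then obtain x0 where "x0 \<in> K" "\<And>x. x \<in> K \<Longrightarrow> d x0 \<le> d x"
      using continuous_attains_inf[OF \<open>compact K\<close>, of d] contd continuous_on_subset by blast
    then show ?thesis using that dpos by blast
  qed (use that[of 1] in auto)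
  define C where "C = 2 powr q / \<mu>"
  have C: "C > 0" using mu by (simp add: C_def)
  have d0: "d x \<ge> 0" for x using midpoint_le[OF q] by (auto simp: d_def S_def)
  have one: "m x \<le> e + C * d x" if "S x = 1" for x
  proof (cases "e \<le> m x")
    case True
    then have "\<mu> \<le> d x" using mu that by (auto simp: K_def)
    then have "2 powr q \<le> C * d x" using mu by (simp add: C_def field_simps)
    moreover have "m x \<le> 2 powr q"
      using abs_diff_powr_le[OF q, of "fst x" "snd x"] that by (simp add: m_def S_def)
    ultimately show ?thesis using e by linarith
  next
    case False
    have "0 \<le> C * d x" using C d0 by simp
    then show ?thesis using False by linarith
  qed
  show ?thesis
  proof (rule that[OF C])
    fix a b :: real
    show "\<bar>a - b\<bar> powr q \<le> e * (\<bar>a\<bar> powr q + \<bar>b\<bar> powr q)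
      + C * ((\<bar>a\<bar> powr q + \<bar>b\<bar> powr q) / 2 - \<bar>(a + b) / 2\<bar> powr q)"
    proof (cases "a = 0 \<and> b = 0")
      case False
      define s where "s = S (a, b)"
      define l where "l = s powr (1 / q)"
      have s: "s > 0" using False by (auto simp: s_def S_def add_pos_nonneg add_nonneg_pos)
      have l: "l > 0" "l powr q = s" using s q by (auto simp: l_def powr_powr)
      have sc: "\<bar>u / l\<bar> powr q = \<bar>u\<bar> powr q / s" for u
        using l by (simp add: powr_divide)
      have S1: "S (a / l, b / l) = 1"
        using s by (simp only: S_def fst_conv snd_conv sc) (simp add: s_def S_def flip: add_divide_distrib)
      have dd: "d (a / l, b / l) = d (a, b) / s"
      proof -
        have "(a / l + b / l) / 2 = ((a + b) / 2) / l" by (simp add: add_divide_distrib)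
        then show ?thesis
          by (simp only: d_def S_def fst_conv snd_conv sc) (simp add: diff_divide_distrib add_divide_distrib)
      qed
      have mm: "m (a / l, b / l) = m (a, b) / s"
      proof -
        have "a / l - b / l = (a - b) / l" by (simp add: diff_divide_distrib)
        then show ?thesis by (simp only: m_def fst_conv snd_conv sc)
      qed
      have "m (a, b) / s \<le> e + C * (d (a, b) / s)" using one[OF S1] unfolding dd mm .
      then have "m (a, b) \<le> e * s + C * d (a, b)" using s by (simp add: field_simps)
      then show ?thesis by (simp add: m_def s_def S_def d_def)
    qed (use q in simp)
  qed
qed

section \<open>Spaces of q-integrable functions and extraction of subsequences\<close>

text \<open>
  The predicate is kept apart from \<open>Lp_space\<close> because the underlying measure is arbitrary; on Lebesgue
  measure the two agree.
\<close>
definition in_Lq :: "'c measure \<Rightarrow> real \<Rightarrow> ('c \<Rightarrow> real) \<Rightarrow> bool" where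
  "in_Lq M q g \<longleftrightarrow> g \<in> borel_measurable M \<and> integrable M (\<lambda>z. \<bar>g z\<bar> powr q)"

definition Lq_Cauchy :: "'c measure \<Rightarrow> real \<Rightarrow> (nat \<Rightarrow> 'c \<Rightarrow> real) \<Rightarrow> bool" where
  "Lq_Cauchy M q u \<longleftrightarrow> (\<forall>e>0. \<exists>N. \<forall>m\<ge>N. \<forall>n\<ge>N. (\<integral>z. \<bar>u m z - u n z\<bar> powr q \<partial>M) \<le> e)"

lemma Lp_space_iff: "g \<in> Lp_space q \<longleftrightarrow> in_Lq lborel q g"
  by (simp add: Lp_space_def in_Lq_def)

lemma in_LqD [measurable_dest]: "in_Lq M q g \<Longrightarrow> g \<in> borel_measurable M"
  by (simp add: in_Lq_def)

lemma in_Lq_integrable: "in_Lq M q g \<Longrightarrow> integrable M (\<lambda>z. \<bar>g z\<bar> powr q)"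
  by (simp add: in_Lq_def)

lemma in_Lq_add:
  assumes q: "q > 1" and a: "in_Lq M q a" and b: "in_Lq M q b"
  shows "in_Lq M q (\<lambda>z. a z + b z)"
proof -
  note [measurable] = in_LqD[OF a] in_LqD[OF b]
  have "integrable M (\<lambda>z. 2 powr q * (\<bar>a z\<bar> powr q + \<bar>b z\<bar> powr q))"
    using a b by (auto simp: in_Lq_def)
  then have "integrable M (\<lambda>z. \<bar>a z + b z\<bar> powr q)"
    by (rule Bochner_Integration.integrable_bound) (use abs_add_powr_le[OF q] in auto)
  then show ?thesis by (simp add: in_Lq_def)
qed

lemma in_Lq_cmult:
  assumes "in_Lq M q a" shows "in_Lq M q (\<lambda>z. c * a z)"
  using assms by (auto simp: in_Lq_def abs_mult powr_mult)

lemma in_Lq_diff: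
  assumes q: "q > 1" and a: "in_Lq M q a" and b: "in_Lq M q b"
  shows "in_Lq M q (\<lambda>z. a z - b z)"
  using in_Lq_add[OF q a in_Lq_cmult[OF b, of "-1"]] by simp

lemma conj_exp_gt1: "q > 1 \<Longrightarrow> conj_exp q > 1"
  by (simp add: conj_exp_def field_simps)

lemma conj_exp_conj_exp: "q > 1 \<Longrightarrow> conj_exp (conj_exp q) = q"
  by (simp add: conj_exp_def field_simps)

lemma in_Lq_mult:
  assumes q: "q > 1" and a: "in_Lq M q a" and b: "in_Lq M (conj_exp q) b"
  shows "integrable M (\<lambda>z. a z * b z)"
proof -
  note [measurable] = in_LqD[OF a] in_LqD[OF b]
  have "integrable M (\<lambda>z. \<bar>a z\<bar> powr q + \<bar>b z\<bar> powr (conj_exp q))"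
    using a b by (auto simp: in_Lq_def)
  then show ?thesis
    by (rule Bochner_Integration.integrable_bound) (use abs_mult_powr_conj_le[OF q] in auto)
qed

lemma in_Lq_spow:
  assumes q: "q > 1" and a: "in_Lq M q a"
  shows "in_Lq M (conj_exp q) (\<lambda>z. spow q (a z))"
  using a in_LqD[OF a] by (auto simp: in_Lq_def abs_spow_powr_conj[OF q])

lemma integrable_spow_mult:
  assumes q: "q > 1" and a: "in_Lq M q a" and b: "in_Lq M q b"
  shows "integrable M (\<lambda>z. spow q (a z) * b z)"
  using in_Lq_mult[OF q b in_Lq_spow[OF q a]] by (simp add: mult.commute)

lemma integrable_bounded_mult:
  fixes h g :: "'c \<Rightarrow> real"
  assumes [measurable]: "h \<in> borel_measurable M" and h: "AE z in M. \<bar>h z\<bar> \<le> C" and g: "integrable M g"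
  shows "integrable M (\<lambda>z. h z * g z)"
proof -
  note [measurable] = borel_measurable_integrable[OF g]
  have "integrable M (\<lambda>z. C * g z)" using g by simp
  then show ?thesis
  proof (rule Bochner_Integration.integrable_bound)
    show "AE z in M. norm (h z * g z) \<le> norm (C * g z)"
      using h by eventually_elim (auto simp: abs_mult intro!: mult_right_mono)
  qed simp
qed

lemma abs_integral_bounded_mult_le:
  fixes h g :: "'c \<Rightarrow> real"
  assumes [measurable]: "h \<in> borel_measurable M" and h: "AE z in M. \<bar>h z\<bar> \<le> C" and g: "integrable M g"
  shows "\<bar>\<integral>z. h z * g z \<partial>M\<bar> \<le> C * (\<integral>z. \<bar>g z\<bar> \<partial>M)"
proof -
  have "\<bar>\<integral>z. h z * g z \<partial>M\<bar> \<le> (\<integral>z. \<bar>h z * g z\<bar> \<partial>M)" by (rule integral_abs_bound)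
  also have "\<dots> \<le> (\<integral>z. C * \<bar>g z\<bar> \<partial>M)"
  proof (rule integral_mono_AE)
    show "integrable M (\<lambda>z. \<bar>h z * g z\<bar>)"
      using integrable_bounded_mult[OF assms] by simp
    show "AE z in M. \<bar>h z * g z\<bar> \<le> C * \<bar>g z\<bar>"
      using h by eventually_elim (auto simp: abs_mult intro!: mult_right_mono)
  qed (use g in simp)
  finally show ?thesis by simp
qed

lemma fatou_Lq:
  assumes u: "\<And>n. in_Lq M q (u n)" and K: "\<And>n. (\<integral>z. \<bar>u n z\<bar> powr q \<partial>M) \<le> K"
    and lim: "AE z in M. (\<lambda>n. u n z) \<longlonglongrightarrow> v z" and [measurable]: "v \<in> borel_measurable M"
    and q: "q > 1"
  shows "in_Lq M q v" "(\<integral>z. \<bar>v z\<bar> powr q \<partial>M) \<le> K"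
proof -
  note [measurable] = in_LqD[OF u]
  have K0: "0 \<le> K" using order_trans[OF Bochner_Integration.integral_nonneg K[of 0]] by simp
  have "AE z in M. ennreal (\<bar>v z\<bar> powr q) = liminf (\<lambda>n. ennreal (\<bar>u n z\<bar> powr q))"
    using lim
  proof eventually_elim
    fix z assume "(\<lambda>n. u n z) \<longlonglongrightarrow> v z"
    then have "(\<lambda>n. \<bar>u n z\<bar> powr q) \<longlonglongrightarrow> \<bar>v z\<bar> powr q"
      using q by (intro tendsto_powr' tendsto_intros) auto
    then have "(\<lambda>n. ennreal (\<bar>u n z\<bar> powr q)) \<longlonglongrightarrow> ennreal (\<bar>v z\<bar> powr q)" by simp
    then show "ennreal (\<bar>v z\<bar> powr q) = liminf (\<lambda>n. ennreal (\<bar>u n z\<bar> powr q))"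
      by (intro lim_imp_Liminf[symmetric]) auto
  qed
  then have "(\<integral>\<^sup>+z. ennreal (\<bar>v z\<bar> powr q) \<partial>M) = (\<integral>\<^sup>+z. liminf (\<lambda>n. ennreal (\<bar>u n z\<bar> powr q)) \<partial>M)"
    by (rule nn_integral_cong_AE)
  also have "\<dots> \<le> liminf (\<lambda>n. \<integral>\<^sup>+z. ennreal (\<bar>u n z\<bar> powr q) \<partial>M)"
    by (rule nn_integral_liminf) simp
  also have "\<dots> \<le> liminf (\<lambda>n::nat. ennreal K)"
  proof (rule Liminf_mono, rule always_eventually, rule allI)
    fix n
    have "(\<integral>\<^sup>+z. ennreal (\<bar>u n z\<bar> powr q) \<partial>M) = ennreal (\<integral>z. \<bar>u n z\<bar> powr q \<partial>M)"
      using u[of n] by (intro nn_integral_eq_integral) (auto simp: in_Lq_def)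
    then show "(\<integral>\<^sup>+z. ennreal (\<bar>u n z\<bar> powr q) \<partial>M) \<le> ennreal K"
      using K by (simp add: ennreal_leI)
  qed
  finally have le: "(\<integral>\<^sup>+z. ennreal (\<bar>v z\<bar> powr q) \<partial>M) \<le> ennreal K"
    by (simp add: Liminf_const)
  then have "(\<integral>\<^sup>+z. ennreal (\<bar>v z\<bar> powr q) \<partial>M) < \<infinity>"
    by (simp add: order_le_less_trans)
  then have i: "integrable M (\<lambda>z. \<bar>v z\<bar> powr q)"
    by (intro integrableI_nonneg) auto
  then show "in_Lq M q v" by (simp add: in_Lq_def)
  show "(\<integral>z. \<bar>v z\<bar> powr q \<partial>M) \<le> K"
    using le nn_integral_eq_integral[OF i] K0 by (simp add: ennreal_le_iff)
qed

text \<open>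
  A bounded sequence of \<open>L^q\<close> that converges almost everywhere has no reason to converge in norm, but
  its products with a fixed \<open>b \<in> L^q'\<close> do converge in \<open>L^1\<close>: Young's inequality with a small weight \<open>d\<close>
  on \<open>|a n|^q\<close> bounds the difference by \<open>d |a n|^q\<close> plus a fixed integrable function, so that dominated
  convergence applies to the positive part \<open>s n\<close> of the difference minus \<open>d |a n|^q\<close>.
\<close>
lemma integral_abs_diff_mult_tendsto_0:
  assumes q: "q > 1" and a: "\<And>n. in_Lq M q (a n)" and K: "\<And>n. (\<integral>z. \<bar>a n z\<bar> powr q \<partial>M) \<le> K"
    and lim: "AE z in M. (\<lambda>n. a n z) \<longlonglongrightarrow> c z" and [measurable]: "c \<in> borel_measurable M"
    and b: "in_Lq M (conj_exp q) b"
  shows "(\<lambda>n. \<integral>z. \<bar>a n z * b z - c z * b z\<bar> \<partial>M) \<longlonglongrightarrow> 0"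
proof (rule LIMSEQ_I)
  note [measurable] = in_LqD[OF a] in_LqD[OF b]
  have c: "in_Lq M q c" using fatou_Lq[OF a K lim _ q] by simp
  have icb: "integrable M (\<lambda>z. c z * b z)" by (rule in_Lq_mult[OF q c b])
  have iab: "integrable M (\<lambda>z. a n z * b z)" for n by (rule in_Lq_mult[OF q a b])
  have K0: "0 \<le> K" using order_trans[OF Bochner_Integration.integral_nonneg K[of 0]] by simp
  fix e :: real assume e: "e > 0"
  define d where "d = e / (2 * (K + 1))"
  have d: "d > 0" and dK: "d * K \<le> e / 2" using e K0 by (auto simp: d_def field_simps)
  obtain C where C: "C > 0" "\<And>x y. \<bar>x * y\<bar> \<le> d * \<bar>x\<bar> powr q + C * \<bar>y\<bar> powr (conj_exp q)"
    using young_eps[OF q d] by blast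
  define w where "w z = C * \<bar>b z\<bar> powr (conj_exp q) + \<bar>c z * b z\<bar>" for z
  have [measurable]: "w \<in> borel_measurable M" unfolding w_def by measurable
  have iw: "integrable M w" unfolding w_def using icb b by (auto simp: in_Lq_def)
  define s where "s n z = max 0 (\<bar>a n z * b z - c z * b z\<bar> - d * \<bar>a n z\<bar> powr q)" for n z
  have [measurable]: "s n \<in> borel_measurable M" for n unfolding s_def by measurable
  have sw: "\<bar>s n z\<bar> \<le> w z" for n z
  proof -
    have "\<bar>a n z * b z - c z * b z\<bar> \<le> d * \<bar>a n z\<bar> powr q + w z"
      using C(2)[of "a n z" "b z"] by (simp add: w_def)
    moreover have "0 \<le> w z" using C(1) by (simp add: w_def)
    ultimately show ?thesis by (simp add: s_def)
  qed
  have "(\<lambda>n. \<integral>z. s n z \<partial>M) \<longlonglongrightarrow> (\<integral>z. 0 \<partial>M)"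
  proof (rule integral_dominated_convergence[OF _ _ iw])
    show "AE z in M. (\<lambda>n. s n z) \<longlonglongrightarrow> 0"
      using lim
    proof eventually_elim
      fix z assume l: "(\<lambda>n. a n z) \<longlonglongrightarrow> c z"
      have "(\<lambda>n. max 0 (\<bar>a n z * b z - c z * b z\<bar> - d * \<bar>a n z\<bar> powr q))
          \<longlonglongrightarrow> max 0 (\<bar>c z * b z - c z * b z\<bar> - d * \<bar>c z\<bar> powr q)"
        using l q by (intro tendsto_intros tendsto_powr' tendsto_max) auto
      then show "(\<lambda>n. s n z) \<longlonglongrightarrow> 0" using d by (simp add: s_def)
    qed
    show "AE z in M. norm (s n z) \<le> w z" for n using sw by simp
  qed auto
  then have "(\<lambda>n. \<integral>z. s n z \<partial>M) \<longlonglongrightarrow> 0" by simp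
  then obtain N where N: "\<And>n. n \<ge> N \<Longrightarrow> \<bar>\<integral>z. s n z \<partial>M\<bar> < e / 2"
    using LIMSEQ_D[of "\<lambda>n. \<integral>z. s n z \<partial>M" 0 "e/2"] e by auto
  show "\<exists>no. \<forall>n\<ge>no. norm ((\<integral>z. \<bar>a n z * b z - c z * b z\<bar> \<partial>M) - 0) < e"
  proof (intro exI allI impI)
    fix n assume n: "N \<le> n"
    have intsn: "integrable M (s n)" by (rule Bochner_Integration.integrable_bound[OF iw]) (use order_trans[OF sw abs_ge_self] in simp_all)
    have ia: "integrable M (\<lambda>z. d * \<bar>a n z\<bar> powr q)" using a by (simp add: in_Lq_def)
    have "(\<integral>z. \<bar>a n z * b z - c z * b z\<bar> \<partial>M) \<le> (\<integral>z. s n z + d * \<bar>a n z\<bar> powr q \<partial>M)"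
      by (rule integral_mono) (use intsn ia iab icb in \<open>auto simp: s_def\<close>)
    also have "\<dots> = (\<integral>z. s n z \<partial>M) + d * (\<integral>z. \<bar>a n z\<bar> powr q \<partial>M)"
      using intsn ia by simp
    also have "\<dots> < e / 2 + d * K"
      using N[OF n] K[of n] d by (intro add_less_le_mono mult_left_mono) auto
    finally show "norm ((\<integral>z. \<bar>a n z * b z - c z * b z\<bar> \<partial>M) - 0) < e"
      using dK by simp
  qed
qed

text \<open>
  Along a subsequence whose increments \<open>d k\<close> satisfy \<open>\<integral> |d k|^q \<le> 2^(-k) 2^(-kq)\<close> the series of
  \<open>|2^k d k|^q\<close> is integrable, hence finite almost everywhere, and then \<open>|d k| \<le> 2^(-k)\<close> for large \<open>k\<close>.
\<close>
lemma Lq_Cauchy_AE_subseq: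
  assumes q: "q > 1" and u: "\<And>n. in_Lq M q (u n)" and cau: "Lq_Cauchy M q u"
  obtains r v where "strict_mono r" "v \<in> borel_measurable M" "AE z in M. (\<lambda>n. u (r n) z) \<longlonglongrightarrow> v z"
proof -
  note [measurable] = in_LqD[OF u]
  \<comment> \<open>The factor \<open>(2 ^ k) powr q\<close> compensates the weight \<open>2 ^ k\<close> put on the increments, and \<open>(1/2) ^ k\<close> makes the series converge.\<close>
  define e where "e k = (1/2) ^ k / (2 ^ k) powr q" for k :: nat
  have e: "e k > 0" for k by (simp add: e_def)
  have "\<exists>r. \<forall>k. (\<forall>m\<ge>r k. \<forall>n\<ge>r k. (\<integral>z. \<bar>u m z - u n z\<bar> powr q \<partial>M) \<le> e k) \<and> r k < r (Suc k)"
  proof (rule dependent_nat_choice)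
    show "\<exists>x. \<forall>m\<ge>x. \<forall>n\<ge>x. (\<integral>z. \<bar>u m z - u n z\<bar> powr q \<partial>M) \<le> e 0"
      using cau e unfolding Lq_Cauchy_def by blast
    fix x k
    obtain N where N: "\<forall>m\<ge>N. \<forall>n\<ge>N. (\<integral>z. \<bar>u m z - u n z\<bar> powr q \<partial>M) \<le> e (Suc k)"
      using cau e unfolding Lq_Cauchy_def by blast
    show "\<exists>y. (\<forall>m\<ge>y. \<forall>n\<ge>y. (\<integral>z. \<bar>u m z - u n z\<bar> powr q \<partial>M) \<le> e (Suc k)) \<and> x < y"
      by (rule exI[of _ "max N (Suc x)"]) (use N in auto)
  qed
  then obtain r where r: "\<And>k m n. m \<ge> r k \<Longrightarrow> n \<ge> r k \<Longrightarrow> (\<integral>z. \<bar>u m z - u n z\<bar> powr q \<partial>M) \<le> e k"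
    and rS: "\<And>k. r k < r (Suc k)" by blast
  have mono: "strict_mono r" using rS by (simp add: strict_mono_Suc_iff)
  define d where "d k z = u (r (Suc k)) z - u (r k) z" for k z
  have [measurable]: "d k \<in> borel_measurable M" for k unfolding d_def by measurable
  have dL: "in_Lq M q (d k)" for k unfolding d_def by (rule in_Lq_diff[OF q u u])
  have "(\<integral>\<^sup>+z. ennreal (\<bar>2 ^ k * d k z\<bar> powr q) \<partial>M) \<le> ennreal ((1/2) ^ k)" for k
  proof -
    have L: "in_Lq M q (\<lambda>z. 2 ^ k * d k z)" by (rule in_Lq_cmult[OF dL])
    have "(\<integral>\<^sup>+z. ennreal (\<bar>2 ^ k * d k z\<bar> powr q) \<partial>M) = ennreal (\<integral>z. \<bar>2 ^ k * d k z\<bar> powr q \<partial>M)"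
      by (intro nn_integral_eq_integral) (use L in \<open>auto simp: in_Lq_def\<close>)
    also have "(\<integral>z. \<bar>2 ^ k * d k z\<bar> powr q \<partial>M) = (2 ^ k) powr q * (\<integral>z. \<bar>d k z\<bar> powr q \<partial>M)"
      by (simp add: abs_mult powr_mult)
    also have "(2 ^ k) powr q * (\<integral>z. \<bar>d k z\<bar> powr q \<partial>M) \<le> (2 ^ k) powr q * e k"
      unfolding d_def using r[of k "r (Suc k)" "r k"] rS[of k] by (intro mult_left_mono) auto
    also have "\<dots> = (1/2) ^ k" by (simp add: e_def)
    finally show ?thesis by (simp add: ennreal_leI)
  qed
  then have "(\<Sum>k. \<integral>\<^sup>+z. ennreal (\<bar>2 ^ k * d k z\<bar> powr q) \<partial>M) \<le> (\<Sum>k. ennreal ((1/2) ^ k))"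
    by (intro suminf_le) auto
  also have "\<dots> = ennreal (\<Sum>k. (1/2) ^ k)" by (intro suminf_ennreal2) (auto intro: summable_geometric)
  finally have "(\<integral>\<^sup>+z. (\<Sum>k. ennreal (\<bar>2 ^ k * d k z\<bar> powr q)) \<partial>M) \<noteq> \<infinity>"
    by (subst nn_integral_suminf) (auto simp: top_unique)
  then have "AE z in M. (\<Sum>k. ennreal (\<bar>2 ^ k * d k z\<bar> powr q)) \<noteq> \<infinity>"
    by (intro nn_integral_noteq_infinite) auto
  then have conv: "AE z in M. convergent (\<lambda>k. u (r k) z)"
  proof eventually_elim
    fix z assume "(\<Sum>k. ennreal (\<bar>2 ^ k * d k z\<bar> powr q)) \<noteq> \<infinity>"
    then have "summable (\<lambda>k. \<bar>2 ^ k * d k z\<bar> powr q)"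
      by (intro summable_suminf_not_top) auto
    then have "(\<lambda>k. \<bar>2 ^ k * d k z\<bar> powr q) \<longlonglongrightarrow> 0" by (rule summable_LIMSEQ_zero)
    then have "eventually (\<lambda>k. \<bar>2 ^ k * d k z\<bar> powr q < 1) sequentially"
      by (rule order_tendstoD) simp
    then have "eventually (\<lambda>k. norm (d k z) \<le> (1/2) ^ k) sequentially"
    proof eventually_elim
      fix k assume "\<bar>2 ^ k * d k z\<bar> powr q < 1"
      then have "\<bar>2 ^ k * d k z\<bar> \<le> 1"
        using q by (smt (verit) ge_one_powr_ge_zero)
      then show "norm (d k z) \<le> (1/2) ^ k" by (simp add: abs_mult field_simps)
    qed
    then have "summable (\<lambda>k. d k z)"
      by (rule summable_comparison_test_ev) (auto intro: summable_geometric)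
    then have "convergent (\<lambda>n. \<Sum>k<n. d k z)" by (simp add: summable_iff_convergent)
    moreover have "(\<Sum>k<n. d k z) = u (r n) z - u (r 0) z" for n
      unfolding d_def by (rule sum_lessThan_telescope)
    ultimately have "convergent (\<lambda>n. (u (r n) z - u (r 0) z) + u (r 0) z)"
      by (intro convergent_add convergent_const) simp
    then show "convergent (\<lambda>k. u (r k) z)" by simp
  qed
  show ?thesis
  proof (rule that[OF mono, of "\<lambda>z. lim (\<lambda>k. u (r k) z)"])
    show "(\<lambda>z. lim (\<lambda>k. u (r k) z)) \<in> borel_measurable M"
      by (rule borel_measurable_lim_metric) simp
    show "AE z in M. (\<lambda>n. u (r n) z) \<longlonglongrightarrow> lim (\<lambda>k. u (r k) z)"
      using conv by eventually_elim (simp add: convergent_LIMSEQ_iff)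
  qed
qed

lemma Lq_Cauchy_tendsto:
  assumes q: "q > 1" and u: "\<And>n. in_Lq M q (u n)" and cau: "Lq_Cauchy M q u"
    and r: "strict_mono r" and [measurable]: "v \<in> borel_measurable M"
    and lim: "AE z in M. (\<lambda>n. u (r n) z) \<longlonglongrightarrow> v z"
  shows "in_Lq M q v" "(\<lambda>n. \<integral>z. \<bar>u n z - v z\<bar> powr q \<partial>M) \<longlonglongrightarrow> 0"
proof -
  note [measurable] = in_LqD[OF u]
  have *: "in_Lq M q (\<lambda>z. u n z - v z) \<and> (\<integral>z. \<bar>u n z - v z\<bar> powr q \<partial>M) \<le> e"
    if N: "\<forall>m\<ge>N. \<forall>n\<ge>N. (\<integral>z. \<bar>u m z - u n z\<bar> powr q \<partial>M) \<le> e" "n \<ge> N" for n N e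
  proof -
    have L: "in_Lq M q (\<lambda>z. u n z - u (r (j + N)) z)" for j by (rule in_Lq_diff[OF q u u])
    have K: "(\<integral>z. \<bar>u n z - u (r (j + N)) z\<bar> powr q \<partial>M) \<le> e" for j
      using N seq_suble[OF r, of "j + N"] by auto
    have l: "AE z in M. (\<lambda>j. u n z - u (r (j + N)) z) \<longlonglongrightarrow> u n z - v z"
      using lim by eventually_elim (intro tendsto_intros, rule LIMSEQ_ignore_initial_segment)
    show ?thesis using fatou_Lq[OF L K l _ q] by simp
  qed
  obtain N where "\<forall>m\<ge>N. \<forall>n\<ge>N. (\<integral>z. \<bar>u m z - u n z\<bar> powr q \<partial>M) \<le> 1"
    using cau unfolding Lq_Cauchy_def by (meson zero_less_one)
  then have "in_Lq M q (\<lambda>z. u N z - v z)" using * by blast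
  from in_Lq_diff[OF q u[of N] this] show "in_Lq M q v" by simp
  show "(\<lambda>n. \<integral>z. \<bar>u n z - v z\<bar> powr q \<partial>M) \<longlonglongrightarrow> 0"
  proof (rule LIMSEQ_I)
    fix e :: real assume "e > 0"
    then obtain N where N: "\<forall>m\<ge>N. \<forall>n\<ge>N. (\<integral>z. \<bar>u m z - u n z\<bar> powr q \<partial>M) \<le> e / 2"
      using cau unfolding Lq_Cauchy_def by (meson half_gt_zero)
    show "\<exists>N. \<forall>n\<ge>N. norm ((\<integral>z. \<bar>u n z - v z\<bar> powr q \<partial>M) - 0) < e"
      using *[OF N] \<open>e > 0\<close> by (intro exI[of _ N]) force
  qed
qed

lemma Lq_complete:
  assumes q: "q > 1" and u: "\<And>n. in_Lq M q (u n)" and cau: "Lq_Cauchy M q u"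
  obtains v where "in_Lq M q v" "(\<lambda>n. \<integral>z. \<bar>u n z - v z\<bar> powr q \<partial>M) \<longlonglongrightarrow> 0"
proof (rule Lq_Cauchy_AE_subseq[OF assms])
  fix r v
  assume *: "strict_mono r" "v \<in> borel_measurable M" "AE z in M. (\<lambda>n. u (r n) z) \<longlonglongrightarrow> v z"
  show thesis by (rule that[OF Lq_Cauchy_tendsto[OF assms *]])
qed

lemma tendsto_by_subsequences:
  fixes x :: "nat \<Rightarrow> real"
  assumes "\<And>r. strict_mono (r :: nat \<Rightarrow> nat) \<Longrightarrow> \<exists>s. strict_mono (s :: nat \<Rightarrow> nat) \<and> (\<lambda>n. x (r (s n))) \<longlonglongrightarrow> L"
  shows "x \<longlonglongrightarrow> L"
proof (rule ccontr)
  assume "\<not> ?thesis"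
  then obtain e where e: "e > 0" "\<exists>\<^sub>F n in sequentially. \<not> dist (x n) L < e"
    unfolding tendsto_iff frequently_def by auto
  then have "infinite {n. \<not> dist (x n) L < e}"
    by (simp add: frequently_cofinite flip: cofinite_eq_sequentially)
  then obtain r where r: "strict_mono (r :: nat \<Rightarrow> nat)" "\<And>n. \<not> dist (x (r n)) L < e"
    using infinite_enumerate by blast
  obtain s where "(\<lambda>n. x (r (s n))) \<longlonglongrightarrow> L" using assms[OF r(1)] by blast
  then have "eventually (\<lambda>n. dist (x (r (s n))) L < e) sequentially"
    using e(1) by (rule tendstoD)
  then show False using r(2) by (auto simp: eventually_sequentially)
qed

lemma diagonal_subsequence:
  fixes f :: "nat \<Rightarrow> nat \<Rightarrow> real"
  assumes "\<And>i. bounded (range (f i))"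
  obtains r :: "nat \<Rightarrow> nat" where "strict_mono r" "\<And>i. convergent (\<lambda>n. f i (r n))"
proof -
  interpret subseqs "\<lambda>i s. convergent (\<lambda>n. f i (s n))"
  proof
    fix i and s :: "nat \<Rightarrow> nat"
    have "bounded (range (\<lambda>n. f i (s n)))" by (rule bounded_subset[OF assms[of i]]) auto
    then obtain l r where "strict_mono (r :: nat \<Rightarrow> nat)" "((\<lambda>n. f i (s n)) \<circ> r) \<longlonglongrightarrow> l"
      using bounded_imp_convergent_subsequence by blast
    then show "\<exists>r'. strict_mono r' \<and> convergent (\<lambda>n. f i ((s \<circ> r') n))"
      by (auto simp: convergent_def o_def)
  qed
  have "convergent (\<lambda>n. f i (diagseq n))" for i
  proof -
    have "convergent (\<lambda>n. f i ((diagseq \<circ> (+) (Suc i)) n))"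
    proof (rule diagseq_holds)
      fix r s :: "nat \<Rightarrow> nat" and n
      assume "strict_mono r" "convergent (\<lambda>k. f n (s k))"
      then show "convergent (\<lambda>k. f n ((s \<circ> r) k))"
        using convergent_subseq_convergent[of "\<lambda>k. f n (s k)" r] by (simp add: o_def)
    qed
    then have "convergent (\<lambda>n. f i (diagseq (n + Suc i)))" by (simp add: o_def add.commute)
    then show ?thesis using convergent_ignore_initial_segment[of "\<lambda>n. f i (diagseq n)" "Suc i"] by blast
  qed
  then show ?thesis using that subseq_diagseq by blast
qed

section \<open>Representation of functionals by minimisation\<close>

lemma integral_abs_mult_tendsto_0:
  assumes q: "q > 1" and g: "\<And>n. in_Lq M q (g n)"
    and lim: "(\<lambda>n. \<integral>z. \<bar>g n z\<bar> powr q \<partial>M) \<longlonglongrightarrow> 0"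
    and s: "in_Lq M (conj_exp q) s"
  shows "(\<lambda>n. \<integral>z. \<bar>s z * g n z\<bar> \<partial>M) \<longlonglongrightarrow> 0"
proof (rule LIMSEQ_I)
  fix e :: real assume e: "e > 0"
  define S where "S = (\<integral>z. \<bar>s z\<bar> powr (conj_exp q) \<partial>M)"
  have S: "S \<ge> 0" by (simp add: S_def)
  define d where "d = e / (2 * (S + 1))"
  have d: "d > 0" and dS: "d * S \<le> e / 2" using e S by (auto simp: d_def field_simps)
  obtain C where C: "C > 0" "\<And>x y. \<bar>x * y\<bar> \<le> d * \<bar>x\<bar> powr (conj_exp q) + C * \<bar>y\<bar> powr (conj_exp (conj_exp q))"
    using young_eps[OF conj_exp_gt1[OF q] d] by blast
  have "(\<lambda>n. C * (\<integral>z. \<bar>g n z\<bar> powr q \<partial>M)) \<longlonglongrightarrow> C * 0" by (intro tendsto_intros lim)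
  then obtain N where N: "\<And>n. n \<ge> N \<Longrightarrow> \<bar>C * (\<integral>z. \<bar>g n z\<bar> powr q \<partial>M)\<bar> < e / 2"
    using LIMSEQ_D[of "\<lambda>n. C * (\<integral>z. \<bar>g n z\<bar> powr q \<partial>M)" 0 "e/2"] e by auto
  show "\<exists>no. \<forall>n\<ge>no. norm ((\<integral>z. \<bar>s z * g n z\<bar> \<partial>M) - 0) < e"
  proof (intro exI allI impI)
    fix n assume n: "N \<le> n"
    have i1: "integrable M (\<lambda>z. s z * g n z)"
      using in_Lq_mult[OF q g s] by (simp add: mult.commute)
    have i2: "integrable M (\<lambda>z. \<bar>s z\<bar> powr (conj_exp q))" "integrable M (\<lambda>z. \<bar>g n z\<bar> powr q)"
      using s g by (auto simp: in_Lq_def)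
    have "(\<integral>z. \<bar>s z * g n z\<bar> \<partial>M) \<le> (\<integral>z. d * \<bar>s z\<bar> powr (conj_exp q) + C * \<bar>g n z\<bar> powr q \<partial>M)"
      using C(2) i1 i2 by (intro integral_mono) (auto simp: conj_exp_conj_exp[OF q])
    also have "\<dots> = d * S + C * (\<integral>z. \<bar>g n z\<bar> powr q \<partial>M)"
      using i2 by (simp add: S_def)
    also have "\<dots> < e" using N[OF n] dS by linarith
    finally show "norm ((\<integral>z. \<bar>s z * g n z\<bar> \<partial>M) - 0) < e" by simp
  qed
qed

lemma integral_bounded_mult_diff_tendsto_0:
  fixes h :: "nat \<Rightarrow> 'c \<Rightarrow> real"
  assumes [measurable]: "\<And>n. h n \<in> borel_measurable M" and h: "\<And>n. AE z in M. \<bar>h n z\<bar> \<le> C"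
    and x: "\<And>n. integrable M (x n)" and y: "integrable M y"
    and lim: "(\<lambda>n. \<integral>z. \<bar>x n z - y z\<bar> \<partial>M) \<longlonglongrightarrow> 0"
  shows "(\<lambda>n. (\<integral>z. h n z * x n z \<partial>M) - (\<integral>z. h n z * y z \<partial>M)) \<longlonglongrightarrow> 0"
proof (rule Lim_null_comparison)
  show "(\<lambda>n. C * (\<integral>z. \<bar>x n z - y z\<bar> \<partial>M)) \<longlonglongrightarrow> 0"
    using tendsto_mult_right_zero[OF lim] by simp
  show "\<forall>\<^sub>F n in sequentially. norm ((\<integral>z. h n z * x n z \<partial>M) - (\<integral>z. h n z * y z \<partial>M))
      \<le> C * (\<integral>z. \<bar>x n z - y z\<bar> \<partial>M)"
  proof (rule always_eventually, rule allI)
    fix n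
    have "(\<integral>z. h n z * x n z \<partial>M) - (\<integral>z. h n z * y z \<partial>M) = (\<integral>z. h n z * (x n z - y z) \<partial>M)"
      using integrable_bounded_mult[OF _ h x] integrable_bounded_mult[OF _ h y]
      by (simp add: right_diff_distrib)
    then show "norm ((\<integral>z. h n z * x n z \<partial>M) - (\<integral>z. h n z * y z \<partial>M)) \<le> C * (\<integral>z. \<bar>x n z - y z\<bar> \<partial>M)"
      using abs_integral_bounded_mult_le[OF _ h, of n "\<lambda>z. x n z - y z"] x y by simp
  qed
qed

text \<open>
  A linear map \<open>D\<close> into \<open>L^q\<close>, with \<open>u \<mapsto> (\<integral> |D u|^q)^(1/q)\<close> as seminorm on its domain \<open>V\<close>, for which \<open>V\<close> is
  complete. The energy space with \<open>D\<close> the weighted difference quotient, the spaces \<open>L^q\<close> themselves, and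
  closed subspaces of \<open>L^2\<close> are all of this form.
\<close>
locale Lq_operator =
  fixes M :: "'c measure" and q :: real and V :: "('b \<Rightarrow> real) set"
    and D :: "('b \<Rightarrow> real) \<Rightarrow> 'c \<Rightarrow> real"
  assumes q: "q > 1"
    and zero: "(\<lambda>_. 0) \<in> V"
    and add: "\<And>u v. u \<in> V \<Longrightarrow> v \<in> V \<Longrightarrow> (\<lambda>x. u x + v x) \<in> V"
    and cmult: "\<And>c u. u \<in> V \<Longrightarrow> (\<lambda>x. c * u x) \<in> V"
    and D_Lq: "\<And>u. u \<in> V \<Longrightarrow> in_Lq M q (D u)"
    and D_add: "\<And>u v. u \<in> V \<Longrightarrow> v \<in> V \<Longrightarrow> D (\<lambda>x. u x + v x) = (\<lambda>z. D u z + D v z)"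
    and D_cmult: "\<And>c u. u \<in> V \<Longrightarrow> D (\<lambda>x. c * u x) = (\<lambda>z. c * D u z)"
    and complete: "\<And>u. (\<And>n. u n \<in> V) \<Longrightarrow> Lq_Cauchy M q (\<lambda>n. D (u n)) \<Longrightarrow>
       \<exists>v\<in>V. (\<lambda>n. \<integral>z. \<bar>D (u n) z - D v z\<bar> powr q \<partial>M) \<longlonglongrightarrow> 0"
begin

text \<open>
  The solution minimises \<open>J u = (1/q) \<integral> h |D u|^q - f u\<close>. Since \<open>J\<close> at the midpoint of two almost
  minimisers cannot fall below the infimum, the convexity defect of the two is small in the mean, and
  \<open>clarkson_eps\<close> turns this into the Cauchy property. No compactness is used, so the theorem
  provides at the same time existence for the nonlocal equation and the representation of dual
  spaces. Completeness gives a limit \<open>w\<close>, which is a minimiser by the tangent inequality. Comparing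
  \<open>J w\<close> with \<open>J (w + t v)\<close>, again by the tangent inequality, and letting \<open>t\<close> tend to \<open>0\<close> from above gives
  \<open>f v \<le> \<integral> h |D w|^(q-2) D w D v\<close>, and the opposite inequality follows with \<open>-v\<close>.
\<close>
theorem representation:
  fixes h :: "'c \<Rightarrow> real" and f :: "('b \<Rightarrow> real) \<Rightarrow> real" and a b C :: real
  assumes hm [measurable]: "h \<in> borel_measurable M" and a: "0 < a"
    and h: "AE z in M. a \<le> h z \<and> h z \<le> b"
    and f_add: "\<And>u v. u \<in> V \<Longrightarrow> v \<in> V \<Longrightarrow> f (\<lambda>x. u x + v x) = f u + f v"
    and f_cmult: "\<And>c u. u \<in> V \<Longrightarrow> f (\<lambda>x. c * u x) = c * f u"
    and f_bound: "\<And>u. u \<in> V \<Longrightarrow> \<bar>f u\<bar> \<le> C * (\<integral>z. \<bar>D u z\<bar> powr q \<partial>M) powr (1 / q)"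
  shows "\<exists>u\<in>V. \<forall>v\<in>V. (\<integral>z. h z * (spow q (D u z) * D v z) \<partial>M) = f v"
proof -
  define E where "E u = (\<integral>z. \<bar>D u z\<bar> powr q \<partial>M)" for u
  define Eh where "Eh u = (\<integral>z. h z * \<bar>D u z\<bar> powr q \<partial>M)" for u
  define J where "J u = Eh u / q - f u" for u
  have habs: "AE z in M. \<bar>h z\<bar> \<le> b" using h by eventually_elim (use a in auto)
  have inth: "integrable M (\<lambda>z. h z * g z)" if "integrable M g" for g
    using integrable_bounded_mult[OF hm habs that] .
  have mono: "(\<integral>z. h z * g1 z \<partial>M) \<le> (\<integral>z. h z * g2 z \<partial>M)"
    if "integrable M g1" "integrable M g2" "\<And>z. g1 z \<le> g2 z" for g1 g2
  proof (rule integral_mono_AE)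
    show "AE z in M. h z * g1 z \<le> h z * g2 z"
      using h by eventually_elim (use a that(3) in \<open>auto intro: mult_left_mono\<close>)
  qed (use inth that in auto)
  have intE: "integrable M (\<lambda>z. \<bar>D u z\<bar> powr q)" if "u \<in> V" for u
    using D_Lq[OF that] by (simp add: in_Lq_def)
  have lower: "a * (\<integral>z. g z \<partial>M) \<le> (\<integral>z. h z * g z \<partial>M)" if "integrable M g" "\<And>z. 0 \<le> g z" for g
  proof -
    have "(\<integral>z. a * g z \<partial>M) \<le> (\<integral>z. h z * g z \<partial>M)"
    proof (rule integral_mono_AE)
      show "AE z in M. a * g z \<le> h z * g z"
        using h by eventually_elim (use that(2) in \<open>auto intro: mult_right_mono\<close>)
    qed (use inth that in auto)
    then show ?thesis by simp
  qed
  have E0: "E u \<ge> 0" for u by (simp add: E_def)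
  have divq: "X / q + Y \<le> Z / q" if "X + q * Y \<le> Z" for X Y Z :: real
    using divide_right_mono[OF that, of q] q by (simp add: add_divide_distrib)
  \<comment> \<open>Coercivity: Young's inequality with weight \<open>a / (2 q)\<close> absorbs \<open>f u\<close> into half of the energy term.\<close>
  obtain K where K: "\<And>u. u \<in> V \<Longrightarrow> a / (2 * q) * E u - K \<le> J u"
  proof -
    have "a / (2 * q) > 0" using a q by simp
    then obtain C1 where C1: "\<And>x y. \<bar>x * y\<bar> \<le> a / (2 * q) * \<bar>x\<bar> powr q + C1 * \<bar>y\<bar> powr (conj_exp q)"
      using young_eps[OF q] by blast
    have "a / (2 * q) * E u - C1 * \<bar>C\<bar> powr (conj_exp q) \<le> J u" if u: "u \<in> V" for u
    proof -
      define x where "x = E u powr (1 / q)"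
      have x: "\<bar>x\<bar> powr q = E u" using E0[of u] q by (simp add: x_def powr_powr)
      have "f u \<le> C * x" using f_bound[OF u] by (simp add: x_def E_def)
      also have "\<dots> \<le> \<bar>x * C\<bar>" by (simp add: mult.commute)
      also have "\<dots> \<le> a / (2 * q) * E u + C1 * \<bar>C\<bar> powr (conj_exp q)" using C1[of x C] x by simp
      finally have 1: "f u \<le> a / (2 * q) * E u + C1 * \<bar>C\<bar> powr (conj_exp q)" .
      have "a * E u \<le> Eh u" using lower[OF intE[OF u]] by (simp add: E_def Eh_def)
      then have "a / q * E u \<le> Eh u / q" using q by (simp add: divide_right_mono)
      moreover have "a / q * E u = a / (2 * q) * E u + a / (2 * q) * E u" by (simp add: field_simps)
      ultimately show ?thesis using 1 by (simp add: J_def)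
    qed
    then show ?thesis using that by blast
  qed
  define m where "m = Inf (J ` V)"
  have bdd: "bdd_below (J ` V)"
  proof (rule bdd_belowI2)
    fix u assume "u \<in> V"
    have "0 \<le> a / (2 * q) * E u" using a q E0 by simp
    then show "- K \<le> J u" using K[OF \<open>u \<in> V\<close>] by linarith
  qed
  have mle: "m \<le> J u" if "u \<in> V" for u
    unfolding m_def using bdd that by (rule cINF_lower)
  have "\<exists>u\<in>V. J u < m + 1 / real (Suc n)" for n
  proof -
    have "Inf (J ` V) < m + 1 / real (Suc n)" by (simp add: m_def)
    then show ?thesis using cInf_lessD[of "J ` V"] zero by blast
  qed
  then obtain u where uV: "\<And>n. u n \<in> V" and uJ: "\<And>n. J (u n) < m + 1 / real (Suc n)"
    by metis
  define R where "R = (m + 1 + K) * (2 * q / a)"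
  have ER: "E (u n) \<le> R" for n
  proof -
    have "1 / real (Suc n) \<le> 1" by simp
    then have "a / (2 * q) * E (u n) \<le> m + 1 + K" using K[OF uV[of n]] uJ[of n] by linarith
    then show ?thesis using a q by (simp add: R_def field_simps)
  qed
  have R0: "R \<ge> 0" using ER[of 0] E0[of "u 0"] by linarith
  \<comment> \<open>\<open>def i j\<close> is the midpoint convexity defect of \<open>|D (u i)|^q\<close> and \<open>|D (u j)|^q\<close>.\<close>
  define def where "def i j z = (\<bar>D (u i) z\<bar> powr q + \<bar>D (u j) z\<bar> powr q) / 2
      - \<bar>(D (u i) z + D (u j) z) / 2\<bar> powr q" for i j z
  have D_mid: "D (\<lambda>x. 1/2 * (u i x + u j x)) = (\<lambda>z. (D (u i) z + D (u j) z) / 2)" for i j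
    using D_cmult[OF add[OF uV uV], of "1/2"] D_add[OF uV uV] by simp
  have midV: "(\<lambda>x. 1/2 * (u i x + u j x)) \<in> V" for i j by (intro cmult add uV)
  have intmid: "integrable M (\<lambda>z. \<bar>(D (u i) z + D (u j) z) / 2\<bar> powr q)" for i j
    using intE[OF midV] unfolding D_mid .
  have int_def: "integrable M (def i j)" for i j
    unfolding def_def[abs_def]
    by (intro Bochner_Integration.integrable_diff integrable_divide Bochner_Integration.integrable_add intE uV intmid)
  have defect: "(\<integral>z. def i j z \<partial>M) \<le> q / a / real (Suc n)" if ij: "i \<ge> n" "j \<ge> n" for i j n
  proof -
    have eq: "(\<integral>z. h z * def i j z \<partial>M) = (Eh (u i) + Eh (u j)) / 2 - Eh (\<lambda>x. 1/2 * (u i x + u j x))"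
    proof -
      have "(\<integral>z. h z * def i j z \<partial>M) = (\<integral>z. (h z * \<bar>D (u i) z\<bar> powr q + h z * \<bar>D (u j) z\<bar> powr q) / 2
         - h z * \<bar>(D (u i) z + D (u j) z) / 2\<bar> powr q \<partial>M)"
        by (simp add: def_def algebra_simps add_divide_distrib)
      also have "\<dots> = (Eh (u i) + Eh (u j)) / 2 - Eh (\<lambda>x. 1/2 * (u i x + u j x))"
        unfolding Eh_def D_mid using inth[OF intE[OF uV]] inth[OF intmid] by simp
      finally show ?thesis .
    qed
    have "(\<integral>z. h z * def i j z \<partial>M) / q
        = (Eh (u i) / q + Eh (u j) / q) / 2 - Eh (\<lambda>x. 1/2 * (u i x + u j x)) / q"
      unfolding eq using q by (simp add: field_simps)
    moreover have "J (\<lambda>x. 1/2 * (u i x + u j x)) \<ge> m" by (rule mle[OF midV])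
    moreover have "f (\<lambda>x. 1/2 * (u i x + u j x)) = (f (u i) + f (u j)) / 2"
      using f_cmult[OF add[OF uV[of i] uV[of j]], of "1/2"] f_add[OF uV[of i] uV[of j]] by simp
    ultimately have "(\<integral>z. h z * def i j z \<partial>M) / q \<le> (J (u i) + J (u j)) / 2 - m"
    proof -
      have arith: "I \<le> (A1 - f1 + (A2 - f2)) / 2 - m"
        if "I = (A1 + A2) / 2 - A3" "m \<le> A3 - f3" "f3 = (f1 + f2) / 2" for I A1 A2 A3 f1 f2 f3 :: real
        using that by (simp add: field_simps)
      show "(\<integral>z. h z * def i j z \<partial>M) / q \<le> (J (u i) + J (u j)) / 2 - m"
        if "(\<integral>z. h z * def i j z \<partial>M) / q = (Eh (u i) / q + Eh (u j) / q) / 2 - Eh (\<lambda>x. 1/2 * (u i x + u j x)) / q"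
          "m \<le> J (\<lambda>x. 1/2 * (u i x + u j x))"
          "f (\<lambda>x. 1/2 * (u i x + u j x)) = (f (u i) + f (u j)) / 2"
        using that unfolding J_def by (rule arith)
    qed
    also have "\<dots> \<le> 1 / real (Suc n)"
    proof -
      have "1 / real (Suc i) \<le> 1 / real (Suc n)" "1 / real (Suc j) \<le> 1 / real (Suc n)"
        using ij by (auto simp: field_simps)
      then show ?thesis using uJ[of i] uJ[of j] unfolding add_divide_distrib by linarith
    qed
    finally have "(\<integral>z. h z * def i j z \<partial>M) \<le> q / real (Suc n)" using q by (simp add: field_simps)
    moreover have "a * (\<integral>z. def i j z \<partial>M) \<le> (\<integral>z. h z * def i j z \<partial>M)"
      using midpoint_le[OF q] by (intro lower int_def) (auto simp: def_def)
    ultimately have "a * (\<integral>z. def i j z \<partial>M) \<le> q / real (Suc n)" by linarith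
    then have "(\<integral>z. def i j z \<partial>M) \<le> q / real (Suc n) / a"
      using a by (simp only: pos_le_divide_eq mult.commute)
    then show ?thesis by (simp add: divide_divide_eq_left mult.commute)
  qed
  have "Lq_Cauchy M q (\<lambda>n. D (u n))"
    unfolding Lq_Cauchy_def
  proof (intro allI impI)
    fix e :: real assume e: "e > 0"
    define e' where "e' = e / (4 * (R + 1))"
    have e': "e' > 0" "e' * (R + R) \<le> e / 2" using e R0 by (auto simp: e'_def field_simps)
    obtain Ce where Ce: "Ce > 0" "\<And>a b. \<bar>a - b\<bar> powr q \<le> e' * (\<bar>a\<bar> powr q + \<bar>b\<bar> powr q)
      + Ce * ((\<bar>a\<bar> powr q + \<bar>b\<bar> powr q) / 2 - \<bar>(a + b) / 2\<bar> powr q)"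
      using clarkson_eps[OF q e'(1)] by blast
    have "(\<lambda>n. Ce * (q / a / real (Suc n))) \<longlonglongrightarrow> 0"
      by (intro tendsto_mult_right_zero LIMSEQ_Suc[OF tendsto_divide_0[OF tendsto_const]])
        (simp add: filterlim_real_sequentially filterlim_at_top_imp_at_infinity)
    then have "eventually (\<lambda>n. Ce * (q / a / real (Suc n)) < e / 2) sequentially"
      using e by (intro order_tendstoD(2)) auto
    then obtain N where N: "Ce * (q / a / real (Suc N)) < e / 2"
      unfolding eventually_sequentially by blast
    show "\<exists>N. \<forall>i\<ge>N. \<forall>j\<ge>N. (\<integral>z. \<bar>D (u i) z - D (u j) z\<bar> powr q \<partial>M) \<le> e"
    proof (intro exI allI impI)
      fix i j assume ij: "N \<le> i" "N \<le> j"
      have "(\<integral>z. \<bar>D (u i) z - D (u j) z\<bar> powr q \<partial>M)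
        \<le> (\<integral>z. e' * (\<bar>D (u i) z\<bar> powr q + \<bar>D (u j) z\<bar> powr q) + Ce * def i j z \<partial>M)"
      proof (rule integral_mono)
        show "integrable M (\<lambda>z. \<bar>D (u i) z - D (u j) z\<bar> powr q)"
          using in_Lq_diff[OF q D_Lq[OF uV] D_Lq[OF uV]] by (simp add: in_Lq_def)
        show "integrable M (\<lambda>z. e' * (\<bar>D (u i) z\<bar> powr q + \<bar>D (u j) z\<bar> powr q) + Ce * def i j z)"
          using intE[OF uV] int_def by simp
      qed (unfold def_def, rule Ce(2))
      also have "\<dots> = e' * (E (u i) + E (u j)) + Ce * (\<integral>z. def i j z \<partial>M)"
        using intE[OF uV] int_def by (simp add: E_def)
      also have "\<dots> \<le> e' * (R + R) + Ce * (q / a / real (Suc N))"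
        using e' Ce(1) ER defect[OF ij] by (intro add_mono mult_left_mono) auto
      also have "\<dots> \<le> e" using e' N by linarith
      finally show "(\<integral>z. \<bar>D (u i) z - D (u j) z\<bar> powr q \<partial>M) \<le> e" .
    qed
  qed
  from complete[OF uV this] obtain w where w: "w \<in> V"
    and lim: "(\<lambda>n. \<integral>z. \<bar>D (u n) z - D w z\<bar> powr q \<partial>M) \<longlonglongrightarrow> 0" by blast
  have dL: "in_Lq M q (\<lambda>z. D (u n) z - D w z)" for n by (rule in_Lq_diff[OF q D_Lq[OF uV] D_Lq[OF w]])
  have sL: "in_Lq M (conj_exp q) (\<lambda>z. spow q (D w z))" by (rule in_Lq_spow[OF q D_Lq[OF w]])
  have Jw: "J w \<le> m"
  proof (rule LIMSEQ_le_const)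
    have l1: "(\<lambda>n. \<integral>z. h z * (spow q (D w z) * (D (u n) z - D w z)) \<partial>M) \<longlonglongrightarrow> 0"
    proof (rule Lim_null_comparison)
      show "(\<lambda>n. b * (\<integral>z. \<bar>spow q (D w z) * (D (u n) z - D w z)\<bar> \<partial>M)) \<longlonglongrightarrow> 0"
        by (rule tendsto_mult_right_zero[OF integral_abs_mult_tendsto_0[OF q dL lim sL]])
      show "\<forall>\<^sub>F n in sequentially. norm (\<integral>z. h z * (spow q (D w z) * (D (u n) z - D w z)) \<partial>M)
          \<le> b * (\<integral>z. \<bar>spow q (D w z) * (D (u n) z - D w z)\<bar> \<partial>M)"
        using abs_integral_bounded_mult_le[OF hm habs integrable_spow_mult[OF q D_Lq[OF w] dL]] by simp
    qed
    have l2: "(\<lambda>n. f (u n) - f w) \<longlonglongrightarrow> 0"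
    proof (rule Lim_null_comparison)
      have "(\<lambda>n. (\<integral>z. \<bar>D (u n) z - D w z\<bar> powr q \<partial>M) powr (1 / q)) \<longlonglongrightarrow> 0 powr (1 / q)"
        using q lim by (intro tendsto_powr') auto
      then show "(\<lambda>n. C * (\<integral>z. \<bar>D (u n) z - D w z\<bar> powr q \<partial>M) powr (1 / q)) \<longlonglongrightarrow> 0"
        by (intro tendsto_mult_right_zero) simp
      show "\<forall>\<^sub>F n in sequentially. norm (f (u n) - f w) \<le> C * (\<integral>z. \<bar>D (u n) z - D w z\<bar> powr q \<partial>M) powr (1 / q)"
      proof (rule always_eventually, rule allI)
        fix n
        have V': "(\<lambda>x. u n x + (-1) * w x) \<in> V" by (intro add cmult uV w)
        have "f (\<lambda>x. u n x + (-1) * w x) = f (u n) - f w"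
          using f_add[OF uV[of n] cmult[OF w, of "-1"]] f_cmult[OF w, of "-1"] by simp
        moreover have "D (\<lambda>x. u n x + (-1) * w x) = (\<lambda>z. D (u n) z - D w z)"
          using D_add[OF uV[of n] cmult[OF w, of "-1"]] D_cmult[OF w, of "-1"] by simp
        ultimately show "norm (f (u n) - f w) \<le> C * (\<integral>z. \<bar>D (u n) z - D w z\<bar> powr q \<partial>M) powr (1 / q)"
          using f_bound[OF V'] by simp
      qed
    qed
    have l3: "(\<lambda>n. 1 / real (Suc n)) \<longlonglongrightarrow> 0" by (rule LIMSEQ_inverse_real_of_nat[unfolded inverse_eq_divide])
    have "(\<lambda>n. m + 1 / real (Suc n) + (f (u n) - f w)
       - (\<integral>z. h z * (spow q (D w z) * (D (u n) z - D w z)) \<partial>M)) \<longlonglongrightarrow> m + 0 + 0 - 0"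
      by (intro tendsto_intros l1 l2 l3)
    then show "(\<lambda>n. m + 1 / real (Suc n) + (f (u n) - f w)
       - (\<integral>z. h z * (spow q (D w z) * (D (u n) z - D w z)) \<partial>M)) \<longlonglongrightarrow> m" by simp
    show "\<exists>N. \<forall>n\<ge>N. J w \<le> m + 1 / real (Suc n) + (f (u n) - f w)
       - (\<integral>z. h z * (spow q (D w z) * (D (u n) z - D w z)) \<partial>M)"
    proof (intro exI allI impI)
      fix n
      have i1: "integrable M (\<lambda>z. spow q (D w z) * (D (u n) z - D w z))"
        by (rule integrable_spow_mult[OF q D_Lq[OF w] dL])
      have "(\<integral>z. h z * (\<bar>D w z\<bar> powr q + q * (spow q (D w z) * (D (u n) z - D w z))) \<partial>M) \<le> Eh (u n)"
        unfolding Eh_def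
        by (rule mono) (use i1 intE[OF w] intE[OF uV] tangent_le[OF q] in \<open>auto simp: mult.assoc\<close>)
      also have "(\<integral>z. h z * (\<bar>D w z\<bar> powr q + q * (spow q (D w z) * (D (u n) z - D w z))) \<partial>M)
         = (\<integral>z. h z * \<bar>D w z\<bar> powr q + q * (h z * (spow q (D w z) * (D (u n) z - D w z))) \<partial>M)"
        by (simp add: algebra_simps)
      also have "\<dots> = Eh w + q * (\<integral>z. h z * (spow q (D w z) * (D (u n) z - D w z)) \<partial>M)"
        using inth[OF i1] inth[OF intE[OF w]] by (simp add: Eh_def)
      finally have "Eh w / q + (\<integral>z. h z * (spow q (D w z) * (D (u n) z - D w z)) \<partial>M) \<le> Eh (u n) / q"
        by (rule divq)
      then show "J w \<le> m + 1 / real (Suc n) + (f (u n) - f w)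
       - (\<integral>z. h z * (spow q (D w z) * (D (u n) z - D w z)) \<partial>M)"
        using uJ[of n] by (simp add: J_def)
    qed
  qed
  have EL: "f v \<le> (\<integral>z. h z * (spow q (D w z) * D v z) \<partial>M)" if v: "v \<in> V" for v
  proof (rule LIMSEQ_le_const)
    define t where "t n = 1 / real (Suc n)" for n
    have t: "t n > 0" "t n \<le> 1" for n by (auto simp: t_def)
    have tlim: "t \<longlonglongrightarrow> 0" unfolding t_def by (rule LIMSEQ_inverse_real_of_nat[unfolded inverse_eq_divide])
    define W where "W n z = D w z + t n * D v z" for n z
    have WV: "(\<lambda>x. w x + t n * v x) \<in> V" for n by (intro add cmult w v)
    have DW: "D (\<lambda>x. w x + t n * v x) = W n" for n
      using D_add[OF w cmult[OF v]] D_cmult[OF v] by (simp add: W_def fun_eq_iff)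
    have WL: "in_Lq M q (W n)" for n using D_Lq[OF WV] by (simp add: DW)
    have aL: "in_Lq M (conj_exp q) (\<lambda>z. spow q (W n z))" for n by (rule in_Lq_spow[OF q WL])
    have bL: "in_Lq M (conj_exp (conj_exp q)) (D v)" using D_Lq[OF v] by (simp add: conj_exp_conj_exp[OF q])
    have lim0: "(\<lambda>n. \<integral>z. \<bar>spow q (W n z) * D v z - spow q (D w z) * D v z\<bar> \<partial>M) \<longlonglongrightarrow> 0"
    proof (rule integral_abs_diff_mult_tendsto_0[OF conj_exp_gt1[OF q] aL _ _ _ bL])
      fix n
      have "(\<integral>z. \<bar>spow q (W n z)\<bar> powr conj_exp q \<partial>M) = (\<integral>z. \<bar>W n z\<bar> powr q \<partial>M)"
        by (simp add: abs_spow_powr_conj[OF q])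
      also have "\<dots> \<le> (\<integral>z. 2 powr q * (\<bar>D w z\<bar> powr q + \<bar>D v z\<bar> powr q) \<partial>M)"
      proof (rule integral_mono)
        fix z
        have "\<bar>t n * D v z\<bar> \<le> \<bar>D v z\<bar>" using t[of n] by (simp add: abs_mult mult_left_le_one_le)
        then have "\<bar>t n * D v z\<bar> powr q \<le> \<bar>D v z\<bar> powr q" using q by (intro powr_mono2) auto
        then have "\<bar>D w z\<bar> powr q + \<bar>t n * D v z\<bar> powr q \<le> \<bar>D w z\<bar> powr q + \<bar>D v z\<bar> powr q" by simp
        then show "\<bar>W n z\<bar> powr q \<le> 2 powr q * (\<bar>D w z\<bar> powr q + \<bar>D v z\<bar> powr q)"
          unfolding W_def using abs_add_powr_le[OF q, of "D w z" "t n * D v z"]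
          by (meson mult_left_mono order_trans powr_ge_zero)
      qed (use WL intE[OF w] intE[OF v] in \<open>auto simp: in_Lq_def\<close>)
      finally show "(\<integral>z. \<bar>spow q (W n z)\<bar> powr conj_exp q \<partial>M)
         \<le> (\<integral>z. 2 powr q * (\<bar>D w z\<bar> powr q + \<bar>D v z\<bar> powr q) \<partial>M)" .
    next
      have "(\<lambda>n. spow q (W n z)) \<longlonglongrightarrow> spow q (D w z + 0 * D v z)" for z
        unfolding W_def by (intro tendsto_spow[OF q] tendsto_intros tlim)
      then show "AE z in M. (\<lambda>n. spow q (W n z)) \<longlonglongrightarrow> spow q (D w z)" by simp
    qed (use in_LqD[OF D_Lq[OF w]] in simp)
    have iW: "integrable M (\<lambda>z. spow q (W n z) * D v z)" for n
      by (rule integrable_spow_mult[OF q WL D_Lq[OF v]])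
    have iw: "integrable M (\<lambda>z. spow q (D w z) * D v z)"
      by (rule integrable_spow_mult[OF q D_Lq[OF w] D_Lq[OF v]])
    have "(\<lambda>n. (\<integral>z. h z * (spow q (W n z) * D v z) \<partial>M) - (\<integral>z. h z * (spow q (D w z) * D v z) \<partial>M)) \<longlonglongrightarrow> 0"
      by (rule integral_bounded_mult_diff_tendsto_0[OF hm habs iW iw lim0])
    then show "(\<lambda>n. \<integral>z. h z * (spow q (W n z) * D v z) \<partial>M) \<longlonglongrightarrow> (\<integral>z. h z * (spow q (D w z) * D v z) \<partial>M)"
      by (rule LIM_zero_cancel)
    show "\<exists>N. \<forall>n\<ge>N. f v \<le> (\<integral>z. h z * (spow q (W n z) * D v z) \<partial>M)"
    proof (intro exI allI impI)
      fix n
      have intW: "integrable M (\<lambda>z. \<bar>W n z\<bar> powr q)" using WL by (simp add: in_Lq_def)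
      have "(\<integral>z. h z * (\<bar>W n z\<bar> powr q - q * t n * (spow q (W n z) * D v z)) \<partial>M) \<le> Eh w"
        unfolding Eh_def
      proof (rule mono)
        fix z
        show "\<bar>W n z\<bar> powr q - q * t n * (spow q (W n z) * D v z) \<le> \<bar>D w z\<bar> powr q"
          using tangent_le[OF q, of "W n z" "D w z"] by (simp add: W_def algebra_simps)
      qed (use intW iW intE[OF w] in auto)
      also have "(\<integral>z. h z * (\<bar>W n z\<bar> powr q - q * t n * (spow q (W n z) * D v z)) \<partial>M)
         = (\<integral>z. h z * \<bar>W n z\<bar> powr q - q * t n * (h z * (spow q (W n z) * D v z)) \<partial>M)"
        by (simp add: algebra_simps)
      also have "\<dots> = Eh (\<lambda>x. w x + t n * v x) - q * t n * (\<integral>z. h z * (spow q (W n z) * D v z) \<partial>M)"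
        using inth[OF iW] inth[OF intW] by (simp add: Eh_def DW)
      finally have "Eh (\<lambda>x. w x + t n * v x) + q * (- (t n * (\<integral>z. h z * (spow q (W n z) * D v z) \<partial>M))) \<le> Eh w"
        by (simp only: mult_minus_right mult.assoc diff_conv_add_uminus)
      from divq[OF this]
      have "Eh (\<lambda>x. w x + t n * v x) / q - Eh w / q \<le> t n * (\<integral>z. h z * (spow q (W n z) * D v z) \<partial>M)"
        by linarith
      moreover have "J w \<le> J (\<lambda>x. w x + t n * v x)" using Jw mle[OF WV] by (rule order_trans)
      moreover have "f (\<lambda>x. w x + t n * v x) = f w + t n * f v"
        using f_add[OF w cmult[OF v]] f_cmult[OF v] by simp
      ultimately have "t n * f v \<le> t n * (\<integral>z. h z * (spow q (W n z) * D v z) \<partial>M)"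
        unfolding J_def by linarith
      then show "f v \<le> (\<integral>z. h z * (spow q (W n z) * D v z) \<partial>M)" using t[of n] by simp
    qed
  qed
  have "(\<integral>z. h z * (spow q (D w z) * D v z) \<partial>M) = f v" if v: "v \<in> V" for v
  proof (rule antisym[OF _ EL[OF v]])
    have "f (\<lambda>x. -1 * v x) \<le> (\<integral>z. h z * (spow q (D w z) * D (\<lambda>x. -1 * v x) z) \<partial>M)"
      by (rule EL[OF cmult[OF v]])
    then show "(\<integral>z. h z * (spow q (D w z) * D v z) \<partial>M) \<le> f v"
      using f_cmult[OF v, of "-1"] D_cmult[OF v, of "-1"] by simp
  qed
  then show ?thesis using w by blast
qed

end

section \<open>Duality and weak compactness\<close>

text \<open>
  Hoelder's inequality with constant 2, from \<open>|x y| \<le> |x|^q + |y|^q'\<close> after normalising both factors.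
  Only the homogeneity of the bound matters below, as it makes \<open>a \<mapsto> \<integral> a b\<close> a bounded functional.
\<close>
lemma holder_const2:
  assumes q: "q > 1" and a: "in_Lq M q a" and b: "in_Lq M (conj_exp q) b"
  shows "\<bar>\<integral>z. a z * b z \<partial>M\<bar> \<le> 2 * (\<integral>z. \<bar>b z\<bar> powr (conj_exp q) \<partial>M) powr (1 / conj_exp q)
    * (\<integral>z. \<bar>a z\<bar> powr q \<partial>M) powr (1 / q)"
proof -
  define A where "A = (\<integral>z. \<bar>a z\<bar> powr q \<partial>M)"
  define B where "B = (\<integral>z. \<bar>b z\<bar> powr (conj_exp q) \<partial>M)"
  have q': "conj_exp q > 1" by (rule conj_exp_gt1[OF q])
  have ia: "integrable M (\<lambda>z. \<bar>a z\<bar> powr q)" and ib: "integrable M (\<lambda>z. \<bar>b z\<bar> powr (conj_exp q))"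
    using a b by (auto simp: in_Lq_def)
  have A0: "A \<ge> 0" and B0: "B \<ge> 0" by (auto simp: A_def B_def)
  show ?thesis
  proof (cases "A = 0 \<or> B = 0")
    case True
    then have "AE z in M. a z * b z = 0"
    proof
      assume "A = 0"
      then have "AE z in M. \<bar>a z\<bar> powr q = 0"
        using integral_nonneg_eq_0_iff_AE[OF ia] by (simp add: A_def)
      then show ?thesis by eventually_elim simp
    next
      assume "B = 0"
      then have "AE z in M. \<bar>b z\<bar> powr (conj_exp q) = 0"
        using integral_nonneg_eq_0_iff_AE[OF ib] by (simp add: B_def)
      then show ?thesis by eventually_elim simp
    qed
    then have "(\<integral>z. a z * b z \<partial>M) = 0" by (simp add: integral_eq_zero_AE)
    then show ?thesis by simp
  next
    case False
    then have pos: "A > 0" "B > 0" using A0 B0 by auto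
    define l where "l = A powr (1 / q)"
    define k where "k = B powr (1 / conj_exp q)"
    have l: "l > 0" "l powr q = A" using pos q by (auto simp: l_def powr_powr)
    have k: "k > 0" "k powr (conj_exp q) = B" using pos q' by (auto simp: k_def powr_powr)
    have "\<bar>\<integral>z. (a z / l) * (b z / k) \<partial>M\<bar> \<le> (\<integral>z. \<bar>(a z / l) * (b z / k)\<bar> \<partial>M)"
      by (rule integral_abs_bound)
    also have "\<dots> \<le> (\<integral>z. \<bar>a z\<bar> powr q / A + \<bar>b z\<bar> powr (conj_exp q) / B \<partial>M)"
    proof (rule integral_mono)
      show "integrable M (\<lambda>z. \<bar>(a z / l) * (b z / k)\<bar>)"
        using integrable_abs[OF integrable_divide[OF in_Lq_mult[OF q a b], of "l * k"]] by simp
      show "\<bar>(a z / l) * (b z / k)\<bar> \<le> \<bar>a z\<bar> powr q / A + \<bar>b z\<bar> powr (conj_exp q) / B" for z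
        using abs_mult_powr_conj_le[OF q, of "a z / l" "b z / k"] l k by (simp add: powr_divide)
    qed (use ia ib in auto)
    also have "\<dots> = A / A + B / B" using ia ib by (simp add: A_def B_def)
    also have "\<dots> = 2" using pos by simp
    finally have "\<bar>\<integral>z. (a z * b z) / (l * k) \<partial>M\<bar> \<le> 2" by simp
    then have "\<bar>\<integral>z. a z * b z \<partial>M\<bar> \<le> 2 * k * l" using l k by (simp add: abs_mult field_simps)
    then show ?thesis by (simp add: l_def k_def A_def B_def)
  qed
qed

lemma in_Lq_0: "in_Lq M q (\<lambda>_. 0)"
  by (simp add: in_Lq_def)

lemma Lq_dual_representation:
  fixes f :: "('c \<Rightarrow> real) \<Rightarrow> real"
  assumes q: "q > 1"
    and f_add: "\<And>u v. in_Lq M q u \<Longrightarrow> in_Lq M q v \<Longrightarrow> f (\<lambda>x. u x + v x) = f u + f v"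
    and f_cmult: "\<And>c u. in_Lq M q u \<Longrightarrow> f (\<lambda>x. c * u x) = c * f u"
    and f_bound: "\<And>u. in_Lq M q u \<Longrightarrow> \<bar>f u\<bar> \<le> C * (\<integral>z. \<bar>u z\<bar> powr q \<partial>M) powr (1 / q)"
  obtains g where "in_Lq M (conj_exp q) g" "\<And>v. in_Lq M q v \<Longrightarrow> f v = (\<integral>z. g z * v z \<partial>M)"
proof -
  interpret Lq_operator M q "{v. in_Lq M q v}" "\<lambda>u. u"
  proof
    fix u :: "nat \<Rightarrow> 'c \<Rightarrow> real"
    assume "\<And>n. u n \<in> {v. in_Lq M q v}" "Lq_Cauchy M q (\<lambda>n. u n)"
    then show "\<exists>v\<in>{v. in_Lq M q v}. (\<lambda>n. \<integral>z. \<bar>u n z - v z\<bar> powr q \<partial>M) \<longlonglongrightarrow> 0"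
      using Lq_complete[OF q, of M u] by auto
  qed (use q in \<open>auto intro: in_Lq_0 in_Lq_add in_Lq_cmult\<close>)
  have "\<exists>u\<in>{v. in_Lq M q v}. \<forall>v\<in>{v. in_Lq M q v}. (\<integral>z. 1 * (spow q (u z) * v z) \<partial>M) = f v"
    by (rule representation[where a = 1 and b = 1 and C = C]) (use f_add f_cmult f_bound in auto)
  then obtain u where "in_Lq M q u" "\<And>v. in_Lq M q v \<Longrightarrow> f v = (\<integral>z. spow q (u z) * v z \<partial>M)"
    by auto
  then show ?thesis using that in_Lq_spow[OF q] by blast
qed

lemma conj_exp_2: "conj_exp 2 = 2" by (simp add: conj_exp_def)

lemma spow_2: "spow 2 t = t" by (simp add: spow_def)

text \<open>
  Bounded sequences in \<open>L^2\<close> are handled without a countable dense set. A diagonal subsequence makes all inner products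
  \<open>\<integral> x (r n) * x i\<close> converge in \<open>n\<close>. The set \<open>V\<close> of those \<open>v \<in> L^2\<close> for which \<open>\<integral> x (r n) * v\<close> converges is
  then a closed subspace that contains all \<open>x i\<close>. The limit functional on \<open>V\<close> is represented by some
  \<open>u \<in> V\<close>. For an arbitrary \<open>v \<in> L^2\<close>, the functional \<open>w \<mapsto> \<integral> v * w\<close> on \<open>V\<close> is represented by some \<open>y \<in> V\<close>,
  the orthogonal projection of \<open>v\<close>, and \<open>v\<close> may be replaced by \<open>y\<close> in all inner products with elements of \<open>V\<close>.
\<close>
lemma L2_weak_compactness:
  fixes x :: "nat \<Rightarrow> 'c \<Rightarrow> real"
  assumes x: "\<And>n. in_Lq M 2 (x n)" and K: "\<And>n. (\<integral>z. \<bar>x n z\<bar> powr 2 \<partial>M) \<le> K"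
  obtains r u where "strict_mono (r :: nat \<Rightarrow> nat)" "in_Lq M 2 u"
    "\<And>v. in_Lq M 2 v \<Longrightarrow> (\<lambda>n. \<integral>z. x (r n) z * v z \<partial>M) \<longlonglongrightarrow> (\<integral>z. u z * v z \<partial>M)"
proof -
  have two: "(2::real) > 1" by simp
  have int: "integrable M (\<lambda>z. u z * v z)" if "in_Lq M 2 u" "in_Lq M 2 v" for u v :: "'c \<Rightarrow> real"
    using in_Lq_mult[OF two] that by (simp add: conj_exp_2)
  have holder: "\<bar>\<integral>z. u z * v z \<partial>M\<bar> \<le> 2 * (\<integral>z. \<bar>u z\<bar> powr 2 \<partial>M) powr (1 / 2) * (\<integral>z. \<bar>v z\<bar> powr 2 \<partial>M) powr (1 / 2)"
    if "in_Lq M 2 u" "in_Lq M 2 v" for u v :: "'c \<Rightarrow> real"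
    using holder_const2[OF two, of M v u] that by (simp add: conj_exp_2 mult.commute)
  have K0: "0 \<le> K" using order_trans[OF Bochner_Integration.integral_nonneg K[of 0]] by simp
  have holder_x: "\<bar>\<integral>z. x n z * v z \<partial>M\<bar> \<le> 2 * K powr (1 / 2) * (\<integral>z. \<bar>v z\<bar> powr 2 \<partial>M) powr (1 / 2)"
    if v: "in_Lq M 2 v" for n v
  proof -
    have "(\<integral>z. \<bar>x n z\<bar> powr 2 \<partial>M) powr (1 / 2) \<le> K powr (1 / 2)" using K by (intro powr_mono2) auto
    then have "2 * (\<integral>z. \<bar>x n z\<bar> powr 2 \<partial>M) powr (1 / 2) * (\<integral>z. \<bar>v z\<bar> powr 2 \<partial>M) powr (1 / 2)
       \<le> 2 * K powr (1 / 2) * (\<integral>z. \<bar>v z\<bar> powr 2 \<partial>M) powr (1 / 2)"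
      by (intro mult_right_mono) auto
    then show ?thesis using holder[OF x v, of n] by linarith
  qed
  define G where "G i n = (\<integral>z. x n z * x i z \<partial>M)" for i n
  have bdd: "bounded (range (G i))" for i
    unfolding bounded_iff G_def
    by (rule exI[of _ "2 * K powr (1 / 2) * (\<integral>z. \<bar>x i z\<bar> powr 2 \<partial>M) powr (1 / 2)"])
      (use holder_x[OF x[of i]] in \<open>simp only: ball_simps real_norm_def simp_thms\<close>)
  obtain r :: "nat \<Rightarrow> nat"
    where r: "strict_mono r" and conv: "\<And>i. convergent (\<lambda>n. G i (r n))"
    by (rule diagonal_subsequence[of G, OF bdd]) (rule that)
  define V where "V = {v. in_Lq M 2 v \<and> convergent (\<lambda>n. \<integral>z. x (r n) z * v z \<partial>M)}"
  have xV: "x i \<in> V" for i using x conv[of i] by (simp add: V_def G_def)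
  interpret Lq_operator M 2 V "\<lambda>u. u"
  proof
    show "(\<lambda>_. 0) \<in> V" by (simp add: V_def in_Lq_0 convergent_const)
    show "(\<lambda>x. u x + v x) \<in> V" if uv: "u \<in> V" "v \<in> V" for u v
    proof -
      have "(\<lambda>n. \<integral>z. x (r n) z * (u z + v z) \<partial>M) = (\<lambda>n. (\<integral>z. x (r n) z * u z \<partial>M) + (\<integral>z. x (r n) z * v z \<partial>M))"
        using uv int[OF x] by (auto simp: V_def distrib_left)
      then show ?thesis using uv by (auto simp: V_def in_Lq_add intro: convergent_add)
    qed
    show "(\<lambda>x. c * u x) \<in> V" if u: "u \<in> V" for c u
    proof -
      have "(\<lambda>n. \<integral>z. x (r n) z * (c * u z) \<partial>M) = (\<lambda>n. c * (\<integral>z. x (r n) z * u z \<partial>M))"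
        by (simp add: mult.left_commute)
      then show ?thesis using u by (auto simp: V_def in_Lq_cmult intro: convergent_mult convergent_const)
    qed
    show "in_Lq M 2 u" if "u \<in> V" for u using that by (simp add: V_def)
    fix v :: "nat \<Rightarrow> 'c \<Rightarrow> real"
    assume vV: "\<And>n. v n \<in> V" and cau: "Lq_Cauchy M 2 (\<lambda>n. v n)"
    have vL: "in_Lq M 2 (v n)" for n using vV by (simp add: V_def)
    obtain w where w: "in_Lq M 2 w" and lim: "(\<lambda>n. \<integral>z. \<bar>v n z - w z\<bar> powr 2 \<partial>M) \<longlonglongrightarrow> 0"
      using Lq_complete[OF two vL cau] by blast
    have "Cauchy (\<lambda>n. \<integral>z. x (r n) z * w z \<partial>M)"
    proof (rule metric_CauchyI)
      fix e :: real assume e: "e > 0"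
      have "(\<lambda>n. 2 * K powr (1 / 2) * (\<integral>z. \<bar>v n z - w z\<bar> powr 2 \<partial>M) powr (1 / 2)) \<longlonglongrightarrow> 2 * K powr (1/2) * 0 powr (1/2)"
        by (intro tendsto_intros tendsto_powr' lim) auto
      then have "eventually (\<lambda>n. 2 * K powr (1 / 2) * (\<integral>z. \<bar>v n z - w z\<bar> powr 2 \<partial>M) powr (1 / 2) < e / 3) sequentially"
        using e by (intro order_tendstoD(2)) auto
      then obtain n where n: "2 * K powr (1 / 2) * (\<integral>z. \<bar>v n z - w z\<bar> powr 2 \<partial>M) powr (1 / 2) < e / 3"
        unfolding eventually_sequentially by blast
      have close: "\<bar>(\<integral>z. x j z * v n z \<partial>M) - (\<integral>z. x j z * w z \<partial>M)\<bar> < e / 3" for j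
      proof -
        have "(\<integral>z. x j z * v n z \<partial>M) - (\<integral>z. x j z * w z \<partial>M) = (\<integral>z. x j z * (v n z - w z) \<partial>M)"
          using int[OF x vL] int[OF x w] by (simp add: right_diff_distrib)
        then show ?thesis using holder_x[OF in_Lq_diff[OF two vL[of n] w], of j] n by linarith
      qed
      have "Cauchy (\<lambda>j. \<integral>z. x (r j) z * v n z \<partial>M)"
        using vV[of n] by (simp add: V_def convergent_Cauchy)
      from metric_CauchyD[OF this, of "e / 3"] e
      obtain N where N: "\<And>i j. i \<ge> N \<Longrightarrow> j \<ge> N \<Longrightarrow>
          dist (\<integral>z. x (r i) z * v n z \<partial>M) (\<integral>z. x (r j) z * v n z \<partial>M) < e / 3"
        by auto
      show "\<exists>N. \<forall>i\<ge>N. \<forall>j\<ge>N. dist (\<integral>z. x (r i) z * w z \<partial>M) (\<integral>z. x (r j) z * w z \<partial>M) < e"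
      proof (intro exI allI impI)
        fix i j assume "N \<le> i" "N \<le> j"
        from N[OF this] show "dist (\<integral>z. x (r i) z * w z \<partial>M) (\<integral>z. x (r j) z * w z \<partial>M) < e"
          using close[of "r i"] close[of "r j"] unfolding dist_real_def by linarith
      qed
    qed
    then have "w \<in> V" using w by (simp add: V_def Cauchy_convergent)
    then show "\<exists>w\<in>V. (\<lambda>n. \<integral>z. \<bar>v n z - w z\<bar> powr 2 \<partial>M) \<longlonglongrightarrow> 0" using lim by blast
  qed auto
  define l where "l v = lim (\<lambda>n. \<integral>z. x (r n) z * v z \<partial>M)" for v
  have l: "(\<lambda>n. \<integral>z. x (r n) z * v z \<partial>M) \<longlonglongrightarrow> l v" if "v \<in> V" for v
    using that by (simp add: V_def l_def convergent_LIMSEQ_iff)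
  have "\<exists>u\<in>V. \<forall>v\<in>V. (\<integral>z. 1 * (spow 2 (u z) * v z) \<partial>M) = l v"
  proof (rule representation[where a = 1 and b = 1 and C = "2 * K powr (1 / 2)"])
    fix u v assume uv: "u \<in> V" "v \<in> V"
    have "(\<lambda>n. \<integral>z. x (r n) z * (u z + v z) \<partial>M) = (\<lambda>n. (\<integral>z. x (r n) z * u z \<partial>M) + (\<integral>z. x (r n) z * v z \<partial>M))"
      using uv int[OF x] by (auto simp: V_def distrib_left)
    then have "(\<lambda>n. \<integral>z. x (r n) z * (u z + v z) \<partial>M) \<longlonglongrightarrow> l u + l v"
      using tendsto_add[OF l l] uv by simp
    then show "l (\<lambda>x. u x + v x) = l u + l v"
      using l[OF add[OF uv]] LIMSEQ_unique by blast
  next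
    fix c u assume u: "u \<in> V"
    have "(\<lambda>n. \<integral>z. x (r n) z * (c * u z) \<partial>M) = (\<lambda>n. c * (\<integral>z. x (r n) z * u z \<partial>M))"
      by (simp add: mult.left_commute)
    then have "(\<lambda>n. \<integral>z. x (r n) z * (c * u z) \<partial>M) \<longlonglongrightarrow> c * l u"
      using tendsto_mult[OF tendsto_const l[OF u]] by simp
    then show "l (\<lambda>x. c * u x) = c * l u"
      using l[OF cmult[OF u]] LIMSEQ_unique by blast
  next
    fix v assume v: "v \<in> V"
    then have vL: "in_Lq M 2 v" by (simp add: V_def)
    show "\<bar>l v\<bar> \<le> 2 * K powr (1 / 2) * (\<integral>z. \<bar>v z\<bar> powr 2 \<partial>M) powr (1 / 2)"
      by (rule LIMSEQ_le_const2[OF tendsto_rabs[OF l[OF v]]]) (use holder_x[OF vL] in blast)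
  qed auto
  then obtain u where uV: "u \<in> V" and u: "\<And>v. v \<in> V \<Longrightarrow> (\<integral>z. u z * v z \<partial>M) = l v"
    by (auto simp: spow_2)
  have uL: "in_Lq M 2 u" using uV by (simp add: V_def)
  have "(\<lambda>n. \<integral>z. x (r n) z * v z \<partial>M) \<longlonglongrightarrow> (\<integral>z. u z * v z \<partial>M)" if v: "in_Lq M 2 v" for v
  proof -
    have "\<exists>y\<in>V. \<forall>w\<in>V. (\<integral>z. 1 * (spow 2 (y z) * w z) \<partial>M) = (\<integral>z. v z * w z \<partial>M)"
    proof (rule representation[where a = 1 and b = 1 and C = "2 * (\<integral>z. \<bar>v z\<bar> powr 2 \<partial>M) powr (1 / 2)"])
      show "\<bar>\<integral>z. v z * w z \<partial>M\<bar> \<le> 2 * (\<integral>z. \<bar>v z\<bar> powr 2 \<partial>M) powr (1 / 2) * (\<integral>z. \<bar>w z\<bar> powr 2 \<partial>M) powr (1 / 2)"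
        if "w \<in> V" for w using holder[OF v] that by (simp add: V_def)
      show "(\<integral>z. v z * (w z + y z) \<partial>M) = (\<integral>z. v z * w z \<partial>M) + (\<integral>z. v z * y z \<partial>M)"
        if "w \<in> V" "y \<in> V" for w y using int[OF v] that by (simp add: V_def distrib_left)
    qed (auto simp: mult.left_commute)
    then obtain y where yV: "y \<in> V" and y: "\<And>w. w \<in> V \<Longrightarrow> (\<integral>z. y z * w z \<partial>M) = (\<integral>z. v z * w z \<partial>M)"
      by (auto simp: spow_2)
    have "(\<integral>z. x i z * y z \<partial>M) = (\<integral>z. x i z * v z \<partial>M)" for i
      using y[OF xV[of i]] by (simp add: mult.commute)
    moreover have "l y = (\<integral>z. u z * v z \<partial>M)"
      using u[OF yV] y[OF uV] by (simp add: mult.commute)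
    ultimately show ?thesis using l[OF yV] by simp
  qed
  then show ?thesis using that[OF r uL] by blast
qed

text \<open>
  Weak-star compactness in \<open>L^\<infinity>\<close> is reduced to \<open>L^2\<close> by multiplying with a positive \<open>\<sigma> \<in> L^2\<close>. Pairings of
  \<open>h n\<close> with \<open>g\<close> become pairings of \<open>\<sigma> * h n\<close> with \<open>g / \<sigma>\<close>, and the \<open>g \<in> L^1\<close> with \<open>|g| \<le> m * \<sigma>^2\<close>, for which
  \<open>g / \<sigma>\<close> lies in \<open>L^2\<close>, are dense in \<open>L^1\<close>.
\<close>
lemma weak_star_compactness:
  fixes h :: "nat \<Rightarrow> 'c \<Rightarrow> real"
  assumes "sigma_finite_measure M"
    and hm [measurable]: "\<And>n. h n \<in> borel_measurable M"
    and hab: "\<And>n. AE z in M. a \<le> h n z \<and> h n z \<le> b"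
  obtains r h0 where "strict_mono (r :: nat \<Rightarrow> nat)" "h0 \<in> borel_measurable M"
    "AE z in M. a \<le> h0 z \<and> h0 z \<le> b"
    "\<And>g. integrable M g \<Longrightarrow> (\<lambda>n. \<integral>z. h (r n) z * g z \<partial>M) \<longlonglongrightarrow> (\<integral>z. h0 z * g z \<partial>M)"
proof -
  have two: "(2::real) > 1" by simp
  interpret sigma_finite_measure M by fact
  obtain \<rho>0 where rho0 [measurable]: "\<rho>0 \<in> borel_measurable M" and "integral\<^sup>N M \<rho>0 \<noteq> \<infinity>"
    and fin: "\<And>z. z \<in> space M \<Longrightarrow> 0 < \<rho>0 z \<and> \<rho>0 z < \<infinity>"
    using Ex_finite_integrable_function by blast
  define \<sigma> where "\<sigma> z = sqrt (enn2real (\<rho>0 z))" for z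
  have sm [measurable]: "\<sigma> \<in> borel_measurable M" unfolding \<sigma>_def by measurable
  have spos: "\<sigma> z > 0" if "z \<in> space M" for z
    using fin[OF that] by (simp add: \<sigma>_def enn2real_positive_iff)
  have sq: "\<bar>\<sigma> z\<bar> powr 2 = enn2real (\<rho>0 z)" for z
    by (simp add: \<sigma>_def powr_numeral)
  have "integrable M (\<lambda>z. enn2real (\<rho>0 z))"
  proof (rule integrableI_nonneg)
    have "(\<integral>\<^sup>+z. ennreal (enn2real (\<rho>0 z)) \<partial>M) = integral\<^sup>N M \<rho>0"
      by (rule nn_integral_cong) (use fin in \<open>auto simp: less_top\<close>)
    then show "(\<integral>\<^sup>+z. ennreal (enn2real (\<rho>0 z)) \<partial>M) < \<infinity>"
      using \<open>integral\<^sup>N M \<rho>0 \<noteq> \<infinity>\<close> by (simp add: less_top)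
  qed auto
  then have sL: "in_Lq M 2 \<sigma>" by (simp add: in_Lq_def sq sm)
  define c where "c = max \<bar>a\<bar> \<bar>b\<bar>"
  have c0: "c \<ge> 0" by (simp add: c_def)
  have hc: "AE z in M. \<bar>h n z\<bar> \<le> c" for n
    using hab[of n] by eventually_elim (auto simp: c_def)
  define x where "x n z = \<sigma> z * h n z" for n z
  have xm [measurable]: "x n \<in> borel_measurable M" for n unfolding x_def by measurable
  have xle: "AE z in M. \<bar>x n z\<bar> powr 2 \<le> \<bar>c * \<sigma> z\<bar> powr 2" for n
    using hc[of n]
  proof eventually_elim
    fix z assume "\<bar>h n z\<bar> \<le> c"
    then have "\<bar>\<sigma> z\<bar> * \<bar>h n z\<bar> \<le> \<bar>\<sigma> z\<bar> * c" by (intro mult_left_mono) auto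
    then have "\<bar>x n z\<bar> \<le> \<bar>c * \<sigma> z\<bar>" using c0 by (simp add: x_def abs_mult mult.commute)
    then show "\<bar>x n z\<bar> powr 2 \<le> \<bar>c * \<sigma> z\<bar> powr 2" by (intro powr_mono2) auto
  qed
  have csL: "in_Lq M 2 (\<lambda>z. c * \<sigma> z)" by (rule in_Lq_cmult[OF sL])
  have xL: "in_Lq M 2 (x n)" for n
  proof -
    have "integrable M (\<lambda>z. \<bar>x n z\<bar> powr 2)"
      by (rule Bochner_Integration.integrable_bound[OF in_Lq_integrable[OF csL]]) (use xle[of n] in auto)
    then show ?thesis by (simp add: in_Lq_def xm)
  qed
  have "(\<integral>z. \<bar>x n z\<bar> powr 2 \<partial>M) \<le> (\<integral>z. \<bar>c * \<sigma> z\<bar> powr 2 \<partial>M)" for n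
    by (rule integral_mono_AE[OF in_Lq_integrable[OF xL] in_Lq_integrable[OF csL] xle])
  then obtain r u where r: "strict_mono (r :: nat \<Rightarrow> nat)"
    and uL: "in_Lq M 2 u"
    and lim: "\<And>v. in_Lq M 2 v \<Longrightarrow> (\<lambda>n. \<integral>z. x (r n) z * v z \<partial>M) \<longlonglongrightarrow> (\<integral>z. u z * v z \<partial>M)"
    by (rule L2_weak_compactness[of M x, OF xL]) (rule that)
  have um [measurable]: "u \<in> borel_measurable M" using uL by (simp add: in_Lq_def)
  have int: "integrable M (\<lambda>z. u z * v z)" if "in_Lq M 2 u" "in_Lq M 2 v" for u v :: "'c \<Rightarrow> real"
    using in_Lq_mult[OF two] that by (simp add: conj_exp_2)
  have dom: "in_Lq M 2 v" if "in_Lq M 2 w" "v \<in> borel_measurable M" "\<And>z. \<bar>v z\<bar> \<le> \<bar>w z\<bar>" for v w :: "'c \<Rightarrow> real"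
  proof -
    have "integrable M (\<lambda>z. \<bar>v z\<bar> powr 2)"
      by (rule Bochner_Integration.integrable_bound[OF in_Lq_integrable[OF that(1)]])
        (use that in \<open>auto simp flip: abs_le_square_iff\<close>)
    then show ?thesis using that by (simp add: in_Lq_def)
  qed
  \<comment> \<open>A linear inequality between \<open>x n\<close> and \<open>\<sigma>\<close> passes to the weak limit, by testing with the negative
    part \<open>v\<close> of the limit expression.\<close>
  have sign: "AE z in M. 0 \<le> t * u z + s * \<sigma> z"
    if ge: "\<And>n. AE z in M. 0 \<le> t * x n z + s * \<sigma> z" for t s :: real
  proof -
    define y where "y z = t * u z + s * \<sigma> z" for z
    have yL: "in_Lq M 2 y" unfolding y_def by (intro in_Lq_add in_Lq_cmult uL sL two)
    have ym [measurable]: "y \<in> borel_measurable M" by (rule in_LqD[OF yL])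
    define v where "v z = max 0 (- y z)" for z
    have vm: "v \<in> borel_measurable M" unfolding v_def by measurable
    have vL: "in_Lq M 2 v" by (rule dom[OF yL vm]) (simp add: v_def)
    have "(\<lambda>n. t * (\<integral>z. x (r n) z * v z \<partial>M) + s * (\<integral>z. \<sigma> z * v z \<partial>M))
       \<longlonglongrightarrow> t * (\<integral>z. u z * v z \<partial>M) + s * (\<integral>z. \<sigma> z * v z \<partial>M)"
      by (intro tendsto_intros lim vL)
    moreover have "t * (\<integral>z. x (r n) z * v z \<partial>M) + s * (\<integral>z. \<sigma> z * v z \<partial>M) \<ge> 0" for n
    proof -
      have "t * (\<integral>z. x (r n) z * v z \<partial>M) + s * (\<integral>z. \<sigma> z * v z \<partial>M)
        = (\<integral>z. t * (x (r n) z * v z) + s * (\<sigma> z * v z) \<partial>M)"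
        using int[OF xL vL] int[OF sL vL] by simp
      also have "\<dots> = (\<integral>z. (t * x (r n) z + s * \<sigma> z) * v z \<partial>M)" by (simp add: algebra_simps)
      also have "\<dots> \<ge> 0"
        by (rule integral_nonneg_AE) (use ge[of "r n"] in eventually_elim, auto simp: v_def)
      finally show ?thesis .
    qed
    ultimately have "t * (\<integral>z. u z * v z \<partial>M) + s * (\<integral>z. \<sigma> z * v z \<partial>M) \<ge> 0"
      by (intro LIMSEQ_le_const) auto
    also have "t * (\<integral>z. u z * v z \<partial>M) + s * (\<integral>z. \<sigma> z * v z \<partial>M)
        = (\<integral>z. t * (u z * v z) + s * (\<sigma> z * v z) \<partial>M)"
      using int[OF uL vL] int[OF sL vL] by simp
    also have "\<dots> = (\<integral>z. - (v z * v z) \<partial>M)"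
      by (rule Bochner_Integration.integral_cong) (auto simp: v_def y_def max_def algebra_simps)
    finally have "(\<integral>z. v z * v z \<partial>M) = 0"
      by (simp add: antisym Bochner_Integration.integral_nonneg)
    then have "AE z in M. v z * v z = 0"
      using integral_nonneg_eq_0_iff_AE[OF int[OF vL vL]] by simp
    then show ?thesis by eventually_elim (auto simp: v_def y_def max_def split: if_splits)
  qed
  define h0 where "h0 z = u z / \<sigma> z" for z
  have h0m [measurable]: "h0 \<in> borel_measurable M" unfolding h0_def by measurable
  have sp: "AE z in M. \<sigma> z > 0" using spos by (auto intro: AE_I2)
  have "AE z in M. 0 \<le> 1 * x n z + (- a) * \<sigma> z" for n
    using hab[of n] sp by eventually_elim (simp add: x_def mult.commute mult_left_mono)
  from sign[OF this] have A: "AE z in M. 0 \<le> 1 * u z + (- a) * \<sigma> z" .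
  have "AE z in M. 0 \<le> (-1) * x n z + b * \<sigma> z" for n
    using hab[of n] sp by eventually_elim (simp add: x_def mult.commute mult_left_mono)
  from sign[OF this] have B: "AE z in M. 0 \<le> (-1) * u z + b * \<sigma> z" .
  have h0ab: "AE z in M. a \<le> h0 z \<and> h0 z \<le> b"
    using A B sp by eventually_elim (simp add: h0_def field_simps)
  have h0c: "AE z in M. \<bar>h0 z\<bar> \<le> c" using h0ab by eventually_elim (auto simp: c_def)
  have "(\<lambda>n. \<integral>z. h (r n) z * g z \<partial>M) \<longlonglongrightarrow> (\<integral>z. h0 z * g z \<partial>M)" if g: "integrable M g" for g
  proof (rule LIMSEQ_I)
    have gm [measurable]: "g \<in> borel_measurable M" using g by auto
    fix e :: real assume e: "e > 0"
    \<comment> \<open>\<open>gt n / \<sigma>\<close> is bounded by \<open>n * \<sigma>\<close> and therefore an admissible test function in \<open>L^2\<close>.\<close>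
    define gt where "gt n z = (if \<bar>g z\<bar> \<le> real n * (\<sigma> z * \<sigma> z) then g z else 0)" for n z
    have gtm [measurable]: "gt n \<in> borel_measurable M" for n unfolding gt_def by measurable
    have gtle: "\<bar>gt n z\<bar> \<le> \<bar>g z\<bar>" for n z by (simp add: gt_def)
    have gti: "integrable M (gt n)" for n
      by (rule Bochner_Integration.integrable_bound[OF g]) (use gtle in auto)
    have "(\<lambda>n. \<integral>z. \<bar>g z - gt n z\<bar> \<partial>M) \<longlonglongrightarrow> (\<integral>z. 0 \<partial>M)"
    proof (rule integral_dominated_convergence[where w = "\<lambda>z. \<bar>g z\<bar>"])
      show "AE z in M. (\<lambda>n. \<bar>g z - gt n z\<bar>) \<longlonglongrightarrow> 0"
        using sp
      proof eventually_elim
        fix z assume "\<sigma> z > 0"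
        obtain N where N: "\<bar>g z\<bar> / (\<sigma> z * \<sigma> z) \<le> real N" using real_arch_simple by blast
        have "\<bar>g z\<bar> \<le> real n * (\<sigma> z * \<sigma> z)" if "n \<ge> N" for n
        proof -
          have "\<bar>g z\<bar> / (\<sigma> z * \<sigma> z) \<le> real n" using N that by linarith
          then show ?thesis using \<open>\<sigma> z > 0\<close> by (simp add: field_simps)
        qed
        then have "eventually (\<lambda>n. \<bar>g z - gt n z\<bar> = 0) sequentially"
          unfolding eventually_sequentially by (intro exI[of _ N]) (simp add: gt_def)
        then show "(\<lambda>n. \<bar>g z - gt n z\<bar>) \<longlonglongrightarrow> 0" by (rule tendsto_eventually)
      qed
      show "AE z in M. norm \<bar>g z - gt n z\<bar> \<le> \<bar>g z\<bar>" for n by (simp add: gt_def)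
    qed (use g in auto)
    then have "(\<lambda>n. c * (\<integral>z. \<bar>g z - gt n z\<bar> \<partial>M)) \<longlonglongrightarrow> 0" by (intro tendsto_mult_right_zero) simp
    then have "eventually (\<lambda>n. c * (\<integral>z. \<bar>g z - gt n z\<bar> \<partial>M) < e / 3) sequentially"
      using e by (intro order_tendstoD(2)) auto
    then obtain m where m: "c * (\<integral>z. \<bar>g z - gt m z\<bar> \<partial>M) < e / 3"
      unfolding eventually_sequentially by blast
    have close: "\<bar>(\<integral>z. k z * g z \<partial>M) - (\<integral>z. k z * gt m z \<partial>M)\<bar> < e / 3"
      if k: "k \<in> borel_measurable M" "AE z in M. \<bar>k z\<bar> \<le> c" for k
    proof -
      have "(\<integral>z. k z * g z \<partial>M) - (\<integral>z. k z * gt m z \<partial>M) = (\<integral>z. k z * (g z - gt m z) \<partial>M)"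
        using integrable_bounded_mult[OF k g] integrable_bounded_mult[OF k gti[of m]] by (simp add: right_diff_distrib)
      then show ?thesis
        using abs_integral_bounded_mult_le[OF k, of "\<lambda>z. g z - gt m z"] g gti[of m] m by simp
    qed
    define v where "v z = gt m z / \<sigma> z" for z
    have vL: "in_Lq M 2 v"
    proof (rule dom)
      show "in_Lq M 2 (\<lambda>z. real m * \<sigma> z)" by (rule in_Lq_cmult[OF sL])
      fix z
      show "\<bar>v z\<bar> \<le> \<bar>real m * \<sigma> z\<bar>"
      proof (cases "\<sigma> z = 0")
        case False
        then show ?thesis by (auto simp: v_def gt_def abs_mult divide_le_eq mult.assoc)
      qed (simp add: v_def)
    qed (simp add: v_def[abs_def])
    have "(\<integral>z. x n z * v z \<partial>M) = (\<integral>z. h n z * gt m z \<partial>M)" for n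
      by (rule integral_cong_AE) (use sp in \<open>auto simp: x_def v_def elim!: eventually_mono\<close>)
    moreover have "(\<integral>z. u z * v z \<partial>M) = (\<integral>z. h0 z * gt m z \<partial>M)"
      by (rule integral_cong_AE) (auto simp: h0_def v_def)
    ultimately have "(\<lambda>n. \<integral>z. h (r n) z * gt m z \<partial>M) \<longlonglongrightarrow> (\<integral>z. h0 z * gt m z \<partial>M)"
      using lim[OF vL] by simp
    from LIMSEQ_D[OF this, of "e / 3"] e obtain N
      where N: "\<And>n. n \<ge> N \<Longrightarrow> \<bar>(\<integral>z. h (r n) z * gt m z \<partial>M) - (\<integral>z. h0 z * gt m z \<partial>M)\<bar> < e / 3"
      by auto
    show "\<exists>N. \<forall>n\<ge>N. norm ((\<integral>z. h (r n) z * g z \<partial>M) - (\<integral>z. h0 z * g z \<partial>M)) < e"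
    proof (intro exI allI impI)
      fix n assume "n \<ge> N"
      from N[OF this] show "norm ((\<integral>z. h (r n) z * g z \<partial>M) - (\<integral>z. h0 z * g z \<partial>M)) < e"
        using close[OF hm hc, of "r n"] close[OF h0m h0c] unfolding real_norm_def by linarith
    qed
  qed
  then show ?thesis using that[OF r h0m h0ab] by blast
qed

section \<open>The difference quotient and the Poincare inequality\<close>

text \<open>
  With the factor \<open>k^(1/p)\<close> included, the energy is \<open>\<integral> |diff_quot p k u|^p\<close>, the form is
  \<open>\<integral> h * spow p (diff_quot p k u) * diff_quot p k v\<close> and the flux is \<open>h * spow p (diff_quot p k u)\<close>.
  On the diagonal the value is \<open>0\<close>, so that these identities hold at every point.
\<close>
definition diff_quot :: "real \<Rightarrow> (real \<Rightarrow> real) \<Rightarrow> ('a::euclidean_space \<Rightarrow> real) \<Rightarrow> 'a \<times> 'a \<Rightarrow> real" where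
  "diff_quot p k u = (\<lambda>(x', x). k (norm (x' - x)) powr (1 / p) * (u x' - u x) / norm (x' - x))"

lemma AE_lborel_pairI:
  fixes P :: "'a::euclidean_space \<Rightarrow> bool"
  assumes "AE x in lborel. P x"
  shows "AE z in (lborel :: ('a \<times> 'a) measure). P (fst z) \<and> P (snd z)"
proof -
  obtain N where N: "{x \<in> space lborel. \<not> P x} \<subseteq> N" "N \<in> null_sets lborel"
    using assms by (auto simp: eventually_ae_filter)
  have b: "N \<in> sets borel" using N(2) by (auto simp: null_sets_def)
  have "N \<times> UNIV \<in> null_sets (lborel :: ('a \<times> 'a) measure)"
    unfolding null_sets_def lborel_prod[symmetric] using N(2)
    by (auto simp: lborel.emeasure_pair_measure_Times null_sets_def)
  moreover have "UNIV \<times> N \<in> null_sets (lborel :: ('a \<times> 'a) measure)"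
    unfolding null_sets_def lborel_prod[symmetric] using N(2)
    by (auto simp: lborel.emeasure_pair_measure_Times null_sets_def)
  ultimately have "N \<times> UNIV \<union> UNIV \<times> N \<in> null_sets (lborel :: ('a \<times> 'a) measure)" by blast
  then show ?thesis
    by (rule AE_I') (use N(1) in auto)
qed

locale nonlocal_space =
  fixes \<Omega> :: "'a::euclidean_space set" and p s c0 :: real and k :: "real \<Rightarrow> real"
  assumes bounded: "bounded \<Omega>" and \<Omega>: "\<Omega> \<in> sets borel"
    and p: "1 < p" and s: "0 < s" and c0: "0 < c0"
    and kernel: "admissible_kernel TYPE('a) p s c0 k"
begin

abbreviation "X0 \<equiv> X0_space p k \<Omega>"
abbreviation D :: "('a \<Rightarrow> real) \<Rightarrow> 'a \<times> 'a \<Rightarrow> real" where "D \<equiv> diff_quot p k"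
abbreviation \<E> :: "('a \<Rightarrow> real) \<Rightarrow> real" where "\<E> w \<equiv> (\<integral>z. \<bar>D w z\<bar> powr p \<partial>lborel)"
abbreviation \<N> :: "('a \<Rightarrow> real) \<Rightarrow> real" where "\<N> w \<equiv> (\<integral>x. \<bar>w x\<bar> powr p \<partial>lborel)"
abbreviation \<I> :: "'a set \<Rightarrow> ('a \<Rightarrow> real) \<Rightarrow> real" where "\<I> Q w \<equiv> (\<integral>x. indicator Q x * w x \<partial>lborel)"

lemma k_pos: "r > 0 \<Longrightarrow> 0 < k r"
  using kernel by (simp add: admissible_kernel_def)

text \<open>
  Measurability of the kernel is implicit in its integrability on compact balls.
\<close>
lemma kernel_measurable [measurable]: "(\<lambda>z::'a. k (norm z)) \<in> borel_measurable borel"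
proof (rule borel_measurable_LIMSEQ_real)
  show "(\<lambda>n. indicator (cball 0 (real n)) z *\<^sub>R k (norm z)) \<longlonglongrightarrow> k (norm z)" for z :: 'a
  proof (rule tendsto_eventually)
    obtain N where "norm z \<le> real N" using real_arch_simple by blast
    then show "eventually (\<lambda>n. indicator (cball 0 (real n)) z *\<^sub>R k (norm z) = k (norm z)) sequentially"
      unfolding eventually_sequentially by (intro exI[of _ N]) (auto simp: indicator_def)
  qed
  show "(\<lambda>z::'a. indicator (cball 0 (real n)) z *\<^sub>R k (norm z)) \<in> borel_measurable borel" for n
  proof -
    have "set_integrable lborel (cball (0::'a) (real n)) (\<lambda>z. k (norm z))"
      using kernel by (simp add: admissible_kernel_def)
    then show ?thesis unfolding set_integrable_def by (auto dest: borel_measurable_integrable)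
  qed
qed

lemma kernel_diff_measurable [measurable]: "(\<lambda>z. k (norm (fst z - snd z :: 'a))) \<in> borel_measurable borel"
proof -
  have "(\<lambda>z. fst z - snd z :: 'a) \<in> borel \<rightarrow>\<^sub>M borel"
    by (intro borel_measurable_continuous_onI continuous_intros)
  from measurable_compose[OF this kernel_measurable] show ?thesis .
qed

lemma fst_snd_measurable [measurable]:
  "(fst :: 'a \<times> 'a \<Rightarrow> 'a) \<in> borel \<rightarrow>\<^sub>M borel" "(snd :: 'a \<times> 'a \<Rightarrow> 'a) \<in> borel \<rightarrow>\<^sub>M borel"
  by (intro borel_measurable_continuous_onI continuous_intros)+

lemma D_measurable [measurable]:
  assumes [measurable]: "w \<in> borel_measurable borel"
  shows "D w \<in> borel_measurable borel"
proof -
  have [measurable]: "(\<lambda>z. norm (fst z - snd z :: 'a)) \<in> borel_measurable borel"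
    by (intro borel_measurable_continuous_onI continuous_intros)
  show ?thesis unfolding diff_quot_def case_prod_beta by measurable
qed

lemma abs_D_powr:
  "\<bar>D w (x', x)\<bar> powr p = k (norm (x' - x)) * (\<bar>w x' - w x\<bar> powr p / norm (x' - x) powr p)"
proof (cases "x' = x")
  case False
  then have "k (norm (x' - x)) > 0" by (simp add: k_pos)
  then show ?thesis using p
    by (simp add: diff_quot_def abs_mult powr_mult powr_divide powr_powr)
qed (simp add: diff_quot_def)

lemma energy_eq: "energy p k w = (\<integral>\<^sup>+z. ennreal (\<bar>D w z\<bar> powr p) \<partial>lborel)"
  unfolding energy_def by (intro nn_integral_cong) (auto simp only: abs_D_powr split: prod.split)

lemma X_space_iff: "w \<in> X_space p k \<longleftrightarrow> in_Lq lborel p w \<and> in_Lq lborel p (D w)"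
proof -
  have "energy p k w < \<infinity> \<longleftrightarrow> integrable lborel (\<lambda>z. \<bar>D w z\<bar> powr p)" if "w \<in> borel_measurable borel"
    unfolding energy_eq using that by (subst integrable_iff_bounded) auto
  then show ?thesis by (auto simp: X_space_def Lp_space_iff in_Lq_def)
qed

lemma X0_iff: "w \<in> X0 \<longleftrightarrow> in_Lq lborel p w \<and> in_Lq lborel p (D w) \<and> (AE x in lborel. x \<notin> \<Omega> \<longrightarrow> w x = 0)"
  by (auto simp: X0_space_def X_space_iff)

lemma X0D:
  assumes "w \<in> X0"
  shows "in_Lq lborel p w" "in_Lq lborel p (D w)" "AE x in lborel. x \<notin> \<Omega> \<longrightarrow> w x = 0"
    "w \<in> borel_measurable borel"
  using assms by (auto simp: X0_iff in_Lq_def)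

lemma X0_norm_eq:
  assumes "in_Lq lborel p (D w)" shows "X0_norm p k w = \<E> w powr (1 / p)"
proof -
  have "energy p k w = ennreal (\<E> w)"
    unfolding energy_eq using assms by (intro nn_integral_eq_integral) (auto simp: in_Lq_def)
  then show ?thesis by (simp add: X0_norm_def)
qed

lemma D_add: "D (\<lambda>x. u x + v x) = (\<lambda>z. D u z + D v z)"
  by (auto simp: diff_quot_def fun_eq_iff algebra_simps add_divide_distrib diff_divide_distrib)

lemma D_cmult: "D (\<lambda>x. c * u x) = (\<lambda>z. c * D u z)"
  by (auto simp: diff_quot_def fun_eq_iff algebra_simps diff_divide_distrib)

lemma D_diff: "D (\<lambda>x. u x - v x) = (\<lambda>z. D u z - D v z)"
  by (auto simp: diff_quot_def fun_eq_iff algebra_simps add_divide_distrib diff_divide_distrib)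

lemma X0_0: "(\<lambda>_. 0) \<in> X0"
  by (auto simp: X0_iff in_Lq_def diff_quot_def case_prod_beta)

lemma X0_add:
  assumes "u \<in> X0" "v \<in> X0" shows "(\<lambda>x. u x + v x) \<in> X0"
proof -
  have "AE x in lborel. x \<notin> \<Omega> \<longrightarrow> u x + v x = 0"
    using X0D(3)[OF assms(1)] X0D(3)[OF assms(2)] by eventually_elim auto
  then show ?thesis using X0D[OF assms(1)] X0D[OF assms(2)] by (simp add: X0_iff D_add in_Lq_add[OF p])
qed

lemma X0_cmult:
  assumes "u \<in> X0" shows "(\<lambda>x. c * u x) \<in> X0"
proof -
  have "AE x in lborel. x \<notin> \<Omega> \<longrightarrow> c * u x = 0"
    using X0D(3)[OF assms] by eventually_elim auto
  then show ?thesis using X0D[OF assms] by (simp add: X0_iff D_cmult in_Lq_cmult)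
qed

lemma X0_diff: "u \<in> X0 \<Longrightarrow> v \<in> X0 \<Longrightarrow> (\<lambda>x. u x - v x) \<in> X0"
  using X0_add[OF _ X0_cmult[of v "-1"], of u] by simp

text \<open>
  This is where the lower bound \<open>c0 / |z|^(N + (s - 1) p)\<close> on the kernel enters: after division by \<open>|z|^p\<close>
  it becomes \<open>c0 / |z|^(N + s p)\<close>, which is at least \<open>c0 / R^(N + s p)\<close> for \<open>|z| \<le> R\<close>.
\<close>
lemma diff_powr_le:
  assumes R: "norm (x' - x) \<le> R" "R > 0"
  shows "\<bar>w x' - w x\<bar> powr p \<le> R powr (real DIM('a) + s * p) / c0 * \<bar>D w (x', x)\<bar> powr p"
proof (cases "x' = x")
  case False
  define r where "r = norm (x' - x)"
  have r: "r > 0" using False by (simp add: r_def)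
  have "c0 / r powr (real DIM('a) + (s - 1) * p) \<le> k r"
    using kernel False unfolding admissible_kernel_def r_def by (metis right_minus_eq)
  then have "c0 / r powr (real DIM('a) + (s - 1) * p) * (\<bar>w x' - w x\<bar> powr p / r powr p)
     \<le> \<bar>D w (x', x)\<bar> powr p"
    unfolding abs_D_powr r_def[symmetric] by (intro mult_right_mono) auto
  moreover have "r powr (real DIM('a) + (s - 1) * p) * r powr p = r powr (real DIM('a) + s * p)"
    by (subst powr_add[symmetric]) (simp add: algebra_simps)
  ultimately have "c0 * \<bar>w x' - w x\<bar> powr p / r powr (real DIM('a) + s * p) \<le> \<bar>D w (x', x)\<bar> powr p"
    by simp
  then have "\<bar>w x' - w x\<bar> powr p \<le> r powr (real DIM('a) + s * p) / c0 * \<bar>D w (x', x)\<bar> powr p"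
    using r c0 by (simp add: field_simps)
  also have "\<dots> \<le> R powr (real DIM('a) + s * p) / c0 * \<bar>D w (x', x)\<bar> powr p"
    using R r c0 s p by (intro mult_right_mono divide_right_mono powr_mono2) (auto simp: r_def)
  finally show ?thesis .
qed (use c0 in simp)

lemma abs_le_1_powr: "\<bar>t\<bar> \<le> 1 + \<bar>t\<bar> powr p" for t :: real
proof (cases "\<bar>t\<bar> \<le> 1")
  case False
  then have "\<bar>t\<bar> powr 1 \<le> \<bar>t\<bar> powr p" using p by (intro powr_mono) auto
  then show ?thesis using False by simp
qed (simp add: add_increasing2)

lemma integrable_indicator_mult:
  fixes g :: "'b::euclidean_space \<Rightarrow> real"
  assumes "Q \<in> sets borel" "integrable lborel g"
  shows "integrable lborel (\<lambda>y. indicator Q y * g y)"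
  using integrable_mult_indicator[of Q lborel g] assms by simp

lemma integrable_on_finite:
  assumes w: "in_Lq lborel p w" and Q: "Q \<in> sets borel" "emeasure lborel Q < \<infinity>"
  shows "integrable lborel (\<lambda>y. indicator Q y * w y)"
    "\<bar>\<I> Q w\<bar> \<le> measure lborel Q + \<N> w"
proof -
  have [measurable]: "w \<in> borel_measurable borel" "Q \<in> sets borel" using w Q by (auto simp: in_Lq_def)
  have i1: "integrable lborel (\<lambda>y. indicator Q y * 1 :: real)" using Q by simp
  have i: "integrable lborel (\<lambda>y. indicator Q y + \<bar>w y\<bar> powr p)"
    using i1 in_Lq_integrable[OF w] by simp
  have le: "\<bar>indicator Q y * w y\<bar> \<le> indicator Q y + \<bar>w y\<bar> powr p" for y
    using abs_le_1_powr[of "w y"] by (auto simp: indicator_def)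
  show ii: "integrable lborel (\<lambda>y. indicator Q y * w y)"
    by (rule Bochner_Integration.integrable_bound[OF i]) (use order_trans[OF le abs_ge_self] in auto)
  have "\<bar>\<I> Q w\<bar> \<le> (\<integral>y. \<bar>indicator Q y * w y\<bar> \<partial>lborel)"
    by (rule integral_abs_bound)
  also have "\<dots> \<le> (\<integral>y. indicator Q y + \<bar>w y\<bar> powr p \<partial>lborel)"
    by (rule integral_mono[OF integrable_abs[OF ii] i le])
  also have "\<dots> = measure lborel Q + \<N> w"
    using i1 in_Lq_integrable[OF w] by simp
  finally show "\<bar>\<I> Q w\<bar> \<le> measure lborel Q + \<N> w" .
qed

lemma integrable_indicator_diff_powr:
  assumes w: "in_Lq lborel p w" and Q: "Q \<in> sets borel" "emeasure lborel Q < \<infinity>"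
  shows "integrable lborel (\<lambda>y. indicator Q y * \<bar>c - w y\<bar> powr p)"
proof -
  have [measurable]: "w \<in> borel_measurable borel" "Q \<in> sets borel" using w Q by (auto simp: in_Lq_def)
  have "integrable lborel (\<lambda>y. indicator Q y * (2 powr p * (\<bar>c\<bar> powr p + \<bar>w y\<bar> powr p)))"
  proof -
    have "integrable lborel (\<lambda>y. (2 powr p * \<bar>c\<bar> powr p) * indicator Q y + 2 powr p * (indicator Q y * \<bar>w y\<bar> powr p))"
      using Q by (intro Bochner_Integration.integrable_add integrable_mult_right integrable_indicator_mult
        in_Lq_integrable[OF w]) auto
    then show ?thesis by (simp add: algebra_simps)
  qed
  then show ?thesis
    by (rule Bochner_Integration.integrable_bound)
      (use abs_diff_powr_le[OF p] in \<open>auto simp: indicator_def\<close>)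
qed

text \<open>
  Jensen's inequality: for \<open>x \<in> A\<close> and the mean \<open>c\<close> of \<open>w\<close> over \<open>Q\<close>, the tangent inequality at
  \<open>w x - c\<close>, integrated over \<open>y \<in> Q\<close>, gives \<open>|Q| |w x - c|^p \<le> \<integral>_Q |w x - w y|^p dy\<close>, because the linear
  term has integral zero. With \<open>Q\<close> outside \<open>\<Omega>\<close> and \<open>c = 0\<close> this yields the Poincare inequality, with
  \<open>A = Q\<close> a small cube it yields the compactness estimate.
\<close>
lemma mean_deviation_le:
  assumes w: "in_Lq lborel p w" and Dw: "in_Lq lborel p (D w)"
    and A: "A \<in> sets borel" "emeasure lborel A < \<infinity>"
    and Q: "Q \<in> sets borel" "emeasure lborel Q < \<infinity>"
    and R: "R > 0" "\<And>x y. x \<in> A \<Longrightarrow> y \<in> Q \<Longrightarrow> norm (x - y) \<le> R"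
    and c: "\<I> Q w = c * measure lborel Q"
  shows "measure lborel Q * (\<integral>x. indicator A x * \<bar>w x - c\<bar> powr p \<partial>lborel)
    \<le> R powr (real DIM('a) + s * p) / c0 * (\<integral>z. indicator (A \<times> Q) z * \<bar>D w z\<bar> powr p \<partial>lborel)"
proof -
  have [measurable]: "w \<in> borel_measurable borel" "D w \<in> borel_measurable borel" "A \<in> sets borel" "Q \<in> sets borel"
    using w Dw A Q by (auto simp: in_Lq_def)
  define F where "F z = indicator (A \<times> Q) z * \<bar>D w z\<bar> powr p" for z
  have AQ: "A \<times> Q \<in> sets (borel :: ('a \<times> 'a) measure)"
    using A Q by (simp add: borel_prod[symmetric] pair_measureI)
  have F: "integrable (lborel \<Otimes>\<^sub>M lborel) F"
    unfolding lborel_prod F_def by (rule integrable_indicator_mult[OF AQ in_Lq_integrable[OF Dw]])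
  have "measure lborel Q * (\<integral>x. indicator A x * \<bar>w x - c\<bar> powr p \<partial>lborel)
     = (\<integral>x. measure lborel Q * (indicator A x * \<bar>w x - c\<bar> powr p) \<partial>lborel)" by simp
  also have "\<dots> \<le> (\<integral>x. R powr (real DIM('a) + s * p) / c0 * (\<integral>y. F (x, y) \<partial>lborel) \<partial>lborel)"
  proof (rule integral_mono_AE)
    have "integrable lborel (\<lambda>x. indicator A x * \<bar>c - w x\<bar> powr p)"
      by (rule integrable_indicator_diff_powr[OF w A])
    then show "integrable lborel (\<lambda>x. measure lborel Q * (indicator A x * \<bar>w x - c\<bar> powr p))"
      by (simp add: abs_minus_commute)
    show "integrable lborel (\<lambda>x. R powr (real DIM('a) + s * p) / c0 * (\<integral>y. F (x, y) \<partial>lborel))"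
      using lborel_pair.integrable_fst'[OF F] by simp
    show "AE x in lborel. measure lborel Q * (indicator A x * \<bar>w x - c\<bar> powr p)
        \<le> R powr (real DIM('a) + s * p) / c0 * (\<integral>y. F (x, y) \<partial>lborel)"
      using lborel_pair.AE_integrable_fst'[OF F]
    proof eventually_elim
      fix x assume Fx: "integrable lborel (\<lambda>y. F (x, y))"
      show "measure lborel Q * (indicator A x * \<bar>w x - c\<bar> powr p) \<le> R powr (real DIM('a) + s * p) / c0 * (\<integral>y. F (x, y) \<partial>lborel)"
      proof (cases "x \<in> A")
        case True
        define t where "t = w x - c"
        have iQ: "integrable lborel (\<lambda>y. indicator Q y :: real)" using Q by simp
        note iw = integrable_on_finite(1)[OF w Q]
        have "measure lborel Q * \<bar>t\<bar> powr p
            = (\<integral>y. \<bar>t\<bar> powr p * indicator Q y + p * spow p t * (c * indicator Q y - indicator Q y * w y) \<partial>lborel)"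
          using iQ iw c by simp
        also have "\<dots> \<le> (\<integral>y. indicator Q y * \<bar>w x - w y\<bar> powr p \<partial>lborel)"
        proof (rule integral_mono)
          show "integrable lborel (\<lambda>y. indicator Q y * \<bar>w x - w y\<bar> powr p)"
            by (rule integrable_indicator_diff_powr[OF w Q])
          show "\<bar>t\<bar> powr p * indicator Q y + p * spow p t * (c * indicator Q y - indicator Q y * w y)
             \<le> indicator Q y * \<bar>w x - w y\<bar> powr p" for y
            using tangent_le[OF p, of t "w x - w y"] by (auto simp: indicator_def t_def)
        qed (use iQ iw in simp)
        also have "\<dots> \<le> (\<integral>y. R powr (real DIM('a) + s * p) / c0 * F (x, y) \<partial>lborel)"
        proof (rule integral_mono)
          show "integrable lborel (\<lambda>y. indicator Q y * \<bar>w x - w y\<bar> powr p)"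
            by (rule integrable_indicator_diff_powr[OF w Q])
          show "indicator Q y * \<bar>w x - w y\<bar> powr p \<le> R powr (real DIM('a) + s * p) / c0 * F (x, y)" for y
            using True diff_powr_le[OF R(2) R(1), of x y w] by (cases "y \<in> Q") (auto simp: F_def)
        qed (use Fx in simp)
        finally show ?thesis using True by (simp add: t_def)
      next
        case False
        then show ?thesis by (simp add: F_def)
      qed
    qed
  qed
  also have "\<dots> = R powr (real DIM('a) + s * p) / c0 * (\<integral>z. F z \<partial>(lborel \<Otimes>\<^sub>M lborel))"
    using lborel_pair.integral_fst'[OF F] by simp
  finally show ?thesis by (simp add: F_def lborel_prod)
qed

lemma integral_X0_on_\<Omega>:
  assumes "w \<in> X0"
  shows "(\<integral>x. indicator \<Omega> x * \<bar>w x\<bar> powr p \<partial>lborel) = \<N> w"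
proof (rule integral_cong_AE)
  have [measurable]: "w \<in> borel_measurable borel" using X0D[OF assms] by simp
  have [measurable]: "\<Omega> \<in> sets borel" by (rule \<Omega>)
  show "(\<lambda>x. indicator \<Omega> x * \<bar>w x\<bar> powr p) \<in> borel_measurable lborel"
    "(\<lambda>x. \<bar>w x\<bar> powr p) \<in> borel_measurable lborel" by measurable
  show "AE x in lborel. indicator \<Omega> x * \<bar>w x\<bar> powr p = \<bar>w x\<bar> powr p"
    using X0D(3)[OF assms] by eventually_elim (auto simp: indicator_def)
qed

lemma emeasure_\<Omega>: "emeasure lborel \<Omega> < \<infinity>"
  using emeasure_bounded_finite[OF bounded] by simp

text \<open>
  Functions in \<open>X0\<close> vanish on a unit ball \<open>Q\<close> placed outside of the bounded set \<open>\<Omega>\<close>, and all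
  distances between points of \<open>\<Omega>\<close> and of \<open>Q\<close> are at most \<open>2 * R0 + 3\<close>.
\<close>
lemma poincare:
  obtains C where "C \<ge> 0" "\<And>w. w \<in> X0 \<Longrightarrow> \<N> w \<le> C * \<E> w"
proof -
  obtain R0 where R0: "R0 > 0" "\<And>x. x \<in> \<Omega> \<Longrightarrow> norm x \<le> R0"
    using bounded unfolding bounded_pos by blast
  obtain e :: 'a where e: "norm e = R0 + 2" using vector_choose_size[of "R0 + 2"] R0 by auto
  define Q where "Q = ball e 1"
  have Q: "Q \<in> sets borel" "emeasure lborel Q < \<infinity>"
    unfolding Q_def using emeasure_bounded_finite[OF bounded_ball] by auto
  have Qpos: "measure lborel Q > 0"
    using content_ball_pos[of 1 e] by (simp add: Q_def)
  have QO: "y \<notin> \<Omega>" if "y \<in> Q" for y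
  proof
    assume "y \<in> \<Omega>"
    then have "norm y \<le> R0" by (rule R0)
    moreover have "norm e \<le> norm y + dist e y" by (metis dist_norm norm_triangle_sub)
    ultimately show False using that e by (simp add: Q_def)
  qed
  define R where "R = 2 * R0 + 3"
  have R: "R > 0" "norm (x - y) \<le> R" if "x \<in> \<Omega>" "y \<in> Q" for x y
  proof -
    show "R > 0" using R0 by (simp add: R_def)
    have "norm (x - y) \<le> norm x + norm y" by (rule norm_triangle_ineq4)
    moreover have "norm y \<le> norm e + dist e y" by (metis dist_norm norm_triangle_sub dist_commute)
    ultimately show "norm (x - y) \<le> R" using R0(2)[OF that(1)] that(2) e by (simp add: R_def Q_def)
  qed
  have Rpos: "R > 0" using R0 by (simp add: R_def)
  show ?thesis
  proof (rule that[of "R powr (real DIM('a) + s * p) / c0 / measure lborel Q"])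
    show "0 \<le> R powr (real DIM('a) + s * p) / c0 / measure lborel Q" using c0 by simp
    fix w assume w: "w \<in> X0"
    note wD = X0D[OF w]
    have "\<I> Q w = 0"
    proof (rule integral_eq_zero_AE)
      show "AE y in lborel. indicator Q y * w y = 0"
        using wD(3) by eventually_elim (use QO in \<open>auto simp: indicator_def\<close>)
    qed
    then have "measure lborel Q * (\<integral>x. indicator \<Omega> x * \<bar>w x - 0\<bar> powr p \<partial>lborel)
      \<le> R powr (real DIM('a) + s * p) / c0 * (\<integral>z. indicator (\<Omega> \<times> Q) z * \<bar>D w z\<bar> powr p \<partial>lborel)"
      using R Rpos by (intro mean_deviation_le wD \<Omega> emeasure_\<Omega> Q) auto
    also have "\<dots> \<le> R powr (real DIM('a) + s * p) / c0 * \<E> w"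
    proof (intro mult_left_mono integral_mono)
      have "\<Omega> \<times> Q \<in> sets (borel :: ('a \<times> 'a) measure)"
        using \<Omega> Q by (simp add: borel_prod[symmetric] pair_measureI)
      then show "integrable lborel (\<lambda>z. indicator (\<Omega> \<times> Q) z * \<bar>D w z\<bar> powr p)"
        by (rule integrable_indicator_mult[OF _ in_Lq_integrable[OF wD(2)]])
    qed (use in_Lq_integrable[OF wD(2)] c0 in \<open>auto simp: indicator_def\<close>)
    finally have "\<N> w * measure lborel Q
        \<le> R powr (real DIM('a) + s * p) / c0 * \<E> w"
      using integral_X0_on_\<Omega>[OF w] by (simp only: diff_zero mult.commute)
    then have "\<N> w
        \<le> R powr (real DIM('a) + s * p) / c0 * \<E> w / measure lborel Q"
      using Qpos by (simp only: pos_le_divide_eq)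
    then show "\<N> w \<le> R powr (real DIM('a) + s * p) / c0 / measure lborel Q * \<E> w"
      by (simp only: times_divide_eq_left)
  qed
qed

end

section \<open>Compactness of bounded energy\<close>

lemma cube_grid:
  fixes S :: "'a::euclidean_space set" and e :: real
  assumes S: "bounded S" and e: "e > 0"
  obtains \<Q> where "finite \<Q>" "disjoint \<Q>" "S \<subseteq> \<Union>\<Q>"
    "\<And>Q. Q \<in> \<Q> \<Longrightarrow> Q \<in> sets borel" "\<And>Q. Q \<in> \<Q> \<Longrightarrow> emeasure lborel Q < \<infinity>"
    "\<And>Q. Q \<in> \<Q> \<Longrightarrow> e ^ DIM('a) \<le> measure lborel Q"
    "\<And>Q x y. Q \<in> \<Q> \<Longrightarrow> x \<in> Q \<Longrightarrow> y \<in> Q \<Longrightarrow> norm (x - y) \<le> real DIM('a) * e"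
proof -
  define cell :: "('a \<Rightarrow> int) \<Rightarrow> 'a set"
    where "cell f = {x. \<forall>b\<in>Basis. \<lfloor>x \<bullet> b / e\<rfloor> = f b}" for f
  obtain R where R: "R > 0" "\<And>x. x \<in> S \<Longrightarrow> norm x \<le> R"
    using S unfolding bounded_pos by blast
  define m where "m = \<lceil>R / e\<rceil> + 1"
  define \<Q> where "\<Q> = cell ` (Basis \<rightarrow>\<^sub>E {-m..m})"
  have diam: "norm (x - y) \<le> real DIM('a) * e" if "x \<in> cell f" "y \<in> cell f" for x y f
  proof -
    have "\<bar>(x - y) \<bullet> b\<bar> \<le> e" if b: "b \<in> Basis" for b
    proof -
      have "\<lfloor>x \<bullet> b / e\<rfloor> = \<lfloor>y \<bullet> b / e\<rfloor>" using \<open>x \<in> cell f\<close> \<open>y \<in> cell f\<close> b by (simp add: cell_def)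
      then have "\<bar>x \<bullet> b / e - y \<bullet> b / e\<bar> < 1" by linarith
      then have "\<bar>(x - y) \<bullet> b / e\<bar> < 1" by (simp add: inner_diff_left diff_divide_distrib)
      then show ?thesis using e by simp
    qed
    then have "(\<Sum>b\<in>Basis. \<bar>(x - y) \<bullet> b\<bar>) \<le> (\<Sum>b\<in>(Basis::'a set). e)" by (rule sum_mono)
    then show ?thesis using norm_le_l1[of "x - y"] by simp
  qed
  have meas: "cell f \<in> sets borel" for f
  proof -
    have "cell f = {x \<in> space borel. \<forall>b\<in>Basis. \<lfloor>x \<bullet> b / e\<rfloor> = f b}" by (auto simp: cell_def)
    also have "\<dots> \<in> sets borel" by measurable
    finally show ?thesis .
  qed
  have bnd: "bounded (cell f)" for f
  proof (cases "cell f = {}")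
    case False
    then obtain y where "y \<in> cell f" by blast
    then have "cell f \<subseteq> cball y (real DIM('a) * e)"
      using diam by (auto simp: dist_norm norm_minus_commute)
    then show ?thesis using bounded_cball bounded_subset by blast
  qed simp
  have fin: "emeasure lborel (cell f) < \<infinity>" for f using emeasure_bounded_finite[OF bnd] by simp
  have vol: "e ^ DIM('a) \<le> measure lborel (cell f)" for f
  proof -
    define l u :: 'a where "l = (\<Sum>b\<in>Basis. (e * of_int (f b)) *\<^sub>R b)"
      and "u = (\<Sum>b\<in>Basis. (e * (of_int (f b) + 1)) *\<^sub>R b)"
    have lb: "l \<bullet> b = e * of_int (f b)" "u \<bullet> b = e * (of_int (f b) + 1)" if "b \<in> Basis" for b
      using that by (auto simp: l_def u_def)
    have "box l u \<subseteq> cell f"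
    proof
      fix x assume x: "x \<in> box l u"
      show "x \<in> cell f" unfolding cell_def
      proof (intro CollectI ballI)
        fix b :: 'a assume b: "b \<in> Basis"
        then have "e * of_int (f b) < x \<bullet> b" "x \<bullet> b < e * (of_int (f b) + 1)"
          using x lb by (auto simp: mem_box)
        then show "\<lfloor>x \<bullet> b / e\<rfloor> = f b"
          using e by (intro floor_unique) (auto simp: field_simps)
      qed
    qed
    have "(\<Prod>b\<in>Basis. (u - l) \<bullet> b) = (\<Prod>b\<in>(Basis :: 'a set). e)"
      by (rule prod.cong) (auto simp: inner_diff_left lb algebra_simps)
    then have "measure lborel (box l u) = e ^ DIM('a)"
      using e lb by (subst measure_lborel_box_eq) (auto simp: algebra_simps)
    moreover have "measure lborel (box l u) \<le> measure lborel (cell f)"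
      by (rule measure_mono_fmeasurable[OF \<open>box l u \<subseteq> cell f\<close>])
        (use fin meas in \<open>auto simp: fmeasurable_def\<close>)
    ultimately show ?thesis by simp
  qed
  have disj: "disjoint \<Q>"
  proof (rule disjointI)
    fix A B assume "A \<in> \<Q>" "B \<in> \<Q>" "A \<noteq> B"
    then obtain f g where fg: "A = cell f" "B = cell g" "f \<in> Basis \<rightarrow>\<^sub>E {-m..m}" "g \<in> Basis \<rightarrow>\<^sub>E {-m..m}"
      by (auto simp: \<Q>_def)
    show "A \<inter> B = {}"
    proof (rule ccontr)
      assume "A \<inter> B \<noteq> {}"
      then obtain x where "x \<in> cell f" "x \<in> cell g" using fg by blast
      then have "f = g" using fg(3,4) by (intro PiE_ext) (auto simp: cell_def)
      then show False using \<open>A \<noteq> B\<close> fg by simp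
    qed
  qed
  have cover: "S \<subseteq> \<Union>\<Q>"
  proof
    fix x assume x: "x \<in> S"
    define f where "f = restrict (\<lambda>b. \<lfloor>x \<bullet> b / e\<rfloor>) (Basis :: 'a set)"
    have "f \<in> Basis \<rightarrow>\<^sub>E {-m..m}"
    proof (unfold f_def, rule restrict_PiE_iff[THEN iffD2], rule ballI)
      fix b :: 'a assume b: "b \<in> Basis"
      have "\<bar>x \<bullet> b\<bar> \<le> R" using Basis_le_norm[OF b, of x] R(2)[OF x] by linarith
      then have "\<bar>x \<bullet> b / e\<bar> \<le> R / e" using e by (simp add: divide_right_mono)
      then show "\<lfloor>x \<bullet> b / e\<rfloor> \<in> {-m..m}" unfolding m_def atLeastAtMost_iff by linarith
    qed
    moreover have "x \<in> cell f" by (simp add: cell_def f_def)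
    ultimately show "x \<in> \<Union>\<Q>" by (auto simp: \<Q>_def)
  qed
  have "finite \<Q>" unfolding \<Q>_def by (intro finite_imageI finite_PiE) auto
  then show ?thesis
  proof (rule that[of \<Q>, OF _ disj cover])
    fix Q assume "Q \<in> \<Q>"
    then obtain f where Q: "Q = cell f" by (auto simp: \<Q>_def)
    show "Q \<in> sets borel" "emeasure lborel Q < \<infinity>" "e ^ DIM('a) \<le> measure lborel Q"
      "\<And>x y. x \<in> Q \<Longrightarrow> y \<in> Q \<Longrightarrow> norm (x - y) \<le> real DIM('a) * e"
      unfolding Q using meas fin vol diam by auto
  qed
qed

context nonlocal_space
begin

text \<open>
  On cubes of side \<open>e\<close> the deviation of \<open>w\<close> from its means has \<open>p\<close>-th power integral at most a constant
  times \<open>e^(s p)\<close> times the energy: the factor \<open>(n e)^(n + s p)\<close> comes from the kernel on points of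
  the same cube, and the division by the volume removes \<open>e^n\<close>. Since \<open>s > 0\<close>, small cubes make this
  smaller than \<open>\<delta>\<close>; what remains are the finitely many means.
\<close>
lemma compactness_estimate:
  assumes \<delta>: "\<delta> > 0"
  obtains \<Q> C where "finite \<Q>" "\<And>Q. Q \<in> \<Q> \<Longrightarrow> Q \<in> sets borel \<and> emeasure lborel Q < \<infinity>"
    "\<And>w. w \<in> X0 \<Longrightarrow> \<N> w \<le> \<delta> * \<E> w
       + C * (\<Sum>Q\<in>\<Q>. \<bar>\<I> Q w\<bar> powr p)"
proof -
  define n where "n = real DIM('a)"
  have n: "n \<ge> 1" by (simp add: n_def Suc_leI)
  define L where "L = 2 powr p * n powr (n + s * p) / c0"
  have L: "L > 0" using n c0 by (simp add: L_def)
  have sp: "s * p > 0" using s p by simp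
  \<comment> \<open>This mesh size makes the constant \<open>L * e powr (s * p)\<close> in front of the energy equal to \<open>\<delta>\<close>.\<close>
  define e where "e = (\<delta> / L) powr (1 / (s * p))"
  have e: "e > 0" "e powr (s * p) = \<delta> / L" using \<delta> L sp by (auto simp: e_def powr_powr)
  obtain \<Q> :: "'a set set" where Q: "finite \<Q>" "disjoint \<Q>" "\<Omega> \<subseteq> \<Union>\<Q>"
    "\<And>Q. Q \<in> \<Q> \<Longrightarrow> Q \<in> sets borel" "\<And>Q. Q \<in> \<Q> \<Longrightarrow> emeasure lborel Q < \<infinity>"
    "\<And>Q. Q \<in> \<Q> \<Longrightarrow> e ^ DIM('a) \<le> measure lborel Q"
    "\<And>Q x y. Q \<in> \<Q> \<Longrightarrow> x \<in> Q \<Longrightarrow> y \<in> Q \<Longrightarrow> norm (x - y) \<le> real DIM('a) * e"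
    by (rule cube_grid[OF bounded e(1)]) (rule that)
  define v where "v = e ^ DIM('a)"
  have v: "v > 0" "v = e powr n" using e by (auto simp: v_def n_def powr_realpow)
  define K where "K = (n * e) powr (n + s * p) / c0"
  have coef: "2 powr p * (K / v) = \<delta>"
  proof -
    have "(n * e) powr (n + s * p) = n powr (n + s * p) * (v * (\<delta> / L))"
      using n e v by (simp add: powr_mult powr_add)
    then have "2 powr p * (K / v) = L * (\<delta> / L)" using v(1) by (simp add: K_def L_def)
    then show ?thesis using L by simp
  qed
  define mt where "mt = (\<Sum>Q\<in>\<Q>. measure lborel Q)"
  have mQ: "measure lborel Q \<le> mt" if "Q \<in> \<Q>" for Q
    unfolding mt_def using Q(1) that by (intro member_le_sum) auto
  define C where "C = 2 powr p * mt / v powr p"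
  show ?thesis
  proof (rule that[of \<Q> C])
    show "finite \<Q>" "\<And>Q. Q \<in> \<Q> \<Longrightarrow> Q \<in> sets borel \<and> emeasure lborel Q < \<infinity>" using Q by auto
    fix w assume w: "w \<in> X0"
    note wD = X0D[OF w]
    note ip = in_Lq_integrable[OF wD(1)]
    note iD = in_Lq_integrable[OF wD(2)]
    define I where "I Q = \<I> Q w" for Q
    define T where "T Q = (\<integral>z. indicator (Q \<times> Q) z * \<bar>D w z\<bar> powr p \<partial>lborel)" for Q
    have one: "(\<integral>x. indicator Q x * \<bar>w x\<bar> powr p \<partial>lborel) \<le> 2 powr p * (K / v * T Q + mt / v powr p * \<bar>I Q\<bar> powr p)"
      if QQ: "Q \<in> \<Q>" for Q
    proof -
      have mpos: "measure lborel Q > 0" using Q(6)[OF QQ] v(1) unfolding v_def by linarith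
      define c where "c = I Q / measure lborel Q"
      have dev: "measure lborel Q * (\<integral>x. indicator Q x * \<bar>w x - c\<bar> powr p \<partial>lborel) \<le> K * T Q"
        unfolding K_def T_def n_def
      proof (rule mean_deviation_le[OF wD(1,2)])
        show "real DIM('a) * e > 0" using e by simp
        show "\<I> Q w = c * measure lborel Q"
          using mpos by (simp add: c_def I_def)
      qed (use Q QQ in auto)
      have K0: "K \<ge> 0" "T Q \<ge> 0" using c0 by (auto simp: K_def T_def)
      have dev': "(\<integral>x. indicator Q x * \<bar>w x - c\<bar> powr p \<partial>lborel) \<le> K / v * T Q"
      proof -
        have "v * (\<integral>x. indicator Q x * \<bar>w x - c\<bar> powr p \<partial>lborel)
            \<le> measure lborel Q * (\<integral>x. indicator Q x * \<bar>w x - c\<bar> powr p \<partial>lborel)"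
          using Q(6)[OF QQ] by (intro mult_right_mono) (auto simp: v_def)
        then show ?thesis using dev v by (simp add: field_simps)
      qed
      have i1: "integrable lborel (\<lambda>x. indicator Q x * \<bar>w x\<bar> powr p)"
        by (rule integrable_indicator_mult[OF Q(4)[OF QQ] ip])
      have i2: "integrable lborel (\<lambda>x. indicator Q x * \<bar>w x - c\<bar> powr p)"
        using integrable_indicator_diff_powr[OF wD(1) Q(4)[OF QQ] Q(5)[OF QQ], of c] by (simp add: abs_minus_commute)
      have i3: "integrable lborel (\<lambda>x. indicator Q x :: real)" using Q(4,5)[OF QQ] by simp
      have "(\<integral>x. indicator Q x * \<bar>w x\<bar> powr p \<partial>lborel)
        \<le> (\<integral>x. 2 powr p * (indicator Q x * \<bar>w x - c\<bar> powr p + \<bar>c\<bar> powr p * indicator Q x) \<partial>lborel)"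
      proof (rule integral_mono[OF i1])
        show "indicator Q x * \<bar>w x\<bar> powr p
          \<le> 2 powr p * (indicator Q x * \<bar>w x - c\<bar> powr p + \<bar>c\<bar> powr p * indicator Q x)" for x
          using abs_add_powr_le[OF p, of "w x - c" c] by (auto simp: indicator_def)
      qed (use i2 i3 in simp)
      also have "\<dots> = 2 powr p * ((\<integral>x. indicator Q x * \<bar>w x - c\<bar> powr p \<partial>lborel) + \<bar>c\<bar> powr p * measure lborel Q)"
        using i2 i3 by simp
      also have "\<dots> \<le> 2 powr p * (K / v * T Q + mt / v powr p * \<bar>I Q\<bar> powr p)"
      proof (intro mult_left_mono add_mono dev')
        have "v \<le> measure lborel Q" using Q(6)[OF QQ] by (simp only: v_def)
        then have "\<bar>I Q\<bar> / measure lborel Q \<le> \<bar>I Q\<bar> / v"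
          by (rule divide_left_mono[OF _ _ mult_pos_pos[OF mpos v(1)]]) simp
        then have "\<bar>c\<bar> \<le> \<bar>I Q\<bar> / v" by (simp add: c_def)
        then have "\<bar>c\<bar> powr p \<le> (\<bar>I Q\<bar> / v) powr p" using p by (intro powr_mono2) auto
        also have "\<dots> = \<bar>I Q\<bar> powr p / v powr p" using v by (simp add: powr_divide)
        finally have "\<bar>c\<bar> powr p * measure lborel Q \<le> \<bar>I Q\<bar> powr p / v powr p * mt"
          using mQ[OF QQ] by (intro mult_mono) auto
        then show "\<bar>c\<bar> powr p * measure lborel Q \<le> mt / v powr p * \<bar>I Q\<bar> powr p" by (simp add: mult.commute)
      qed auto
      finally show ?thesis .
    qed
    have QQm: "Q \<times> Q \<in> sets (borel :: ('a \<times> 'a) measure)" if "Q \<in> \<Q>" for Q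
      using Q(4)[OF that] by (simp add: borel_prod[symmetric] pair_measureI)
    have iT: "integrable lborel (\<lambda>z. indicator (Q \<times> Q) z * \<bar>D w z\<bar> powr p)" if "Q \<in> \<Q>" for Q
      by (rule integrable_indicator_mult[OF QQm[OF that] iD])
    have sumT: "(\<Sum>Q\<in>\<Q>. T Q) \<le> \<E> w"
    proof -
      have "(\<Sum>Q\<in>\<Q>. T Q) = (\<integral>z. (\<Sum>Q\<in>\<Q>. indicator (Q \<times> Q) z * \<bar>D w z\<bar> powr p) \<partial>lborel)"
        unfolding T_def using iT by (subst Bochner_Integration.integral_sum) auto
      also have "\<dots> \<le> \<E> w"
      proof (rule integral_mono[OF _ iD])
        show "integrable lborel (\<lambda>z. \<Sum>Q\<in>\<Q>. indicator (Q \<times> Q) z * \<bar>D w z\<bar> powr p)"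
          using iT by (intro Bochner_Integration.integrable_sum) auto
        fix z
        have "disjoint_family_on (\<lambda>Q. Q \<times> Q) \<Q>"
          using Q(2) unfolding disjoint_family_on_def disjoint_def by blast
        then have "(\<Sum>Q\<in>\<Q>. indicator (Q \<times> Q) z :: real) = indicator (\<Union>Q\<in>\<Q>. Q \<times> Q) z"
          using Q(1) by (simp add: indicator_UN_disjoint)
        then have "(\<Sum>Q\<in>\<Q>. indicator (Q \<times> Q) z :: real) \<le> 1" by (simp add: indicator_def)
        then show "(\<Sum>Q\<in>\<Q>. indicator (Q \<times> Q) z * \<bar>D w z\<bar> powr p) \<le> \<bar>D w z\<bar> powr p"
          by (simp add: mult_left_le_one_le sum_nonneg flip: sum_distrib_right)
      qed
      finally show ?thesis .
    qed
    have "\<N> w = (\<integral>x. indicator \<Omega> x * \<bar>w x\<bar> powr p \<partial>lborel)"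
      by (rule integral_X0_on_\<Omega>[OF w, symmetric])
    also have "\<dots> \<le> (\<integral>x. (\<Sum>Q\<in>\<Q>. indicator Q x * \<bar>w x\<bar> powr p) \<partial>lborel)"
    proof (rule integral_mono)
      show "integrable lborel (\<lambda>x. indicator \<Omega> x * \<bar>w x\<bar> powr p)"
        by (rule integrable_indicator_mult[OF \<Omega> ip])
      show "integrable lborel (\<lambda>x. \<Sum>Q\<in>\<Q>. indicator Q x * \<bar>w x\<bar> powr p)"
        by (intro Bochner_Integration.integrable_sum integrable_indicator_mult[OF Q(4) ip])
      fix x
      show "indicator \<Omega> x * \<bar>w x\<bar> powr p \<le> (\<Sum>Q\<in>\<Q>. indicator Q x * \<bar>w x\<bar> powr p)"
      proof (cases "x \<in> \<Omega>")
        case True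
        then obtain Q0 where "Q0 \<in> \<Q>" "x \<in> Q0" using Q(3) by blast
        then have "indicator \<Omega> x * \<bar>w x\<bar> powr p = indicator Q0 x * \<bar>w x\<bar> powr p" using True by simp
        also have "\<dots> \<le> (\<Sum>Q\<in>\<Q>. indicator Q x * \<bar>w x\<bar> powr p)"
          using \<open>Q0 \<in> \<Q>\<close> Q(1) by (intro member_le_sum) auto
        finally show ?thesis .
      qed (simp add: sum_nonneg)
    qed
    also have "\<dots> = (\<Sum>Q\<in>\<Q>. \<integral>x. indicator Q x * \<bar>w x\<bar> powr p \<partial>lborel)"
      by (rule Bochner_Integration.integral_sum) (rule integrable_indicator_mult[OF Q(4) ip])
    also have "\<dots> \<le> (\<Sum>Q\<in>\<Q>. 2 powr p * (K / v * T Q + mt / v powr p * \<bar>I Q\<bar> powr p))"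
      by (intro sum_mono one)
    also have "\<dots> = \<delta> * (\<Sum>Q\<in>\<Q>. T Q) + C * (\<Sum>Q\<in>\<Q>. \<bar>I Q\<bar> powr p)"
      unfolding coef[symmetric] C_def
      by (simp add: sum.distrib sum_distrib_left distrib_left mult.assoc)
    also have "\<dots> \<le> \<delta> * \<E> w + C * (\<Sum>Q\<in>\<Q>. \<bar>I Q\<bar> powr p)"
      using sumT \<delta> by simp
    finally show "\<N> w \<le> \<delta> * \<E> w
       + C * (\<Sum>Q\<in>\<Q>. \<bar>\<I> Q w\<bar> powr p)"
      by (simp add: I_def)
  qed
qed

text \<open>
  Almost everywhere convergence of functions gives almost everywhere convergence of difference
  quotients, and then Fatou's lemma keeps the limit in \<open>X0\<close>.
\<close>
lemma X0_closed_AE_bounded: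
  assumes u: "\<And>n. u n \<in> X0" and K: "\<And>n. \<E> (u n) \<le> K"
    and v: "in_Lq lborel p v" and lim: "AE x in lborel. (\<lambda>n. u n x) \<longlonglongrightarrow> v x"
  shows "v \<in> X0" "AE z in lborel. (\<lambda>n. D (u n) z) \<longlonglongrightarrow> D v z"
proof -
  have vm: "v \<in> borel_measurable borel" using v by (simp add: in_Lq_def)
  have "AE z in (lborel :: ('a \<times> 'a) measure). (\<lambda>n. u n (fst z)) \<longlonglongrightarrow> v (fst z) \<and> (\<lambda>n. u n (snd z)) \<longlonglongrightarrow> v (snd z)"
    by (rule AE_lborel_pairI[OF lim])
  then show limD: "AE z in lborel. (\<lambda>n. D (u n) z) \<longlonglongrightarrow> D v z"
  proof eventually_elim
    fix z :: "'a \<times> 'a"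
    assume *: "(\<lambda>n. u n (fst z)) \<longlonglongrightarrow> v (fst z) \<and> (\<lambda>n. u n (snd z)) \<longlonglongrightarrow> v (snd z)"
    have "(\<lambda>n. (u n (fst z) - u n (snd z)) * (k (norm (fst z - snd z)) powr (1 / p) / norm (fst z - snd z)))
       \<longlonglongrightarrow> (v (fst z) - v (snd z)) * (k (norm (fst z - snd z)) powr (1 / p) / norm (fst z - snd z))"
      using * by (intro tendsto_intros) auto
    then show "(\<lambda>n. D (u n) z) \<longlonglongrightarrow> D v z"
      by (simp add: diff_quot_def case_prod_beta mult.commute)
  qed
  have "in_Lq lborel p (D v)"
    by (rule fatou_Lq(1)[OF X0D(2)[OF u] K limD _ p]) (use vm in simp)
  moreover have "AE x in lborel. x \<notin> \<Omega> \<longrightarrow> v x = 0"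
  proof -
    have "AE x in lborel. \<forall>n. x \<notin> \<Omega> \<longrightarrow> u n x = 0"
      using X0D(3)[OF u] by (subst AE_all_countable) blast
    then show ?thesis using lim
    proof eventually_elim
      fix x assume "\<forall>n. x \<notin> \<Omega> \<longrightarrow> u n x = 0" "(\<lambda>n. u n x) \<longlonglongrightarrow> v x"
      then show "x \<notin> \<Omega> \<longrightarrow> v x = 0" by (auto simp: LIMSEQ_const_iff)
    qed
  qed
  ultimately show "v \<in> X0" using v by (simp add: X0_iff)
qed

lemma X0_diff_energy_le:
  assumes "u \<in> X0" "v \<in> X0"
  shows "\<E> (\<lambda>x. u x - v x)
    \<le> 2 powr p * (\<E> u + \<E> v)"
proof -
  note i = in_Lq_integrable[OF X0D(2)[OF assms(1)]] in_Lq_integrable[OF X0D(2)[OF assms(2)]]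
  have "\<E> (\<lambda>x. u x - v x) \<le> (\<integral>z. 2 powr p * (\<bar>D u z\<bar> powr p + \<bar>D v z\<bar> powr p) \<partial>lborel)"
    by (rule integral_mono[OF in_Lq_integrable[OF X0D(2)[OF X0_diff[OF assms]]]])
      (use i abs_diff_powr_le[OF p] in \<open>auto simp: D_diff\<close>)
  also have "\<dots> = 2 powr p * (\<E> u + \<E> v)"
    using i by simp
  finally show ?thesis .
qed

text \<open>
  The compact embedding of the energy space into \<open>L^p\<close>, in the form in which it is used: almost
  everywhere convergence of the difference quotients of a subsequence. The integrals over the countably many cubes
  needed for \<open>\<delta> = 1, 1/2, 1/3, ...\<close> converge along one diagonal subsequence, and the compactness estimate
  applied to differences makes this subsequence Cauchy in \<open>L^p\<close>.
\<close>
theorem X0_compact: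
  assumes u: "\<And>n. u n \<in> X0" and K: "\<And>n. \<E> (u n) \<le> K"
  obtains r v where "strict_mono (r :: nat \<Rightarrow> nat)" "v \<in> X0"
    "AE z in lborel. (\<lambda>n. D (u (r n)) z) \<longlonglongrightarrow> D v z"
proof -
  define good where "good m \<Q> C \<longleftrightarrow> finite \<Q> \<and> (\<forall>Q\<in>\<Q>. Q \<in> sets borel \<and> emeasure lborel Q < \<infinity>) \<and>
    (\<forall>w\<in>X0. \<N> w \<le> 1 / real (Suc m) * \<E> w
       + C * (\<Sum>Q\<in>\<Q>. \<bar>\<I> Q w\<bar> powr p))" for m \<Q> C
  have "\<exists>\<Q> C. good m \<Q> C" for m
  proof -
    have "1 / real (Suc m) > 0" by simp
    then obtain \<Q> C where *: "finite \<Q>" "\<And>Q. Q \<in> \<Q> \<Longrightarrow> Q \<in> sets borel \<and> emeasure lborel Q < \<infinity>"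
      "\<And>w. w \<in> X0 \<Longrightarrow> \<N> w \<le> 1 / real (Suc m) * \<E> w
       + C * (\<Sum>Q\<in>\<Q>. \<bar>\<I> Q w\<bar> powr p)"
      by (rule compactness_estimate) (rule that)
    have "good m \<Q> C" unfolding good_def by (intro conjI ballI * )
    then show ?thesis by blast
  qed
  then obtain \<Q> C where good: "\<And>m. good m (\<Q> m) (C m)" by metis
  have Qf: "finite (\<Q> m)" for m using good[of m] unfolding good_def by (rule conjunct1)
  have Qm: "Q \<in> sets borel \<and> emeasure lborel Q < \<infinity>" if "Q \<in> \<Q> m" for m Q
    using good[of m, unfolded good_def, THEN conjunct2, THEN conjunct1] that by (rule bspec)
  have est: "\<N> w \<le> 1 / real (Suc m) * \<E> w
       + C m * (\<Sum>Q\<in>\<Q> m. \<bar>\<I> Q w\<bar> powr p)" if "w \<in> X0" for m w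
    using good[of m, unfolded good_def, THEN conjunct2, THEN conjunct2] that by (rule bspec)
  \<comment> \<open>The empty set is added so that \<open>U\<close> is nonempty and can be enumerated.\<close>
  define U where "U = insert {} (\<Union>m. \<Q> m)"
  have U: "countable U" "U \<noteq> {}" unfolding U_def using Qf by (auto intro: countable_finite)
  have Um: "Q \<in> sets borel" "emeasure lborel Q < \<infinity>" if "Q \<in> U" for Q
    using that Qm by (auto simp: U_def)
  obtain CP where CP: "CP \<ge> 0" "\<And>w. w \<in> X0 \<Longrightarrow> \<N> w \<le> CP * \<E> w"
    using poincare by blast
  define G where "G i j = (\<integral>x. indicator (from_nat_into U i) x * u j x \<partial>lborel)" for i j
  have bdd: "bounded (range (G i))" for i
    unfolding bounded_iff
  proof (intro exI ballI)
    fix y assume "y \<in> range (G i)"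
    then obtain j where y: "y = G i j" by blast
    have "from_nat_into U i \<in> U" using U by (simp add: from_nat_into)
    then have "\<bar>G i j\<bar> \<le> measure lborel (from_nat_into U i) + \<N> (u j)"
      unfolding G_def by (intro integrable_on_finite(2)[OF X0D(1)[OF u]] Um)
    also have "\<N> (u j) \<le> CP * K"
      using CP(2)[OF u[of j]] mult_left_mono[OF K[of j] CP(1)] by linarith
    finally show "norm y \<le> measure lborel (from_nat_into U i) + CP * K" using y by simp
  qed
  obtain r :: "nat \<Rightarrow> nat" where r: "strict_mono r" and conv: "\<And>i. convergent (\<lambda>n. G i (r n))"
    by (rule diagonal_subsequence[of G, OF bdd]) (rule that)
  define w where "w n = u (r n)" for n
  have wX: "w n \<in> X0" for n by (simp add: w_def u)
  have wK: "\<E> (w n) \<le> K" for n by (simp add: w_def K)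
  have convQ: "convergent (\<lambda>n. \<I> Q (w n))" if "Q \<in> U" for Q
  proof -
    obtain i where "from_nat_into U i = Q" using from_nat_into_surj[OF U(1) \<open>Q \<in> U\<close>] by blast
    then show ?thesis using conv[of i] by (simp add: G_def w_def)
  qed
  have K0: "K \<ge> 0" using order_trans[OF Bochner_Integration.integral_nonneg K[of 0]] by simp
  have "Lq_Cauchy lborel p w"
    unfolding Lq_Cauchy_def
  proof (intro allI impI)
    fix e :: real assume e: "e > 0"
    define K' where "K' = 2 powr p * (K + K)"
    have "K' \<ge> 0" using K0 by (simp add: K'_def)
    obtain m where m: "2 * K' / e < real m" using reals_Archimedean2 by blast
    have mK: "1 / real (Suc m) * K' \<le> e / 2"
    proof -
      have "2 * K' < e * real (Suc m)" using m e by (simp add: field_simps)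
      then show ?thesis by (simp add: field_simps)
    qed
    define c where "c Q = lim (\<lambda>n. \<I> Q (w n))" for Q
    define t where "t n = (\<Sum>Q\<in>\<Q> m. \<bar>\<I> Q (w n) - c Q\<bar> powr p)" for n
    have "t \<longlonglongrightarrow> (\<Sum>Q\<in>\<Q> m. \<bar>c Q - c Q\<bar> powr p)"
      unfolding t_def
    proof (intro tendsto_sum tendsto_powr' tendsto_rabs tendsto_diff tendsto_const)
      fix Q assume "Q \<in> \<Q> m"
      then have "Q \<in> U" by (auto simp: U_def)
      then show "(\<lambda>n. \<I> Q (w n)) \<longlonglongrightarrow> c Q"
        using convQ by (simp add: c_def convergent_LIMSEQ_iff)
    qed (use p in auto)
    then have "(\<lambda>n. \<bar>C m\<bar> * 2 powr p * t n) \<longlonglongrightarrow> 0" by (intro tendsto_mult_right_zero) simp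
    then have "eventually (\<lambda>n. \<bar>C m\<bar> * 2 powr p * t n < e / 4) sequentially"
      using e by (intro order_tendstoD(2)) auto
    then obtain N where N: "\<And>n. n \<ge> N \<Longrightarrow> \<bar>C m\<bar> * 2 powr p * t n < e / 4"
      unfolding eventually_sequentially by blast
    show "\<exists>N. \<forall>i\<ge>N. \<forall>j\<ge>N. (\<integral>x. \<bar>w i x - w j x\<bar> powr p \<partial>lborel) \<le> e"
    proof (intro exI allI impI)
      fix i j assume ij: "N \<le> i" "N \<le> j"
      define S where "S = (\<Sum>Q\<in>\<Q> m. \<bar>\<integral>x. indicator Q x * (w i x - w j x) \<partial>lborel\<bar> powr p)"
      have "S \<le> (\<Sum>Q\<in>\<Q> m. 2 powr p * (\<bar>\<I> Q (w i) - c Q\<bar> powr p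
          + \<bar>\<I> Q (w j) - c Q\<bar> powr p))"
        unfolding S_def
      proof (rule sum_mono)
        fix Q assume "Q \<in> \<Q> m"
        note Q = Qm[OF this, THEN conjunct1] Qm[OF this, THEN conjunct2]
        have "(\<integral>x. indicator Q x * (w i x - w j x) \<partial>lborel)
           = (\<I> Q (w i) - c Q) - (\<I> Q (w j) - c Q)"
          using integrable_on_finite(1)[OF X0D(1)[OF wX[of i]] Q] integrable_on_finite(1)[OF X0D(1)[OF wX[of j]] Q]
          by (simp add: right_diff_distrib)
        then show "\<bar>\<integral>x. indicator Q x * (w i x - w j x) \<partial>lborel\<bar> powr p
          \<le> 2 powr p * (\<bar>\<I> Q (w i) - c Q\<bar> powr p
          + \<bar>\<I> Q (w j) - c Q\<bar> powr p)"
          using abs_diff_powr_le[OF p] by metis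
      qed
      also have "\<dots> = 2 powr p * (t i + t j)"
        by (simp add: t_def sum.distrib sum_distrib_left distrib_left)
      finally have S: "S \<le> 2 powr p * (t i + t j)" .
      have S0: "S \<ge> 0" by (simp add: S_def sum_nonneg)
      have "(\<integral>x. \<bar>w i x - w j x\<bar> powr p \<partial>lborel)
        \<le> 1 / real (Suc m) * \<E> (\<lambda>x. w i x - w j x) + C m * S"
        unfolding S_def by (rule est[OF X0_diff[OF wX wX]])
      also have "\<dots> \<le> 1 / real (Suc m) * K' + \<bar>C m\<bar> * (2 powr p * (t i + t j))"
      proof (intro add_mono mult_left_mono)
        have "2 powr p * (\<E> (w i) + \<E> (w j)) \<le> K'"
          unfolding K'_def by (intro mult_left_mono add_mono wK) auto
        then show "\<E> (\<lambda>x. w i x - w j x) \<le> K'"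
          using X0_diff_energy_le[OF wX[of i] wX[of j]] by linarith
        show "C m * S \<le> \<bar>C m\<bar> * (2 powr p * (t i + t j))"
          using S S0 by (intro mult_mono) auto
      qed auto
      also have "\<dots> = 1 / real (Suc m) * K' + (\<bar>C m\<bar> * 2 powr p * t i + \<bar>C m\<bar> * 2 powr p * t j)"
        by (simp add: algebra_simps)
      also have "\<dots> \<le> e" using mK N[OF ij(1)] N[OF ij(2)] by linarith
      finally show "(\<integral>x. \<bar>w i x - w j x\<bar> powr p \<partial>lborel) \<le> e" .
    qed
  qed
  then obtain r' v where r': "strict_mono (r' :: nat \<Rightarrow> nat)" and vm: "v \<in> borel_measurable lborel"
    and lim: "AE x in lborel. (\<lambda>n. w (r' n) x) \<longlonglongrightarrow> v x"
    by (rule Lq_Cauchy_AE_subseq[OF p X0D(1)[OF wX]]) (rule that)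
  have "\<N> (w (r' n)) \<le> CP * K" for n
    using CP(2)[OF wX[of "r' n"]] mult_left_mono[OF wK[of "r' n"] CP(1)] by linarith
  from fatou_Lq(1)[OF X0D(1)[OF wX] this lim vm p] have vL: "in_Lq lborel p v" .
  show ?thesis
  proof (rule that[of "r \<circ> r'" v])
    show "strict_mono (r \<circ> r')" by (rule strict_mono_o[OF r r'])
    show "v \<in> X0" by (rule X0_closed_AE_bounded(1)[OF wX wK vL lim])
    show "AE z in lborel. (\<lambda>n. D (u ((r \<circ> r') n)) z) \<longlonglongrightarrow> D v z"
      using X0_closed_AE_bounded(2)[OF wX wK vL lim] by (simp add: w_def)
  qed
qed

text \<open>
  For completeness of \<open>X0\<close>, the Poincare inequality turns an energy Cauchy sequence into an \<open>L^p\<close> Cauchy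
  sequence. The almost everywhere limit of a subsequence also identifies the limit of the difference
  quotients.
\<close>
sublocale Lq_operator "lborel :: ('a \<times> 'a) measure" p X0 D
proof
  fix u assume u: "\<And>n. u n \<in> X0" and cau: "Lq_Cauchy lborel p (\<lambda>n. D (u n))"
  obtain CP where CP: "CP \<ge> 0" "\<And>w. w \<in> X0 \<Longrightarrow> \<N> w \<le> CP * \<E> w"
    using poincare by blast
  have "Lq_Cauchy lborel p u"
    unfolding Lq_Cauchy_def
  proof (intro allI impI)
    fix e :: real assume e: "e > 0"
    have "e / (CP + 1) > 0" using e CP by simp
    then obtain N where N: "\<And>m n. m \<ge> N \<Longrightarrow> n \<ge> N \<Longrightarrow> (\<integral>z. \<bar>D (u m) z - D (u n) z\<bar> powr p \<partial>lborel) \<le> e / (CP + 1)"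
      using cau unfolding Lq_Cauchy_def by blast
    show "\<exists>N. \<forall>m\<ge>N. \<forall>n\<ge>N. (\<integral>x. \<bar>u m x - u n x\<bar> powr p \<partial>lborel) \<le> e"
    proof (intro exI allI impI)
      fix m n assume "N \<le> m" "N \<le> n"
      have "(\<integral>x. \<bar>u m x - u n x\<bar> powr p \<partial>lborel) \<le> CP * (\<integral>z. \<bar>D (u m) z - D (u n) z\<bar> powr p \<partial>lborel)"
        using CP(2)[OF X0_diff[OF u[of m] u[of n]]] by (simp add: D_diff)
      also have "\<dots> \<le> CP * (e / (CP + 1))" using N[OF \<open>N \<le> m\<close> \<open>N \<le> n\<close>] CP by (intro mult_left_mono) auto
      also have "\<dots> \<le> e" using CP e by (simp add: field_simps)
      finally show "(\<integral>x. \<bar>u m x - u n x\<bar> powr p \<partial>lborel) \<le> e" .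
    qed
  qed
  note cauu = this
  obtain r v where r: "strict_mono (r :: nat \<Rightarrow> nat)" and vm: "v \<in> borel_measurable lborel"
    and lim: "AE x in lborel. (\<lambda>n. u (r n) x) \<longlonglongrightarrow> v x"
    by (rule Lq_Cauchy_AE_subseq[OF p X0D(1)[OF u] cauu]) (rule that)
  have vL: "in_Lq lborel p v" by (rule Lq_Cauchy_tendsto(1)[OF p X0D(1)[OF u] cauu r vm lim])
  obtain V where V: "in_Lq lborel p V" "(\<lambda>n. \<integral>z. \<bar>D (u n) z - V z\<bar> powr p \<partial>lborel) \<longlonglongrightarrow> 0"
    by (rule Lq_complete[OF p X0D(2)[OF u] cau]) (rule that)
  have "eventually (\<lambda>n. (\<integral>z. \<bar>D (u n) z - V z\<bar> powr p \<partial>lborel) < 1) sequentially"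
    using V(2) by (rule order_tendstoD) simp
  then obtain N where N: "\<And>n. n \<ge> N \<Longrightarrow> (\<integral>z. \<bar>D (u n) z - V z\<bar> powr p \<partial>lborel) < 1"
    unfolding eventually_sequentially by blast
  define K where "K = 2 powr p * (1 + (\<integral>z. \<bar>V z\<bar> powr p \<partial>lborel))"
  have K: "\<E> (u (r (n + N))) \<le> K" for n
  proof -
    have rn: "r (n + N) \<ge> N" using seq_suble[OF r, of "n + N"] by linarith
    note L = in_Lq_diff[OF p X0D(2)[OF u[of "r (n + N)"]] V(1)]
    have "\<E> (u (r (n + N)))
      \<le> (\<integral>z. 2 powr p * (\<bar>D (u (r (n + N))) z - V z\<bar> powr p + \<bar>V z\<bar> powr p) \<partial>lborel)"
    proof (rule integral_mono)
      show "\<bar>D (u (r (n + N))) z\<bar> powr p \<le> 2 powr p * (\<bar>D (u (r (n + N))) z - V z\<bar> powr p + \<bar>V z\<bar> powr p)" for z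
        using abs_add_powr_le[OF p, of "D (u (r (n + N))) z - V z" "V z"] by simp
    qed (use in_Lq_integrable[OF L] in_Lq_integrable[OF V(1)] in_Lq_integrable[OF X0D(2)[OF u]] in auto)
    also have "\<dots> = 2 powr p * ((\<integral>z. \<bar>D (u (r (n + N))) z - V z\<bar> powr p \<partial>lborel) + (\<integral>z. \<bar>V z\<bar> powr p \<partial>lborel))"
      using in_Lq_integrable[OF L] in_Lq_integrable[OF V(1)] by simp
    also have "\<dots> \<le> K" unfolding K_def using N[OF rn] by (intro mult_left_mono add_mono) auto
    finally show ?thesis .
  qed
  have lim': "AE x in lborel. (\<lambda>n. u (r (n + N)) x) \<longlonglongrightarrow> v x"
    using lim by eventually_elim (rule LIMSEQ_ignore_initial_segment)
  have vX: "v \<in> X0" by (rule X0_closed_AE_bounded(1)[OF u K vL lim'])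
  have limD: "AE z in lborel. (\<lambda>n. D (u (r (n + N))) z) \<longlonglongrightarrow> D v z"
    by (rule X0_closed_AE_bounded(2)[OF u K vL lim'])
  have r': "strict_mono (\<lambda>n. r (n + N))" using r by (simp add: strict_mono_def)
  have "(\<lambda>n. \<integral>z. \<bar>D (u n) z - D v z\<bar> powr p \<partial>lborel) \<longlonglongrightarrow> 0"
    by (rule Lq_Cauchy_tendsto(2)[OF p X0D(2)[OF u] cau r' _ limD]) (use X0D(4)[OF vX] in simp)
  then show "\<exists>v\<in>X0. (\<lambda>n. \<integral>z. \<bar>D (u n) z - D v z\<bar> powr p \<partial>lborel) \<longlonglongrightarrow> 0" using vX by blast
qed (use p X0_0 X0_add X0_cmult X0D D_add D_cmult in auto)

end

section \<open>Operators, fluxes and H-convergence\<close>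

lemma spow_cmult: "c > 0 \<Longrightarrow> spow q (c * t) = c powr (q - 1) * spow q t"
proof -
  assume c: "c > 0"
  have "c powr (q - 2) * c = c powr (q - 1)"
    using c powr_add[of c "q - 2" 1] by simp
  then show ?thesis using c by (simp add: spow_def abs_mult powr_mult)
qed

lemma spow_mult_scaled: "c > 0 \<Longrightarrow> spow q (c * t) * (c * y) = c powr q * (spow q t * y)"
proof -
  assume c: "c > 0"
  have "c powr (q - 1) * c = c powr q"
    using c powr_add[of c "q - 1" 1] by simp
  then show ?thesis using spow_cmult[OF c, of q t] by (metis mult.assoc mult.left_commute)
qed

lemma in_Lq_bounded_mult:
  assumes q: "q > 1" and [measurable]: "h \<in> borel_measurable M" and h: "AE z in M. \<bar>h z\<bar> \<le> C" and g: "in_Lq M q g"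
  shows "in_Lq M q (\<lambda>z. h z * g z)"
proof -
  note [measurable] = in_LqD[OF g]
  have "integrable M (\<lambda>z. \<bar>C * g z\<bar> powr q)" by (rule in_Lq_integrable[OF in_Lq_cmult[OF g]])
  then have "integrable M (\<lambda>z. \<bar>h z * g z\<bar> powr q)"
  proof (rule Bochner_Integration.integrable_bound)
    show "AE z in M. norm (\<bar>h z * g z\<bar> powr q) \<le> norm (\<bar>C * g z\<bar> powr q)"
      using h
    proof eventually_elim
      fix z assume "\<bar>h z\<bar> \<le> C"
      then have "\<bar>h z * g z\<bar> \<le> \<bar>C * g z\<bar>" by (auto simp: abs_mult intro!: mult_right_mono)
      then show "norm (\<bar>h z * g z\<bar> powr q) \<le> norm (\<bar>C * g z\<bar> powr q)"
        using q by (auto intro!: powr_mono2)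
    qed
  qed simp
  then show ?thesis by (simp add: in_Lq_def)
qed

definition uniformly_elliptic :: "real \<Rightarrow> real \<Rightarrow> ('b::euclidean_space \<Rightarrow> real) \<Rightarrow> bool" where
  "uniformly_elliptic a b h \<longleftrightarrow> h \<in> borel_measurable borel \<and> (AE z in lborel. a \<le> h z \<and> h z \<le> b)"

context nonlocal_space
begin

text \<open>
  Away from the diagonal the difference quotient at a fixed pair is a positive multiple of the
  increment of the function, so that \<open>spow\<close> can be evaluated by homogeneity.
\<close>
lemma scale_factor:
  assumes "x' \<noteq> x"
  obtains c where "c > 0" "\<And>u. D u (x', x) = c * (u x' - u x)"
    "c powr p = k (norm (x' - x)) / norm (x' - x) powr p"
    "c powr (p - 1) = k (norm (x' - x)) powr (1 / conj_exp p) / norm (x' - x) powr (p - 1)"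
proof -
  have pos: "k (norm (x' - x)) > 0" "norm (x' - x) > 0" using assms k_pos by auto
  show ?thesis
  proof (rule that[of "k (norm (x' - x)) powr (1 / p) / norm (x' - x)"])
    show "(k (norm (x' - x)) powr (1 / p) / norm (x' - x)) powr (p - 1)
      = k (norm (x' - x)) powr (1 / conj_exp p) / norm (x' - x) powr (p - 1)"
      using pos p by (simp add: powr_divide powr_powr conj_exp_def)
  qed (use pos p in \<open>auto simp: powr_divide powr_powr diff_quot_def\<close>)
qed

lemma B_form_eq: "B_form p k h u v = (\<integral>z. h z * (spow p (D u z) * D v z) \<partial>lborel)"
  unfolding B_form_def
proof (rule Bochner_Integration.integral_cong[OF refl], clarify)
  fix x' x :: 'a
  show "h (x', x) * k (norm (x' - x)) * (\<bar>u x' - u x\<bar> powr (p - 2) * (u x' - u x) * (v x' - v x) / norm (x' - x) powr p)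
    = h (x', x) * (spow p (D u (x', x)) * D v (x', x))"
  proof (cases "x' = x")
    case False
    then obtain c where c: "c > 0" "\<And>u. D u (x', x) = c * (u x' - u x)"
      "c powr p = k (norm (x' - x)) / norm (x' - x) powr p"
      by (rule scale_factor) (rule that)
    show ?thesis unfolding c(2) spow_mult_scaled[OF c(1)] c(3) by (simp add: spow_def)
  qed (simp add: diff_quot_def)
qed

lemma flux_eq: "flux p k \<Omega> h f = (\<lambda>z. h z * spow p (D (L_inv p k \<Omega> h f) z))"
proof (rule ext, clarify)
  fix x' x :: 'a
  define u where "u = L_inv p k \<Omega> h f"
  show "flux p k \<Omega> h f (x', x) = h (x', x) * spow p (D (L_inv p k \<Omega> h f) (x', x))"
  proof (cases "x' = x")
    case False
    then obtain c where c: "c > 0" "\<And>u. D u (x', x) = c * (u x' - u x)"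
      "c powr (p - 1) = k (norm (x' - x)) powr (1 / conj_exp p) / norm (x' - x) powr (p - 1)"
      by (rule scale_factor) (rule that)
    show ?thesis unfolding c(2) spow_cmult[OF c(1)] c(3) by (simp add: spow_def flux_def Let_def)
  qed (simp add: diff_quot_def flux_def Let_def spow_def)
qed

abbreviation "solves h f u \<equiv> u \<in> X0 \<and> (\<forall>v\<in>X0. (\<integral>z. h z * (spow p (D u z) * D v z) \<partial>lborel) = f v)"

lemma dualD:
  assumes "f \<in> X0_dual p k \<Omega>"
  shows "\<And>u v. u \<in> X0 \<Longrightarrow> v \<in> X0 \<Longrightarrow> f (\<lambda>x. u x + v x) = f u + f v"
    "\<And>c u. u \<in> X0 \<Longrightarrow> f (\<lambda>x. c * u x) = c * f u"
    "\<exists>C. \<forall>u\<in>X0. \<bar>f u\<bar> \<le> C * \<E> u powr (1 / p)"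
proof -
  obtain C where C: "\<forall>u\<in>X0. \<bar>f u\<bar> \<le> C * X0_norm p k u"
    using assms unfolding X0_dual_def dual_space_def by blast
  have "\<forall>u\<in>X0. \<bar>f u\<bar> \<le> C * \<E> u powr (1 / p)"
    using C X0_norm_eq[OF X0D(2)] by metis
  then show "\<exists>C. \<forall>u\<in>X0. \<bar>f u\<bar> \<le> C * \<E> u powr (1 / p)" by blast
qed (use assms in \<open>auto simp: X0_dual_def dual_space_def\<close>)

lemma uniformly_ellipticD:
  assumes "uniformly_elliptic a b h" "0 < a"
  shows "h \<in> borel_measurable lborel" "AE z in lborel. a \<le> h z \<and> h z \<le> b" "AE z in lborel. \<bar>h z\<bar> \<le> b"
proof -
  show *: "h \<in> borel_measurable lborel" "AE z in lborel. a \<le> h z \<and> h z \<le> b"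
    using assms by (auto simp: uniformly_elliptic_def)
  show "AE z in lborel. \<bar>h z\<bar> \<le> b"
    using *(2) by eventually_elim (use assms in auto)
qed

text \<open>
  The representation theorem supplies a solution, so the choice in \<open>L_inv\<close> is a choice from a
  nonempty set.
\<close>
lemma L_inv_solves:
  assumes h: "uniformly_elliptic a b h" and a: "0 < a" and f: "f \<in> X0_dual p k \<Omega>"
  shows "solves h f (L_inv p k \<Omega> h f)"
proof -
  obtain C where C: "\<forall>u\<in>X0. \<bar>f u\<bar> \<le> C * \<E> u powr (1 / p)"
    using dualD(3)[OF f] by blast
  note hD = uniformly_ellipticD[OF h a]
  have "\<exists>u\<in>X0. \<forall>v\<in>X0. (\<integral>z. h z * (spow p (D u z) * D v z) \<partial>lborel) = f v"
    by (rule representation[OF hD(1) a hD(2) dualD(1,2)[OF f]]) (use C in auto)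
  then have "\<exists>u. u \<in> X0 \<and> (\<forall>v\<in>X0. L_op p k h u v = f v)"
    by (auto simp: L_op_def B_form_eq)
  from someI_ex[OF this] show ?thesis
    unfolding L_inv_def[symmetric] by (simp add: L_op_def B_form_eq)
qed

text \<open>
  Testing both equations with \<open>u - v\<close> makes the integral of \<open>h\<close> times a nonnegative monotonicity
  expression vanish. Only the difference quotients are compared, as \<open>u\<close> and \<open>v\<close> enter the notions of
  convergence through them alone.
\<close>
lemma solution_unique:
  assumes h: "uniformly_elliptic a b h" and a: "0 < a" and u: "solves h f u" and v: "solves h f v"
  shows "AE z in lborel. D u z = D v z"
proof -
  note hD = uniformly_ellipticD[OF h a]
  have uX: "u \<in> X0" and vX: "v \<in> X0" using u v by auto
  note uL = X0D(2)[OF uX] and vL = X0D(2)[OF vX]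
  have dX: "(\<lambda>x. u x - v x) \<in> X0" by (rule X0_diff[OF uX vX])
  note dL = X0D(2)[OF dX]
  define G where "G z = (spow p (D u z) - spow p (D v z)) * (D u z - D v z)" for z
  note i = integrable_spow_mult[OF p uL dL, unfolded D_diff] integrable_spow_mult[OF p vL dL, unfolded D_diff]
  have iG: "integrable lborel G"
    using Bochner_Integration.integrable_diff[OF i] by (simp add: G_def[abs_def] left_diff_distrib)
  have G0: "G z \<ge> 0" for z
    using spow_strict_mono[OF p, of "D u z" "D v z"] by (cases "D u z = D v z") (auto simp: G_def)
  have "(\<integral>z. h z * G z \<partial>lborel) = (\<integral>z. h z * (spow p (D u z) * (D u z - D v z)) - h z * (spow p (D v z) * (D u z - D v z)) \<partial>lborel)"
    by (simp add: G_def algebra_simps)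
  also have "\<dots> = (\<integral>z. h z * (spow p (D u z) * (D u z - D v z)) \<partial>lborel) - (\<integral>z. h z * (spow p (D v z) * (D u z - D v z)) \<partial>lborel)"
    by (intro Bochner_Integration.integral_diff integrable_bounded_mult[OF hD(1,3)] i)
  also have "\<dots> = f (\<lambda>x. u x - v x) - f (\<lambda>x. u x - v x)"
    using u[THEN conjunct2, rule_format, OF dX] v[THEN conjunct2, rule_format, OF dX]
    unfolding D_diff by (rule arg_cong2)
  finally have "(\<integral>z. h z * G z \<partial>lborel) = 0" by simp
  moreover have "AE z in lborel. 0 \<le> h z * G z"
    using hD(2) by eventually_elim (use a G0 in \<open>auto intro!: mult_nonneg_nonneg\<close>)
  ultimately have "AE z in lborel. h z * G z = 0"
    using integral_nonneg_eq_0_iff_AE[OF integrable_bounded_mult[OF hD(1,3) iG]] by simp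
  then show ?thesis using hD(2)
  proof eventually_elim
    fix z assume "h z * G z = 0" "a \<le> h z \<and> h z \<le> b"
    then have "G z = 0" using a by auto
    then show "D u z = D v z" using spow_strict_mono[OF p, of "D u z" "D v z"] by (force simp: G_def)
  qed
qed

text \<open>
  Testing with the solution itself gives \<open>a E \<le> |C| E^(1/p)\<close> for its energy \<open>E\<close>. The bound depends
  on \<open>h\<close> only through its lower bound \<open>a\<close>.
\<close>
lemma solution_bound:
  assumes h: "uniformly_elliptic a b h" and a: "0 < a" and u: "solves h f u"
    and C: "\<And>u. u \<in> X0 \<Longrightarrow> \<bar>f u\<bar> \<le> C * \<E> u powr (1 / p)"
  shows "\<E> u \<le> (\<bar>C\<bar> / a) powr (conj_exp p)"
proof -
  note hD = uniformly_ellipticD[OF h a]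
  have uX: "u \<in> X0" using u by blast
  define E where "E = \<E> u"
  have i: "integrable lborel (\<lambda>z. \<bar>D u z\<bar> powr p)" by (rule in_Lq_integrable[OF X0D(2)[OF uX]])
  have E0: "E \<ge> 0" by (simp add: E_def)
  have "(\<integral>z. a * \<bar>D u z\<bar> powr p \<partial>lborel) \<le> (\<integral>z. h z * \<bar>D u z\<bar> powr p \<partial>lborel)"
  proof (rule integral_mono_AE)
    show "integrable lborel (\<lambda>z. h z * \<bar>D u z\<bar> powr p)" by (rule integrable_bounded_mult[OF hD(1,3) i])
    show "AE z in lborel. a * \<bar>D u z\<bar> powr p \<le> h z * \<bar>D u z\<bar> powr p"
      using hD(2) by eventually_elim (auto intro!: mult_right_mono)
  qed (use i in simp)
  also have "\<dots> = f u" using u by (simp flip: spow_mult_self)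
  also have "\<dots> \<le> C * E powr (1 / p)" using C[OF uX] by (simp add: E_def)
  also have "\<dots> \<le> \<bar>C\<bar> * E powr (1 / p)" by (intro mult_right_mono) auto
  finally have le: "a * E \<le> \<bar>C\<bar> * E powr (1 / p)" by (simp add: E_def)
  show ?thesis
  proof (cases "E = 0")
    case False
    then have E: "E > 0" using E0 by simp
    have "E powr (1 - 1 / p) * E powr (1 / p) = E" using E by (simp flip: powr_add)
    then have "(a * E powr (1 - 1 / p)) * E powr (1 / p) \<le> \<bar>C\<bar> * E powr (1 / p)" using le by (simp add: mult.assoc)
    then have "a * E powr (1 - 1 / p) \<le> \<bar>C\<bar>" using E by simp
    then have "E powr (1 - 1 / p) \<le> \<bar>C\<bar> / a" using a by (simp add: pos_le_divide_eq mult.commute)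
    then have "(E powr (1 - 1 / p)) powr (conj_exp p) \<le> (\<bar>C\<bar> / a) powr (conj_exp p)"
      using conj_exp_gt1[OF p] by (intro powr_mono2) auto
    moreover have "(1 - 1 / p) * conj_exp p = 1" using p by (simp add: conj_exp_def field_simps)
    ultimately show ?thesis using E by (simp add: powr_powr E_def)
  qed (simp add: E_def)
qed

text \<open>
  Weak-star convergence of the coefficients already implies H-convergence, for the same limit. In
  \<open>passage\<close> the coefficients converge only weakly, but they multiply products
  \<open>spow p (D (u n)) * g\<close> which converge strongly in \<open>L^1\<close>, because \<open>D (u n)\<close> is bounded in \<open>L^p\<close> and
  converges almost everywhere. Hence every almost everywhere limit solves the limit equation. By
  uniqueness all subsequences have the same limit \<open>D w\<close>, and so do the weak limits of the whole
  sequence. Functionals on \<open>X0\<close> and on \<open>L^p'\<close> are integrals by the representation theorem, which makes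
  the weak convergences instances of the same passage to the limit.
\<close>
theorem weak_star_imp_H_converges:
  assumes a: "0 < a" and hs: "\<And>j. uniformly_elliptic a b (hs j)" and h: "uniformly_elliptic a b h"
    and wstar: "\<And>g. integrable lborel g \<Longrightarrow> (\<lambda>j. \<integral>z. hs j z * g z \<partial>lborel) \<longlonglongrightarrow> (\<integral>z. h z * g z \<partial>lborel)"
  shows "H_converges p k \<Omega> hs h"
  unfolding H_converges_def
proof (intro ballI conjI)
  fix f assume f: "f \<in> X0_dual p k \<Omega>"
  define u where "u j = L_inv p k \<Omega> (hs j) f" for j
  define w where "w = L_inv p k \<Omega> h f"
  have us: "solves (hs j) f (u j)" for j unfolding u_def by (rule L_inv_solves[OF hs a f])
  have ws: "solves h f w" unfolding w_def by (rule L_inv_solves[OF h a f])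
  have uX: "u j \<in> X0" for j using us by blast
  have wX: "w \<in> X0" using ws by blast
  note hsD = uniformly_ellipticD[OF hs a] and hD = uniformly_ellipticD[OF h a]
  have q': "conj_exp p > 1" by (rule conj_exp_gt1[OF p])
  obtain C where C: "\<forall>u\<in>X0. \<bar>f u\<bar> \<le> C * \<E> u powr (1 / p)"
    using dualD(3)[OF f] by blast
  define K where "K = (\<bar>C\<bar> / a) powr (conj_exp p)"
  have uK: "\<E> (u j) \<le> K" for j
    unfolding K_def by (rule solution_bound[OF hs a us]) (use C in blast)
  have passage: "(\<lambda>n. \<integral>z. hs (t n) z * (spow p (D (u (t n)) z) * g z) \<partial>lborel)
      \<longlonglongrightarrow> (\<integral>z. h z * (spow p (D v z) * g z) \<partial>lborel)"
    if t: "strict_mono t" and vX: "v \<in> X0" and lim: "AE z in lborel. (\<lambda>n. D (u (t n)) z) \<longlonglongrightarrow> D v z"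
      and g: "in_Lq lborel p g" for t :: "nat \<Rightarrow> nat" and v g
  proof -
    have sL: "in_Lq lborel (conj_exp p) (\<lambda>z. spow p (D (u (t n)) z))" for n
      by (rule in_Lq_spow[OF p X0D(2)[OF uX]])
    have gL: "in_Lq lborel (conj_exp (conj_exp p)) g" using g by (simp add: conj_exp_conj_exp[OF p])
    have lim': "AE z in lborel. (\<lambda>n. spow p (D (u (t n)) z)) \<longlonglongrightarrow> spow p (D v z)"
      using lim by eventually_elim (rule tendsto_spow[OF p])
    have "(\<lambda>n. \<integral>z. \<bar>spow p (D (u (t n)) z) * g z - spow p (D v z) * g z\<bar> \<partial>lborel) \<longlonglongrightarrow> 0"
      by (rule integral_abs_diff_mult_tendsto_0[OF q' sL _ lim' _ gL, where K = K])
        (use uK X0D(4)[OF vX] in \<open>simp_all add: abs_spow_powr_conj[OF p]\<close>)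
    then have "(\<lambda>n. (\<integral>z. hs (t n) z * (spow p (D (u (t n)) z) * g z) \<partial>lborel)
       - (\<integral>z. hs (t n) z * (spow p (D v z) * g z) \<partial>lborel)) \<longlonglongrightarrow> 0"
      by (intro integral_bounded_mult_diff_tendsto_0[OF hsD(1) hsD(3)] integrable_spow_mult[OF p _ g] X0D uX vX)
    moreover have "(\<lambda>n. \<integral>z. hs (t n) z * (spow p (D v z) * g z) \<partial>lborel) \<longlonglongrightarrow> (\<integral>z. h z * (spow p (D v z) * g z) \<partial>lborel)"
      using LIMSEQ_subseq_LIMSEQ[OF wstar[OF integrable_spow_mult[OF p X0D(2)[OF vX] g]] t] by (simp add: o_def)
    ultimately have "(\<lambda>n. ((\<integral>z. hs (t n) z * (spow p (D (u (t n)) z) * g z) \<partial>lborel)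
       - (\<integral>z. hs (t n) z * (spow p (D v z) * g z) \<partial>lborel)) + (\<integral>z. hs (t n) z * (spow p (D v z) * g z) \<partial>lborel))
       \<longlonglongrightarrow> 0 + (\<integral>z. h z * (spow p (D v z) * g z) \<partial>lborel)" by (rule tendsto_add)
    then show ?thesis by simp
  qed
  have subseq: "\<exists>s. strict_mono s \<and> (AE z in lborel. (\<lambda>n. D (u (r (s n))) z) \<longlonglongrightarrow> D w z)"
    if r: "strict_mono r" for r :: "nat \<Rightarrow> nat"
  proof -
    obtain s v where s: "strict_mono (s :: nat \<Rightarrow> nat)" and vX: "v \<in> X0"
      and lim: "AE z in lborel. (\<lambda>n. D (u (r (s n))) z) \<longlonglongrightarrow> D v z"
      by (rule X0_compact[of "\<lambda>n. u (r n)", OF uX uK]) (rule that)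
    have rs: "strict_mono (\<lambda>n. r (s n))" using r s by (simp add: strict_mono_def)
    have "(\<integral>z. h z * (spow p (D v z) * D \<phi> z) \<partial>lborel) = f \<phi>" if "\<phi> \<in> X0" for \<phi>
    proof (rule LIMSEQ_unique)
      show "(\<lambda>n. \<integral>z. hs (r (s n)) z * (spow p (D (u (r (s n))) z) * D \<phi> z) \<partial>lborel)
         \<longlonglongrightarrow> (\<integral>z. h z * (spow p (D v z) * D \<phi> z) \<partial>lborel)"
        by (rule passage[OF rs vX lim X0D(2)[OF that]])
      show "(\<lambda>n. \<integral>z. hs (r (s n)) z * (spow p (D (u (r (s n))) z) * D \<phi> z) \<partial>lborel) \<longlonglongrightarrow> f \<phi>"
        using us that by simp
    qed
    then have "AE z in lborel. D v z = D w z"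
      using vX by (intro solution_unique[OF h a _ ws]) blast
    then have "AE z in lborel. (\<lambda>n. D (u (r (s n))) z) \<longlonglongrightarrow> D w z"
      using lim by eventually_elim simp
    then show ?thesis using s by blast
  qed
  show "weakly_converges X0 (X0_norm p k) (\<lambda>j. L_inv p k \<Omega> (hs j) f) (L_inv p k \<Omega> h f)"
    unfolding weakly_converges_def u_def[symmetric] w_def[symmetric]
  proof (intro conjI allI ballI uX wX)
    fix \<phi> assume "\<phi> \<in> dual_space X0 (X0_norm p k)"
    then have \<phi>: "\<phi> \<in> X0_dual p k \<Omega>" by (simp add: X0_dual_def)
    \<comment> \<open>The functional \<open>\<phi>\<close> is represented by solving the equation with constant coefficient 1.\<close>
    have one: "uniformly_elliptic 1 1 (\<lambda>z::'a \<times> 'a. 1)" by (simp add: uniformly_elliptic_def)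
    obtain y where yX: "y \<in> X0" and y: "\<And>v. v \<in> X0 \<Longrightarrow> (\<integral>z. spow p (D y z) * D v z \<partial>lborel) = \<phi> v"
      using L_inv_solves[OF one _ \<phi>] by auto
    show "(\<lambda>j. \<phi> (u j)) \<longlonglongrightarrow> \<phi> w"
    proof (rule tendsto_by_subsequences)
      fix r :: "nat \<Rightarrow> nat" assume "strict_mono r"
      from subseq[OF this] obtain s where s: "strict_mono s"
        and lim: "AE z in lborel. (\<lambda>n. D (u (r (s n))) z) \<longlonglongrightarrow> D w z" by blast
      have l0: "(\<lambda>n. \<integral>z. \<bar>D (u (r (s n))) z * spow p (D y z) - D w z * spow p (D y z)\<bar> \<partial>lborel) \<longlonglongrightarrow> 0"
        by (rule integral_abs_diff_mult_tendsto_0[OF p X0D(2)[OF uX] uK lim _ in_Lq_spow[OF p X0D(2)[OF yX]]])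
          (use X0D(4)[OF wX] in simp)
      have ii: "integrable lborel (\<lambda>z. D v z * spow p (D y z))" if "v \<in> X0" for v
        by (rule in_Lq_mult[OF p X0D(2)[OF that] in_Lq_spow[OF p X0D(2)[OF yX]]])
      have "(\<lambda>n. (\<integral>z. 1 * (D (u (r (s n))) z * spow p (D y z)) \<partial>lborel)
          - (\<integral>z. 1 * (D w z * spow p (D y z)) \<partial>lborel)) \<longlonglongrightarrow> 0"
        by (rule integral_bounded_mult_diff_tendsto_0[where h = "\<lambda>_ _. 1" and C = 1, OF _ _ ii[OF uX] ii[OF wX] l0]) auto
      then have "(\<lambda>n. \<phi> (u (r (s n))) - \<phi> w) \<longlonglongrightarrow> 0"
        using y[OF uX] y[OF wX] by (simp add: mult.commute)
      from LIM_zero_cancel[OF this] s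
      show "\<exists>s. strict_mono s \<and> (\<lambda>n. \<phi> (u (r (s n)))) \<longlonglongrightarrow> \<phi> w" by (intro exI[of _ s] conjI)
    qed
  qed
  show "weakly_converges (Lp_space (conj_exp p)) (Lp_norm (conj_exp p)) (\<lambda>j. flux p k \<Omega> (hs j) f) (flux p k \<Omega> h f)"
    unfolding weakly_converges_def flux_eq u_def[symmetric] w_def[symmetric] Lp_space_iff
  proof (intro conjI allI ballI)
    show fL: "in_Lq lborel (conj_exp p) (\<lambda>z. hs j z * spow p (D (u j) z))" for j
      by (rule in_Lq_bounded_mult[OF q' hsD(1,3) in_Lq_spow[OF p X0D(2)[OF uX]]])
    show fL': "in_Lq lborel (conj_exp p) (\<lambda>z. h z * spow p (D w z))"
      by (rule in_Lq_bounded_mult[OF q' hD(1,3) in_Lq_spow[OF p X0D(2)[OF wX]]])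
    fix \<phi> assume \<phi>: "\<phi> \<in> dual_space (Lp_space (conj_exp p)) (Lp_norm (conj_exp p) :: ('a \<times> 'a \<Rightarrow> real) \<Rightarrow> real)"
    obtain C' where C': "\<forall>u\<in>Lp_space (conj_exp p). \<bar>\<phi> u\<bar> \<le> C' * Lp_norm (conj_exp p) u"
      using \<phi> unfolding dual_space_def by blast
    obtain g where gL: "in_Lq lborel (conj_exp (conj_exp p)) g"
      and g: "\<And>v. in_Lq lborel (conj_exp p) v \<Longrightarrow> \<phi> v = (\<integral>z. g z * v z \<partial>lborel)"
    proof (rule Lq_dual_representation[OF q', of lborel \<phi> C'])
      show "\<And>u v. in_Lq lborel (conj_exp p) u \<Longrightarrow> in_Lq lborel (conj_exp p) v \<Longrightarrow> \<phi> (\<lambda>x. u x + v x) = \<phi> u + \<phi> v"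
        "\<And>c u. in_Lq lborel (conj_exp p) u \<Longrightarrow> \<phi> (\<lambda>x. c * u x) = c * \<phi> u"
        using \<phi> by (auto simp: dual_space_def Lp_space_iff)
      show "\<And>u. in_Lq lborel (conj_exp p) u \<Longrightarrow> \<bar>\<phi> u\<bar> \<le> C' * (\<integral>z. \<bar>u z\<bar> powr conj_exp p \<partial>lborel) powr (1 / conj_exp p)"
        using C' by (simp add: Lp_space_iff Lp_norm_def)
    qed (rule that)
    have gp: "in_Lq lborel p g" using gL by (simp add: conj_exp_conj_exp[OF p])
    show "(\<lambda>j. \<phi> (\<lambda>z. hs j z * spow p (D (u j) z))) \<longlonglongrightarrow> \<phi> (\<lambda>z. h z * spow p (D w z))"
    proof (rule tendsto_by_subsequences)
      fix r :: "nat \<Rightarrow> nat" assume r: "strict_mono r"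
      from subseq[OF this] obtain s where s: "strict_mono s"
        and lim: "AE z in lborel. (\<lambda>n. D (u (r (s n))) z) \<longlonglongrightarrow> D w z" by blast
      have rs: "strict_mono (\<lambda>n. r (s n))" using r s by (simp add: strict_mono_def)
      have "(\<lambda>n. \<phi> (\<lambda>z. hs (r (s n)) z * spow p (D (u (r (s n))) z))) \<longlonglongrightarrow> \<phi> (\<lambda>z. h z * spow p (D w z))"
        using passage[OF rs wX lim gp] unfolding g[OF fL] g[OF fL'] by (simp add: mult.commute mult.left_commute)
      then show "\<exists>s. strict_mono s \<and> (\<lambda>n. \<phi> (\<lambda>z. hs (r (s n)) z * spow p (D (u (r (s n))) z))) \<longlonglongrightarrow> \<phi> (\<lambda>z. h z * spow p (D w z))"
        using s by (intro exI[of _ s] conjI)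
    qed
  qed
qed

end

text \<open>
  The exchange of the two variables preserves Lebesgue measure, so that testing with \<open>g\<close> and with \<open>g\<close>
  after the exchange gives the same limit. The functions \<open>h0\<close> and \<open>h0\<close> after the exchange then have the same
  integral against the sign of their difference.
\<close>
lemma weak_star_limit_symmetric:
  fixes h0 :: "'a::euclidean_space \<times> 'a \<Rightarrow> real"
  assumes h0: "h0 \<in> borel_measurable borel" "AE z in lborel. \<bar>h0 z\<bar> \<le> c"
    and sym: "\<And>j. AE z in lborel. hs j z = hs j (prod.swap z)" and hsm: "\<And>j. hs j \<in> borel_measurable borel"
    and lim: "\<And>g. integrable lborel g \<Longrightarrow> (\<lambda>j. \<integral>z. hs j z * g z \<partial>lborel) \<longlonglongrightarrow> (\<integral>z. h0 z * g z \<partial>lborel)"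
  shows "AE z in lborel. h0 z = h0 (prod.swap z)"
proof -
  have [measurable]: "prod.swap \<in> (borel :: ('a \<times> 'a) measure) \<rightarrow>\<^sub>M borel"
    unfolding prod.swap_def by (intro borel_measurable_continuous_onI continuous_intros)
  note [measurable] = h0(1) hsm
  have swap_int: "integrable lborel (\<lambda>z. g (prod.swap z))" if "integrable lborel g" for g :: "'a \<times> 'a \<Rightarrow> real"
    using lborel_pair.integrable_product_swap[of g] that by (simp add: lborel_prod prod.swap_def case_prod_unfold)
  have swap_eq: "(\<integral>z. g (prod.swap z) \<partial>lborel) = (\<integral>z. g z \<partial>lborel)" if "g \<in> borel_measurable borel" for g :: "'a \<times> 'a \<Rightarrow> real"
    using lborel_pair.integral_product_swap[of g] that by (simp add: lborel_prod prod.swap_def case_prod_unfold)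
  have h0m: "h0 \<in> borel_measurable lborel" using h0 by simp
  have key: "(\<integral>z. h0 z * g z \<partial>lborel) = (\<integral>z. h0 (prod.swap z) * g z \<partial>lborel)"
    and ikey: "integrable lborel (\<lambda>z. h0 (prod.swap z) * g z)" if g: "integrable lborel g" for g
  proof -
    have gm [measurable]: "g \<in> borel_measurable borel" using borel_measurable_integrable[OF g] by simp
    have "(\<integral>z. hs j z * g z \<partial>lborel) = (\<integral>z. hs j z * g (prod.swap z) \<partial>lborel)" for j
    proof -
      have "(\<integral>z. hs j z * g z \<partial>lborel) = (\<integral>z. hs j (prod.swap z) * g z \<partial>lborel)"
        by (rule integral_cong_AE) (use sym[of j] in auto)
      also have "\<dots> = (\<integral>z. hs j (prod.swap (prod.swap z)) * g (prod.swap z) \<partial>lborel)"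
        by (rule swap_eq[symmetric]) simp
      finally show ?thesis by simp
    qed
    then have "(\<integral>z. h0 z * g z \<partial>lborel) = (\<integral>z. h0 z * g (prod.swap z) \<partial>lborel)"
      using LIMSEQ_unique[OF lim[OF g]] lim[OF swap_int[OF g]] by simp
    also have "\<dots> = (\<integral>z. h0 (prod.swap z) * g (prod.swap (prod.swap z)) \<partial>lborel)"
      by (rule swap_eq[symmetric]) simp
    finally show "(\<integral>z. h0 z * g z \<partial>lborel) = (\<integral>z. h0 (prod.swap z) * g z \<partial>lborel)" by simp
    show "integrable lborel (\<lambda>z. h0 (prod.swap z) * g z)"
      using swap_int[OF integrable_bounded_mult[OF h0m h0(2) swap_int[OF g]]] by simp
  qed
  define d where "d z = h0 z - h0 (prod.swap z)" for z
  have dm [measurable]: "d \<in> borel_measurable borel" unfolding d_def by measurable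
  have "AE z in lborel. z \<in> ball 0 (real n) \<longrightarrow> d z = 0" for n
  proof -
    define g where "g z = indicator (ball 0 (real n)) z * (if 0 < d z then 1 else - 1 :: real)" for z
    have bm [measurable]: "ball (0 :: 'a \<times> 'a) (real n) \<in> sets borel" by simp
    have gm [measurable]: "g \<in> borel_measurable borel" unfolding g_def by measurable
    have "integrable lborel (indicator (ball (0::'a \<times> 'a) (real n)) :: _ \<Rightarrow> real)"
      using emeasure_bounded_finite[OF bounded_ball[of "0::'a \<times> 'a" "real n"]] by (intro integrable_real_indicator) auto
    then have g: "integrable lborel g"
      by (rule Bochner_Integration.integrable_bound) (auto simp: g_def indicator_def)
    have ih: "integrable lborel (\<lambda>z. h0 z * g z)" by (rule integrable_bounded_mult[OF h0m h0(2) g])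
    have eq: "h0 z * g z - h0 (prod.swap z) * g z = indicator (ball 0 (real n)) z * \<bar>d z\<bar>" for z
      by (auto simp: g_def d_def indicator_def)
    have i: "integrable lborel (\<lambda>z. indicator (ball 0 (real n)) z * \<bar>d z\<bar>)"
      using Bochner_Integration.integrable_diff[OF ih ikey[OF g]] unfolding eq .
    have "(\<integral>z. indicator (ball 0 (real n)) z * \<bar>d z\<bar> \<partial>lborel) = 0"
      using Bochner_Integration.integral_diff[OF ih ikey[OF g]] key[OF g] unfolding eq by simp
    then have "AE z in lborel. indicator (ball 0 (real n)) z * \<bar>d z\<bar> = 0"
      using integral_nonneg_eq_0_iff_AE[OF i] by simp
    then show ?thesis by eventually_elim auto
  qed
  then have "AE z in lborel. \<forall>n. z \<in> ball 0 (real n) \<longrightarrow> d z = 0" by (subst AE_all_countable) blast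
  then show ?thesis
  proof eventually_elim
    fix z :: "'a \<times> 'a" assume *: "\<forall>n. z \<in> ball 0 (real n) \<longrightarrow> d z = 0"
    obtain n where "norm z < real n" using reals_Archimedean2 by blast
    then have "d z = 0" using *[rule_format, of n] by simp
    then show "h0 z = h0 (prod.swap z)" by (simp add: d_def)
  qed
qed

theorem theorem5:
  fixes \<Omega> :: "'a::euclidean_space set"
    and p s c0 hmin hmax :: real
    and k :: "real \<Rightarrow> real"
    and hs :: "nat \<Rightarrow> 'a \<times> 'a \<Rightarrow> real"
  assumes "bounded_smooth_domain \<Omega>"
    and "1 < p"
    and "0 < s" and "s < 1" and "0 < c0"
    and "admissible_kernel TYPE('a) p s c0 k"
    and "0 < hmin" and "hmin < hmax"
    and "\<And>j. hs j \<in> H_class hmin hmax"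
  shows "\<exists>r h. strict_mono (r :: nat \<Rightarrow> nat) \<and> h \<in> H_class hmin hmax \<and>
           weakly_star_converges_Linfty (\<lambda>j. hs (r j)) h \<and>
           H_converges p k \<Omega> (\<lambda>j. hs (r j)) h"
proof -
  interpret nonlocal_space \<Omega> p s c0 k
    using assms by unfold_locales (auto simp: bounded_smooth_domain_def)
  have hsm: "hs j \<in> borel_measurable lborel" for j
    using assms(9)[of j] by (simp add: H_class_def Linfty_space_def)
  have hsa: "AE z in lborel. hs j z = hs j (prod.swap z) \<and> hmin \<le> hs j z \<and> hs j z \<le> hmax" for j
    using assms(9)[of j] by (simp add: H_class_def case_prod_beta prod.swap_def)
  have hsb: "AE z in lborel. hmin \<le> hs j z \<and> hs j z \<le> hmax" for j
    using hsa[of j] by eventually_elim simp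
  obtain r h where r: "strict_mono (r :: nat \<Rightarrow> nat)" and hm: "h \<in> borel_measurable lborel"
    and hb: "AE z in lborel. hmin \<le> h z \<and> h z \<le> hmax"
    and lim: "\<And>g. integrable lborel g \<Longrightarrow> (\<lambda>n. \<integral>z. hs (r n) z * g z \<partial>lborel) \<longlonglongrightarrow> (\<integral>z. h z * g z \<partial>lborel)"
    by (rule weak_star_compactness[OF sigma_finite_lborel hsm hsb]) (rule that)
  have ell: "uniformly_elliptic hmin hmax h" "\<And>j. uniformly_elliptic hmin hmax (hs j)"
    using hm hb hsm hsb by (auto simp: uniformly_elliptic_def)
  have sym: "AE z in lborel. h z = h (prod.swap z)"
  proof (rule weak_star_limit_symmetric[where hs = "\<lambda>n. hs (r n)"])
    show "AE z in lborel. \<bar>h z\<bar> \<le> hmax" by (rule uniformly_ellipticD(3)[OF ell(1) assms(7)])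
    show "AE z in lborel. hs (r j) z = hs (r j) (prod.swap z)" for j
      using hsa[of "r j"] by eventually_elim simp
  qed (use hm hsm lim in auto)
  have Linf: "g \<in> Linfty_space" if "uniformly_elliptic hmin hmax g" for g :: "'a \<times> 'a \<Rightarrow> real"
    using uniformly_ellipticD[OF that assms(7)] by (auto simp: Linfty_space_def)
  have "h \<in> H_class hmin hmax"
  proof -
    have "AE z in lborel. h z = h (prod.swap z) \<and> hmin \<le> h z \<and> h z \<le> hmax"
      using sym hb by eventually_elim simp
    then show ?thesis using Linf[OF ell(1)] by (simp add: H_class_def case_prod_beta prod.swap_def)
  qed
  moreover have "weakly_star_converges_Linfty (\<lambda>j. hs (r j)) h"
    using Linf ell lim by (simp add: weakly_star_converges_Linfty_def)
  moreover have "H_converges p k \<Omega> (\<lambda>j. hs (r j)) h"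
    by (rule weak_star_imp_H_converges[OF assms(7) ell(2) ell(1) lim])
  ultimately show ?thesis using r by blast
qed

end
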